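(* Let $D$ be a division ring, $n$ a positive integer, and $G$ a subgroup of $\mathrm{GL}_n(D)$. In case $n\ge 2$, suppose further that $D$ is not a locally finite field. Then the following assertions hold. (1) If $G$ is a periodic locally generalized radical ascendant subgroup of $\mathrm{GL}_n(D)$, then $G$ is central, i.e. $G\subseteq Z(\mathrm{GL}_n(D))$. (2) If $G$ is a periodic locally generalized radical ascendant subgroup of $\mathrm{SL}_n(D)$, then $G\subseteq Z(\mathrm{SL}_n(D))$. (3) The group $\mathrm{PGL}_n(D)$ contains no non-trivial periodic locally generalized radical ascendant subgroups. (4) The group $\mathrm{PSL}_n(D)$ contains no non-trivial periodic locally generalized radical ascendant subgroups.
   Context: $Z(X)$ denotes the center of a group $X$. $\mathrm{GL}_n(D)$ is the group of invertible $n\times n$ matrices over $D$; $\mathrm{SL}_n(D)$ is the kernel of the Dieudonné determinant $\mathrm{GL}_n(D)\to D^*/[D^*,D^*]$ (so $\mathrm{SL}_1(D)=[D^*,D^*]$); $\mathrm{PGL}_n(D)=\mathrm{GL}_n(D)/Z(\mathrm{GL}_n(D))$ and $\mathrm{PSL}_n(D)=\mathrm{SL}_n(D)/Z(\mathrm{SL}_n(D))$. A locally finite field is a field in which every finite subset generates a finite subfield. A subgroup $H$ of a group $X$ is ascendant in $X$ if there is an ordinal $\gamma$ and a family of subgroups $(H_\alpha)_{\alpha\le\gamma}$ with $H_0=H$, $H_\gamma=X$, $H_\alpha\trianglelefteq H_{\alpha+1}$ for all $\alpha<\gamma$, and $H_\lambda=\bigcup_{\alpha<\lambda}H_\alpha$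 for every limit ordinal $\lambda\le\gamma$. A group is periodic if each of its elements has finite order. A group is generalized radical if it has an ascending (possibly transfinite) normal series, starting at $1$ and ending at the group (with unions at limit ordinals), each of whose factors is locally nilpotent or locally finite; it is locally generalized radical if all its finitely generated subgroups are generalized radical. *)

theory Defs
  imports
    "HOL-Algebra.Generated_Groups"
    "HOL-Algebra.Generated_Fields"
    "HOL-Algebra.Algebraic_Closure_Type"
    "Jordan_Normal_Form.Matrix"
begin

section \<open>Group-theoretic notions\<close>

definition center :: "('a, 'b) monoid_scheme \<Rightarrow> 'a set" where
  "center G = {z \<in> carrier G. \<forall>x \<in> carrier G. z \<otimes>\<^bsub>G\<^esub> x = x \<otimes>\<^bsub>G\<^esub> z}"

definition periodic_group :: "('a, 'b) monoid_scheme \<Rightarrow> bool" where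
  "periodic_group G \<longleftrightarrow> (\<forall>x \<in> carrier G. \<exists>k::nat. k > 0 \<and> x [^]\<^bsub>G\<^esub> k = \<one>\<^bsub>G\<^esub>)"

definition finite_group :: "('a, 'b) monoid_scheme \<Rightarrow> bool" where
  "finite_group G \<longleftrightarrow> finite (carrier G)"

primrec lower_central :: "('a, 'b) monoid_scheme \<Rightarrow> nat \<Rightarrow> 'a set" where
  "lower_central G 0 = carrier G"
| "lower_central G (Suc k) = generate G
     (\<Union>x \<in> lower_central G k. \<Union>y \<in> carrier G.
        {x \<otimes>\<^bsub>G\<^esub> y \<otimes>\<^bsub>G\<^esub> inv\<^bsub>G\<^esub> x \<otimes>\<^bsub>G\<^esub> inv\<^bsub>G\<^esub> y})"

definition nilpotent_group :: "('a, 'b) monoid_scheme \<Rightarrow> bool" where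
  "nilpotent_group G \<longleftrightarrow> (\<exists>k. lower_central G k = {\<one>\<^bsub>G\<^esub>})"

definition locally_group ::
  "(('a, 'b) monoid_scheme \<Rightarrow> bool) \<Rightarrow> ('a, 'b) monoid_scheme \<Rightarrow> bool" where
  "locally_group P G \<longleftrightarrow>
     (\<forall>A. finite A \<and> A \<subseteq> carrier G \<longrightarrow> P (G\<lparr>carrier := generate G A\<rparr>))"

section \<open>Ascending series\<close>

text \<open>
  The ordinals \<open>\<alpha> \<le> \<gamma>\<close> are the elements of the field of a well-order \<open>r\<close> having a largest
  element. An index \<open>\<beta>\<close> is the successor of \<open>\<alpha>\<close> iff the indices strictly below \<open>\<beta>\<close> are
  exactly those weakly below \<open>\<alpha>\<close>; a limit is an index that is neither least nor a successor.
  The predicate \<open>step\<close> is the condition relating consecutive terms.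
\<close>

definition ascending_series ::
  "('a, 'b) monoid_scheme \<Rightarrow> ('a set \<Rightarrow> 'a set \<Rightarrow> bool) \<Rightarrow> 'i rel \<Rightarrow> ('i \<Rightarrow> 'a set)
     \<Rightarrow> 'a set \<Rightarrow> 'a set \<Rightarrow> bool" where
  "ascending_series G step r S H K \<longleftrightarrow>
     Well_order r \<and>
     (\<forall>\<alpha> \<in> Field r. subgroup (S \<alpha>) G) \<and>
     (\<exists>z \<in> Field r. underS r z = {} \<and> S z = H) \<and>
     (\<exists>t \<in> Field r. under r t = Field r \<and> S t = K) \<and>
     (\<forall>\<alpha> \<in> Field r. \<forall>\<beta> \<in> Field r. underS r \<beta> = under r \<alpha> \<longrightarrow> step (S \<alpha>) (S \<beta>)) \<and>
     (\<forall>l \<in> Field r. underS r l \<noteq> {} \<and> \<not> (\<exists>\<alpha> \<in> Field r. underS r l = under r \<alpha>)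
        \<longrightarrow> S l = (\<Union>\<alpha> \<in> underS r l. S \<alpha>))"

text \<open>
  In the next two definitions the series is indexed by a well-order on the type of subsets of
  the group. This is no restriction on the ordinal: after deletion of repetitions a series is
  indexed by its own terms, see \<open>ascendantI\<close> and \<open>generalized_radicalI\<close> below.
\<close>

definition ascendant :: "'a set \<Rightarrow> ('a, 'b) monoid_scheme \<Rightarrow> bool" where
  "ascendant H G \<longleftrightarrow>
     (\<exists>(r :: 'a set rel) S.
        ascending_series G (\<lambda>A B. A \<lhd> G\<lparr>carrier := B\<rparr>) r S H (carrier G))"

text \<open>
  Each term of the series is only required to be normal in its successor. This is implied by
  normality in the whole group, so both usages of ``normal series'' are covered.
\<close>

definition radical_step :: "('a, 'b) monoid_scheme \<Rightarrow> 'a set \<Rightarrow> 'a set \<Rightarrow> bool" where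
  "radical_step G A B \<longleftrightarrow>
     A \<lhd> G\<lparr>carrier := B\<rparr> \<and>
     (locally_group nilpotent_group (G\<lparr>carrier := B\<rparr> Mod A) \<or>
      locally_group finite_group (G\<lparr>carrier := B\<rparr> Mod A))"

definition generalized_radical :: "('a, 'b) monoid_scheme \<Rightarrow> bool" where
  "generalized_radical G \<longleftrightarrow>
     (\<exists>(r :: 'a set rel) S. ascending_series G (radical_step G) r S {\<one>\<^bsub>G\<^esub>} (carrier G))"

lemma ascending_series_reindex:
  fixes r :: "'i rel" and G :: "('a, 'b) monoid_scheme"
  assumes ser: "ascending_series G step r S H K"
    and step_sub: "\<And>A B. step A B \<Longrightarrow> A \<subseteq> B"
  shows "\<exists>(r' :: 'a set rel) S'. ascending_series G step r' S' H K"
proof -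
  have wo: "Well_order r"
    and sub: "\<And>\<alpha>. \<alpha> \<in> Field r \<Longrightarrow> subgroup (S \<alpha>) G"
    and suc: "\<And>\<alpha> \<beta>. \<lbrakk>\<alpha> \<in> Field r; \<beta> \<in> Field r; underS r \<beta> = under r \<alpha>\<rbrakk> \<Longrightarrow> step (S \<alpha>) (S \<beta>)"
    and lim: "\<And>l. \<lbrakk>l \<in> Field r; underS r l \<noteq> {}; \<not> (\<exists>\<alpha> \<in> Field r. underS r l = under r \<alpha>)\<rbrakk>
                \<Longrightarrow> S l = (\<Union>\<alpha> \<in> underS r l. S \<alpha>)"
    using ser unfolding ascending_series_def by blast+
  obtain z where z: "z \<in> Field r" "underS r z = {}" "S z = H"
    using ser unfolding ascending_series_def by blast
  obtain t where t: "t \<in> Field r" "under r t = Field r" "S t = K"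
    using ser unfolding ascending_series_def by blast
  have rf: "\<And>a. a \<in> Field r \<Longrightarrow> (a, a) \<in> r" and tr: "trans r" and an: "antisym r"
    and wf: "wf (r - Id)"
    using wo unfolding order_on_defs by (auto simp: refl_on_def)
  have tot: "\<And>a b. \<lbrakk>a \<in> Field r; b \<in> Field r\<rbrakk> \<Longrightarrow> (a, b) \<in> r \<or> (b, a) \<in> r"
    using wo rf unfolding order_on_defs total_on_def by metis
  have ind: "P a" if "a \<in> Field r"
    and "\<And>x. \<lbrakk>x \<in> Field r; \<And>y. y \<in> underS r x \<Longrightarrow> P y\<rbrakk> \<Longrightarrow> P x" for P and a :: 'i
  proof -
    have "a \<in> Field r \<longrightarrow> P a"
    proof (rule wf_induct[OF wf])
      fix x assume "\<forall>y. (y, x) \<in> r - Id \<longrightarrow> y \<in> Field r \<longrightarrow> P y"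
      then show "x \<in> Field r \<longrightarrow> P x"
        using that(2)[of x] unfolding underS_def by (auto intro: FieldI1)
    qed
    with that(1) show ?thesis by blast
  qed
  have least: "\<exists>m. m \<in> Field r \<and> Q m \<and> (\<forall>y. y \<in> underS r m \<longrightarrow> \<not> Q y)"
    if "a \<in> Field r" "Q a" for Q and a :: 'i
    using ind[of a "\<lambda>x. \<not> Q x"] that by blast
  have mono: "b \<in> Field r \<Longrightarrow> (a, b) \<in> r \<Longrightarrow> S a \<subseteq> S b" for a b
  proof -
    assume b: "b \<in> Field r" and ab: "(a, b) \<in> r"
    have "\<forall>a. (a, b) \<in> r \<longrightarrow> S a \<subseteq> S b"
    proof (rule ind[OF b])
      fix x assume x: "x \<in> Field r"
        and IH: "\<And>y. y \<in> underS r x \<Longrightarrow> \<forall>a. (a, y) \<in> r \<longrightarrow> S a \<subseteq> S y"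
      show "\<forall>a. (a, x) \<in> r \<longrightarrow> S a \<subseteq> S x"
      proof (intro allI impI)
        fix a assume ax: "(a, x) \<in> r"
        show "S a \<subseteq> S x"
        proof (cases "a = x")
          case False
          then have aU: "a \<in> underS r x" using ax by (simp add: underS_def)
          show ?thesis
          proof (cases "\<exists>\<alpha> \<in> Field r. underS r x = under r \<alpha>")
            case True
            then obtain \<alpha> where \<alpha>: "\<alpha> \<in> Field r" "underS r x = under r \<alpha>" by blast
            have "\<alpha> \<in> underS r x" using \<alpha> rf by (simp add: under_def)
            moreover have "(a, \<alpha>) \<in> r" using aU \<alpha> by (simp add: under_def)
            ultimately have "S a \<subseteq> S \<alpha>" using IH by blast
            then show ?thesis using step_sub[OF suc[OF \<alpha>(1) x \<alpha>(2)]] by blast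
          next
            case False
            then show ?thesis using lim[OF x] aU by blast
          qed
        qed simp
      qed
    qed
    then show ?thesis using ab by blast
  qed
  have strict: "(a, b) \<in> r \<and> a \<noteq> b" if "a \<in> Field r" "b \<in> Field r" "S a \<subset> S b" for a b
    using tot[OF that(1,2)] mono[OF that(1), of b] that(3) by blast
  define C where "C = S ` Field r"
  define r' where "r' = {(A, B). A \<in> C \<and> B \<in> C \<and> A \<subseteq> B}"
  have F: "Field r' = C" unfolding r'_def Field_def by auto
  have totC: "A \<subseteq> B \<or> B \<subseteq> A" if "A \<in> C" "B \<in> C" for A B
    using that tot mono unfolding C_def by (metis imageE)
  have uS: "underS r' B = {A \<in> C. A \<subset> B}" if "B \<in> C" for B
    using that unfolding underS_def r'_def by auto
  have u: "under r' B = {A \<in> C. A \<subseteq> B}" if "B \<in> C" for B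
    using that unfolding under_def r'_def by auto
  have first: "\<exists>m. m \<in> Field r \<and> S m = A \<and> (\<forall>y \<in> underS r m. S y \<subset> A)" if A: "A \<in> C" for A
  proof -
    from A obtain a where "a \<in> Field r" "S a = A" unfolding C_def by blast
    from least[OF this(1), of "\<lambda>x. S x = A", OF this(2)] obtain m where
      m: "m \<in> Field r" "S m = A" "\<forall>y. y \<in> underS r m \<longrightarrow> S y \<noteq> A" by blast
    then show ?thesis using mono[OF m(1)] unfolding underS_def by blast
  qed
  have wf': "wf (r' - Id)"
  proof (rule wfI_min)
    fix A :: "'a set" and Q assume AQ: "A \<in> Q"
    show "\<exists>B \<in> Q. \<forall>y. (y, B) \<in> r' - Id \<longrightarrow> y \<notin> Q"
    proof (cases "\<exists>a \<in> Field r. S a \<in> Q")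
      case True
      then obtain a where a: "a \<in> Field r" "S a \<in> Q" by blast
      from least[OF a(1), of "\<lambda>x. S x \<in> Q", OF a(2)] obtain m where
        m: "m \<in> Field r" "S m \<in> Q" "\<forall>y. y \<in> underS r m \<longrightarrow> S y \<notin> Q" by blast
      have "B \<notin> Q" if "(B, S m) \<in> r' - Id" for B
      proof -
        from that obtain b where b: "b \<in> Field r" "S b = B" "S b \<subset> S m"
          unfolding r'_def C_def by blast
        then show ?thesis using strict[OF b(1) m(1) b(3)] m(3) unfolding underS_def by blast
      qed
      then show ?thesis using m(2) by blast
    next
      case False
      then have "\<forall>y. (y, A) \<in> r' - Id \<longrightarrow> y \<notin> Q" unfolding r'_def C_def by blast
      then show ?thesis using AQ by blast
    qed
  qed
  have wo': "Well_order r'"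
    unfolding order_on_defs F using wf' totC
    by (auto simp: r'_def refl_on_def trans_def antisym_def total_on_def)
  have "ascending_series G step r' (\<lambda>A. A) H K"
    unfolding ascending_series_def F
  proof (intro conjI ballI impI)
    show "well_order_on C r'" using wo' unfolding F .
    show "subgroup A G" if "A \<in> C" for A using that sub unfolding C_def by blast
    show "\<exists>A \<in> C. underS r' A = {} \<and> A = H"
    proof (intro bexI[of _ H] conjI refl)
      show HC: "H \<in> C" using z unfolding C_def by blast
      have "H \<subseteq> S a" if a: "a \<in> Field r" for a
      proof -
        have "(z, a) \<in> r"
        proof (cases "a = z")
          case False
          then have "(a, z) \<notin> r" using z(2) unfolding underS_def by blast
          then show ?thesis using tot[OF z(1) a] by simp
        qed (use rf z(1) in simp)
        from mono[OF a this] show ?thesis using z(3) by simp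
      qed
      then have "H \<subseteq> A" if "A \<in> C" for A using that unfolding C_def by auto
      then show "underS r' H = {}" unfolding uS[OF HC] by blast
    qed
    show "\<exists>A \<in> C. under r' A = C \<and> A = K"
    proof (intro bexI[of _ K] conjI refl)
      show KC: "K \<in> C" using t unfolding C_def by blast
      have "A \<subseteq> K" if "A \<in> C" for A
        using that mono[OF t(1)] t(2,3) unfolding C_def under_def by blast
      then show "under r' K = C" unfolding u[OF KC] by blast
    qed
    show "step A B" if A: "A \<in> C" and B: "B \<in> C" and eq: "underS r' B = under r' A" for A B
    proof -
      have eq': "\<And>M. M \<in> C \<Longrightarrow> M \<subset> B \<longleftrightarrow> M \<subseteq> A" using eq unfolding uS[OF B] u[OF A] by blast
      have AB: "A \<subset> B" using eq' A by blast
      obtain b where b: "b \<in> Field r" "S b = B" "\<forall>y \<in> underS r b. S y \<subset> B"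
        using first[OF B] by blast
      obtain a where a: "a \<in> Field r" "S a = A" using A unfolding C_def by blast
      have ab: "a \<in> underS r b" using strict[OF a(1) b(1)] a b AB unfolding underS_def by blast
      have le: "S y \<subseteq> A" if "y \<in> underS r b" for y
      proof -
        have "S y \<in> C" using that unfolding C_def underS_def by (auto intro: FieldI1)
        then show ?thesis using eq' b(3) that by blast
      qed
      have "\<exists>\<alpha> \<in> Field r. underS r b = under r \<alpha>"
      proof (rule ccontr)
        assume "\<not> ?thesis"
        then have "B = (\<Union>\<alpha> \<in> underS r b. S \<alpha>)" using lim[OF b(1)] ab b(2) by blast
        then show False using le AB by blast
      qed
      then obtain \<alpha> where \<alpha>: "\<alpha> \<in> Field r" "underS r b = under r \<alpha>" by blast
      have "\<alpha> \<in> underS r b" using \<alpha> rf by (simp add: under_def)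
      then have "S \<alpha> \<subseteq> A" by (rule le)
      moreover have "(a, \<alpha>) \<in> r" using ab \<alpha> by (simp add: under_def)
      then have "A \<subseteq> S \<alpha>" using mono[OF \<alpha>(1)] a by blast
      ultimately show ?thesis using suc[OF \<alpha>(1) b(1) \<alpha>(2)] b(2) by simp
    qed
    show "B = (\<Union>A \<in> underS r' B. A)"
      if B: "B \<in> C" and nl: "underS r' B \<noteq> {} \<and> \<not> (\<exists>A \<in> C. underS r' B = under r' A)" for B
    proof -
      obtain b where b: "b \<in> Field r" "S b = B" "\<forall>y \<in> underS r b. S y \<subset> B"
        using first[OF B] by blast
      have fld: "y \<in> Field r" if "y \<in> underS r b" for y
        using that unfolding underS_def by (auto intro: FieldI1)
      from nl obtain M where "M \<in> C" "M \<subset> B" unfolding uS[OF B] by blast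
      then obtain x where "x \<in> Field r" "S x \<subset> S b" using b(2) unfolding C_def by blast
      then have ne: "underS r b \<noteq> {}" using strict b(1) unfolding underS_def by blast
      have "\<not> (\<exists>\<alpha> \<in> Field r. underS r b = under r \<alpha>)"
      proof
        assume "\<exists>\<alpha> \<in> Field r. underS r b = under r \<alpha>"
        then obtain \<alpha> where \<alpha>: "\<alpha> \<in> Field r" "underS r b = under r \<alpha>" by blast
        have \<alpha>b: "\<alpha> \<in> underS r b" using \<alpha> rf by (simp add: under_def)
        have \<alpha>C: "S \<alpha> \<in> C" using \<alpha> unfolding C_def by blast
        have "M \<subset> B \<longleftrightarrow> M \<subseteq> S \<alpha>" if M: "M \<in> C" for M
        proof
          assume XB: "M \<subset> B"
          obtain x where x: "x \<in> Field r" "S x = M" using M unfolding C_def by blast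
          have "x \<in> underS r b" using strict[OF x(1) b(1)] x b XB unfolding underS_def by blast
          then have "(x, \<alpha>) \<in> r" using \<alpha> by (simp add: under_def)
          then show "M \<subseteq> S \<alpha>" using mono[OF \<alpha>(1)] x by blast
        next
          assume "M \<subseteq> S \<alpha>"
          then show "M \<subset> B" using b(3) \<alpha>b by blast
        qed
        then have "underS r' B = under r' (S \<alpha>)" unfolding uS[OF B] u[OF \<alpha>C] by blast
        then show False using nl \<alpha>C by blast
      qed
      then have "B = (\<Union>\<alpha> \<in> underS r b. S \<alpha>)" using lim[OF b(1) ne] b(2) by simp
      moreover have "S \<alpha> \<in> underS r' B" if "\<alpha> \<in> underS r b" for \<alpha>
        using that b(3) fld unfolding uS[OF B] C_def by blast
      moreover have "A \<subseteq> B" if "A \<in> underS r' B" for A using that unfolding uS[OF B] by blast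
      ultimately show ?thesis by blast
    qed
  qed
  then show ?thesis by blast
qed

lemma ascendantI:
  fixes r :: "'i rel"
  assumes "ascending_series G (\<lambda>A B. A \<lhd> G\<lparr>carrier := B\<rparr>) r S H (carrier G)"
  shows "ascendant H G"
  unfolding ascendant_def
  by (rule ascending_series_reindex[OF assms])
    (auto dest!: normal_imp_subgroup subgroup.subset)

lemma generalized_radicalI:
  fixes r :: "'i rel"
  assumes "ascending_series G (radical_step G) r S {\<one>\<^bsub>G\<^esub>} (carrier G)"
  shows "generalized_radical G"
  unfolding generalized_radical_def
  by (rule ascending_series_reindex[OF assms])
    (auto simp: radical_step_def dest!: normal_imp_subgroup subgroup.subset)

section \<open>Linear groups over a division ring\<close>

definition locally_finite_field :: "'a::division_ring itself \<Rightarrow> bool" where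
  "locally_finite_field _ \<longleftrightarrow>
     field (ring_of_type_algebra :: 'a ring) \<and>
     (\<forall>A :: 'a set. finite A \<longrightarrow> finite (generate_field ring_of_type_algebra A))"

definition mult_group :: "'a::division_ring monoid" where
  "mult_group = units_of ring_of_type_algebra"

definition GL :: "nat \<Rightarrow> 'a::division_ring mat monoid" where
  "GL n = units_of (ring_mat TYPE('a) n ())"

text \<open>
  The Dieudonne determinant, computed by elimination in the first column. Left row operations
  \<open>row k - c * row i\<close> do not change it, a row exchange contributes \<open>-1\<close>, and the determinant of
  a block matrix with first column \<open>(a, 0, ..., 0)\<close> is \<open>a\<close> times that of the remaining block.
  The pivot is the first non-zero entry of the first column (any other choice would give
  the same value modulo commutators). \<open>eliminate n i A\<close> is the \<open>n\<close> by \<open>n\<close> block left after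
  clearing the first column with row \<open>i\<close> and deleting that row and column.
\<close>

definition eliminate :: "nat \<Rightarrow> nat \<Rightarrow> 'a::division_ring mat \<Rightarrow> 'a mat" where
  "eliminate n i A = mat n n (\<lambda>(k, l).
     let k' = (if k < i then k else Suc k)
     in A $$ (k', Suc l) - A $$ (k', 0) * inverse (A $$ (i, 0)) * A $$ (i, Suc l))"

primrec dieudonne_rep :: "nat \<Rightarrow> 'a::division_ring mat \<Rightarrow> 'a" where
  "dieudonne_rep 0 A = 1"
| "dieudonne_rep (Suc n) A =
     (let i = (LEAST i. A $$ (i, 0) \<noteq> 0)
      in (- 1) ^ i * A $$ (i, 0) * dieudonne_rep n (eliminate n i A))"

abbreviation commutator_subgroup :: "'a::division_ring set" where
  "commutator_subgroup \<equiv> derived mult_group (carrier mult_group)"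

definition dieudonne_det :: "nat \<Rightarrow> 'a::division_ring mat \<Rightarrow> 'a set" where
  "dieudonne_det n A = commutator_subgroup #>\<^bsub>mult_group\<^esub> dieudonne_rep n A"

definition SL :: "nat \<Rightarrow> 'a::division_ring mat monoid" where
  "SL n = (GL n)\<lparr>carrier :=
     kernel (GL n) (mult_group Mod commutator_subgroup) (dieudonne_det n)\<rparr>"

definition PGL :: "nat \<Rightarrow> 'a::division_ring mat set monoid" where
  "PGL n = GL n Mod center (GL n)"

definition PSL :: "nat \<Rightarrow> 'a::division_ring mat set monoid" where
  "PSL n = SL n Mod center (SL n)"

end

theory Submission
  imports Defs "HOL-Computational_Algebra.Computational_Algebra"
begin

text \<open>
  A periodic generalized radical group is locally finite, and by Hirsch--Plotkin type arguments a
  locally finite ascendant subgroup lies in a locally finite normal subgroup. So it is enough to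
  treat a subgroup \<open>N\<close> that is normalized by the elementary matrices (by all of \<open>D\<^sup>*\<close> if \<open>n = 1\<close>) and
  locally finite modulo central elements.

  For \<open>n = 1\<close>, transfer into the centre shows that the elements of finite order of \<open>N\<close> form a
  subgroup containing all commutators. This subgroup is commutative, by Wedderburn's little theorem
  in positive characteristic and by a 3-adic congruence argument in characteristic zero, hence
  central by Cartan--Brauer--Hua. Thus \<open>N\<close> has class at most two, and such a normal subgroup of \<open>D\<^sup>*\<close>
  is central.

  For \<open>n \<ge> 2\<close>, a noncentral \<open>N\<close> contains, as in Iwasawa's criterion, all commutators of elementary
  matrices. Its elements \<open>diag(d, d', 1, \<dots>)\<close> reduce the question to the case \<open>n = 1\<close>, which makes \<open>D\<close>
  commutative; then the transvections and the \<open>diag(d, 1/d, 1, \<dots>)\<close> in \<open>N\<close> have finite order, so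
  \<open>D\<close> is a locally finite field.
\<close>

section \<open>Local finiteness modulo a subgroup\<close>

text \<open>The projective statements yield local finiteness only modulo a central subgroup, so it
  is measured relative to \<open>Z\<close> throughout, by finite sets of representatives in place of
  quotient groups. A term of an ascending series is normal only in the next one. What survives the
  passage from \<open>A\<close> to \<open>B\<close> is the largest locally finite normal subgroup of
  \<open>A\<close>: it is invariant under all automorphisms of \<open>A\<close>, hence normalized by
  \<open>B\<close>. The same invariance serves for \<open>n = 1\<close>, where a group between the
  commutator subgroup and the multiplicative group of \<open>D\<close> is normal, and therefore so
  is its radical. That \<open>carrier (SL n)\<close> is a subgroup of \<open>GL n\<close> is read
  off from the ascending series itself, whose terms are groups by the definition of normality. The
  prime 3 is the smallest for which the congruence argument works, because -1 is congruent to 1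
  modulo 2 and has finite order. In class two the contradiction comes from a relation that holds for
  every nonzero central \<open>t\<close>: its left side is independent of \<open>t\<close>, its
  right side is the square of \<open>t\<close>, and \<open>t\<close> can be 1, 2 or the commutator
  itself.\<close>

text \<open>
  When \<open>Z\<close> is a normal subgroup of \<open>N\<close>, this says that \<open>N / Z\<close> is locally finite: the images of the
  elements of \<open>T\<close> are a finite set containing 1 and closed under right multiplication by \<open>A\<close>.
\<close>

definition lf_mod :: "('a, 'b) monoid_scheme \<Rightarrow> 'a set \<Rightarrow> 'a set \<Rightarrow> bool" where
  "lf_mod G Z N \<longleftrightarrow> (\<forall>A. finite A \<and> A \<subseteq> N \<longrightarrow>
     (\<exists>T. finite T \<and> T \<subseteq> N \<and> \<one>\<^bsub>G\<^esub> \<in> T \<and>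
       (\<forall>t \<in> T. \<forall>a \<in> A. \<exists>z \<in> Z. \<exists>t' \<in> T. t \<otimes>\<^bsub>G\<^esub> a = z \<otimes>\<^bsub>G\<^esub> t')))"

lemma lf_modD:
  assumes "lf_mod G Z N" "finite A" "A \<subseteq> N"
  obtains T where "finite T" "T \<subseteq> N" "\<one>\<^bsub>G\<^esub> \<in> T"
    "\<And>t a. t \<in> T \<Longrightarrow> a \<in> A \<Longrightarrow> \<exists>z \<in> Z. \<exists>t' \<in> T. t \<otimes>\<^bsub>G\<^esub> a = z \<otimes>\<^bsub>G\<^esub> t'"
  using assms unfolding lf_mod_def by meson

lemma lf_mod_mono: "lf_mod G Z N \<Longrightarrow> Z \<subseteq> Z' \<Longrightarrow> lf_mod G Z' N"
  unfolding lf_mod_def subset_iff Ball_def Bex_def by metis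

text \<open>Multiplicativity is asked only where the left factor is in \<open>N\<close> or
  \<open>Z\<close>, because the map of later use, reading off the entry at (0, 0), is multiplicative
  on block diagonal matrices but not on all of \<open>GL n\<close>.\<close>

lemma lf_mod_image:
  assumes lf: "lf_mod G Z N"
    and p: "\<And>x y. x \<in> N \<union> Z \<Longrightarrow> y \<in> N \<Longrightarrow> p (x \<otimes>\<^bsub>G\<^esub> y) = p x \<otimes>\<^bsub>H\<^esub> p y" "p \<one>\<^bsub>G\<^esub> = \<one>\<^bsub>H\<^esub>"
    and Z': "p ` Z \<subseteq> Z'"
  shows "lf_mod H Z' (p ` N)"
  unfolding lf_mod_def
proof (intro allI impI)
  fix A assume "finite A \<and> A \<subseteq> p ` N"
  then obtain A' where A': "finite A'" "A' \<subseteq> N" "A = p ` A'" by (meson finite_subset_image)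
  obtain T where T: "finite T" "T \<subseteq> N" "\<one>\<^bsub>G\<^esub> \<in> T"
    "\<And>t a. t \<in> T \<Longrightarrow> a \<in> A' \<Longrightarrow> \<exists>z \<in> Z. \<exists>t' \<in> T. t \<otimes>\<^bsub>G\<^esub> a = z \<otimes>\<^bsub>G\<^esub> t'"
    using lf_modD[OF lf A'(1,2)] by metis
  show "\<exists>T. finite T \<and> T \<subseteq> p ` N \<and> \<one>\<^bsub>H\<^esub> \<in> T \<and>
    (\<forall>t \<in> T. \<forall>a \<in> A. \<exists>z \<in> Z'. \<exists>t' \<in> T. t \<otimes>\<^bsub>H\<^esub> a = z \<otimes>\<^bsub>H\<^esub> t')"
  proof (intro exI[of _ "p ` T"] conjI ballI)
    show "finite (p ` T)" "p ` T \<subseteq> p ` N" using T(1,2) by auto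
    show "\<one>\<^bsub>H\<^esub> \<in> p ` T" using T(3) p(2) by force
    fix t a assume "t \<in> p ` T" "a \<in> A"
    then obtain s c where sc: "s \<in> T" "t = p s" "c \<in> A'" "a = p c" using A'(3) by blast
    obtain z s' where z: "z \<in> Z" "s' \<in> T" "s \<otimes>\<^bsub>G\<^esub> c = z \<otimes>\<^bsub>G\<^esub> s'" using T(4)[OF sc(1,3)] by blast
    have N: "s \<in> N" "c \<in> N" "s' \<in> N" using sc(1,3) z(2) T(2) A'(2) by blast+
    have "t \<otimes>\<^bsub>H\<^esub> a = p (s \<otimes>\<^bsub>G\<^esub> c)" unfolding sc(2,4) using p(1)[of s c] N by simp
    also have "\<dots> = p z \<otimes>\<^bsub>H\<^esub> p s'" unfolding z(3) using p(1)[of z s'] z(1) N by simp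
    finally show "\<exists>z \<in> Z'. \<exists>t' \<in> p ` T. t \<otimes>\<^bsub>H\<^esub> a = z \<otimes>\<^bsub>H\<^esub> t'" using z(1,2) Z' by blast
  qed
qed

text \<open>Usable for sets that are not yet known to be subgroups, such as the generators of a
  normal closure. For a subgroup \<open>B\<close> the inclusion of conjugates already amounts to
  invariance, as \<open>b\<close> and its inverse both act.\<close>

definition normalizes :: "('a, 'b) monoid_scheme \<Rightarrow> 'a set \<Rightarrow> 'a set \<Rightarrow> bool" where
  "normalizes G B M \<longleftrightarrow> (\<forall>b \<in> B. \<forall>m \<in> M. b \<otimes>\<^bsub>G\<^esub> m \<otimes>\<^bsub>G\<^esub> inv\<^bsub>G\<^esub> b \<in> M)"

lemma normalizesD: "normalizes G B M \<Longrightarrow> b \<in> B \<Longrightarrow> m \<in> M \<Longrightarrow> b \<otimes>\<^bsub>G\<^esub> m \<otimes>\<^bsub>G\<^esub> inv\<^bsub>G\<^esub> b \<in> M"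
  unfolding normalizes_def by blast

lemma normalizes_mono: "normalizes G B M \<Longrightarrow> B' \<subseteq> B \<Longrightarrow> normalizes G B' M"
  unfolding normalizes_def by blast

context group
begin

text \<open>Closure under extensions by Schreier's method: writing \<open>t \<otimes> a\<close> as
  \<open>n t a \<otimes> r t a\<close> produces only finitely many factors in \<open>N\<close>. A
  set \<open>S\<close> of representatives for these factors, multiplied by \<open>T\<close>, serves
  for \<open>A\<close>.\<close>

lemma lf_mod_trans:
  assumes B: "subgroup B G" and NB: "N \<subseteq> B" and Z: "Z \<subseteq> carrier G"
    and BN: "lf_mod G N B" and NZ: "lf_mod G Z N"
  shows "lf_mod G Z B"
  unfolding lf_mod_def
proof (intro allI impI)
  have Bc: "B \<subseteq> carrier G" using B by (rule subgroup.subset)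
  fix A assume A: "finite A \<and> A \<subseteq> B"
  obtain T where T: "finite T" "T \<subseteq> B" "\<one> \<in> T"
    "\<And>t a. t \<in> T \<Longrightarrow> a \<in> A \<Longrightarrow> \<exists>n \<in> N. \<exists>t' \<in> T. t \<otimes> a = n \<otimes> t'"
    using lf_modD[OF BN] A by metis
  then obtain n r where nr: "\<And>t a. t \<in> T \<Longrightarrow> a \<in> A \<Longrightarrow> n t a \<in> N \<and> r t a \<in> T \<and> t \<otimes> a = n t a \<otimes> r t a"
    by metis
  define A0 where "A0 = (\<lambda>(t, a). n t a) ` (T \<times> A)"
  have "finite A0" "A0 \<subseteq> N" using T(1) A nr unfolding A0_def by auto
  then obtain S where S: "finite S" "S \<subseteq> N" "\<one> \<in> S"
    "\<And>s a. s \<in> S \<Longrightarrow> a \<in> A0 \<Longrightarrow> \<exists>z \<in> Z. \<exists>s' \<in> S. s \<otimes> a = z \<otimes> s'"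
    using lf_modD[OF NZ] by metis
  define U where "U = (\<lambda>(s, t). s \<otimes> t) ` (S \<times> T)"
  show "\<exists>T. finite T \<and> T \<subseteq> B \<and> \<one> \<in> T \<and> (\<forall>t \<in> T. \<forall>a \<in> A. \<exists>z \<in> Z. \<exists>t' \<in> T. t \<otimes> a = z \<otimes> t')"
  proof (intro exI[of _ U] conjI ballI)
    show "finite U" using S T unfolding U_def by auto
    show "U \<subseteq> B" using S(2) T(2) NB unfolding U_def by (auto intro!: subgroup.m_closed[OF B])
    show "\<one> \<in> U" using S(3) T(3) unfolding U_def by (force intro!: image_eqI[of _ _ "(\<one>, \<one>)"])
    fix u a assume "u \<in> U" and a: "a \<in> A"
    then obtain s t where st: "s \<in> S" "t \<in> T" "u = s \<otimes> t" unfolding U_def by auto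
    have "n t a \<in> A0" using st a unfolding A0_def by force
    then obtain z s' where z: "z \<in> Z" "s' \<in> S" "s \<otimes> n t a = z \<otimes> s'" using S(4) st by blast
    have c: "s \<in> carrier G" "t \<in> carrier G" "a \<in> carrier G" "n t a \<in> carrier G" "r t a \<in> carrier G"
      "z \<in> carrier G" "s' \<in> carrier G"
      using st z nr[OF st(2) a] S(2) T(2) NB Bc A Z a by blast+
    have "u \<otimes> a = s \<otimes> (n t a \<otimes> r t a)" using st nr[OF st(2) a] c by (simp add: m_assoc)
    also have "\<dots> = z \<otimes> (s' \<otimes> r t a)" using z c by (simp add: m_assoc[symmetric])
    finally have "u \<otimes> a = z \<otimes> (s' \<otimes> r t a)" .
    moreover have "s' \<otimes> r t a \<in> U" using z nr[OF st(2) a] unfolding U_def by auto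
    ultimately show "\<exists>z \<in> Z. \<exists>t' \<in> U. u \<otimes> a = z \<otimes> t'" using z by blast
  qed
qed

text \<open>Taken for the generators and their inverses, the finite set \<open>T\<close> is closed
  under right multiplication by them. The generated subgroup is the orbit of \<open>\<one>\<close>
  and so stays inside \<open>T\<close>.\<close>

lemma lf_mod_one_imp_finite_generate:
  assumes N: "subgroup N G" and lf: "lf_mod G {\<one>} N" and A: "finite A" "A \<subseteq> N"
  shows "finite (generate G A)"
proof -
  have Nc: "N \<subseteq> carrier G" using N by (rule subgroup.subset)
  have "finite (A \<union> m_inv G ` A)" "A \<union> m_inv G ` A \<subseteq> N"
    using A subgroup.m_inv_closed[OF N] by auto
  then obtain T where T: "finite T" "T \<subseteq> N" "\<one> \<in> T"
    "\<And>t a. t \<in> T \<Longrightarrow> a \<in> A \<union> m_inv G ` A \<Longrightarrow> \<exists>z \<in> {\<one>}. \<exists>t' \<in> T. t \<otimes> a = z \<otimes> t'"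
    using lf_modD[OF lf] by metis
  have T4: "t \<otimes> a \<in> T" if "t \<in> T" "a \<in> A \<union> m_inv G ` A" for t a
  proof -
    have "\<exists>t' \<in> T. t \<otimes> a = \<one> \<otimes> t'" using T(4)[OF that] by blast
    then show ?thesis using T(2) Nc by auto
  qed
  have "\<forall>t \<in> T. t \<otimes> x \<in> T" if "x \<in> generate G A" for x
    using that
  proof induction
    case one then show ?case using T(2) Nc by auto
  next
    case (eng x y)
    then have "x \<in> carrier G" "y \<in> carrier G" using generate_in_carrier[of A] A Nc by blast+
    then show ?case using eng.IH T(2) Nc by (metis m_assoc subsetD)
  qed (use T4 in blast)+
  then have "generate G A \<subseteq> T" using T(3) generate_in_carrier[of A] A Nc
    by (metis l_one subsetI subset_trans)
  then show ?thesis using T(1) finite_subset by blast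
qed

lemma finite_generate_imp_lf_mod:
  assumes N: "subgroup N G" and f: "\<And>A. finite A \<Longrightarrow> A \<subseteq> N \<Longrightarrow> finite (generate G A)"
  shows "lf_mod G {\<one>} N"
  unfolding lf_mod_def
proof (intro allI impI)
  fix A assume A: "finite A \<and> A \<subseteq> N"
  then have Ac: "A \<subseteq> carrier G" using subgroup.subset[OF N] by blast
  show "\<exists>T. finite T \<and> T \<subseteq> N \<and> \<one> \<in> T \<and> (\<forall>t \<in> T. \<forall>a \<in> A. \<exists>z \<in> {\<one>}. \<exists>t' \<in> T. t \<otimes> a = z \<otimes> t')"
  proof (intro exI[of _ "generate G A"] conjI ballI)
    show "finite (generate G A)" using A f by blast
    show "generate G A \<subseteq> N" using generate_subgroup_incl[OF _ N] A by blast
    show "\<one> \<in> generate G A" by (rule generate.one)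
    fix t a assume ta: "t \<in> generate G A" "a \<in> A"
    then have "t \<otimes> a \<in> generate G A" by (simp add: generate.eng generate.incl)
    then show "\<exists>z \<in> {\<one>}. \<exists>t' \<in> generate G A. t \<otimes> a = z \<otimes> t'"
      using generate_in_carrier[OF Ac] by auto
  qed
qed

text \<open>Pigeonhole: every power of \<open>x\<close> is a \<open>Z\<close>-multiple of an element
  of the finite set \<open>T\<close>. Two powers share that element, and their quotient lies in
  \<open>Z\<close>.\<close>

lemma lf_mod_pow:
  assumes N: "subgroup N G" and Z: "subgroup Z G" and lf: "lf_mod G Z N" and x: "x \<in> N"
  shows "\<exists>k::nat. k > 0 \<and> x [^] k \<in> Z"
proof -
  have Nc: "N \<subseteq> carrier G" and Zc: "Z \<subseteq> carrier G" using N Z subgroup.subset by blast+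
  have xc: "x \<in> carrier G" using x Nc by blast
  obtain T where T: "finite T" "T \<subseteq> N" "\<one> \<in> T"
    "\<And>t a. t \<in> T \<Longrightarrow> a \<in> {x} \<Longrightarrow> \<exists>z \<in> Z. \<exists>t' \<in> T. t \<otimes> a = z \<otimes> t'"
    using lf_modD[OF lf, of "{x}"] x by auto
  have ex: "\<exists>t \<in> T. \<exists>z \<in> Z. x [^] (k::nat) = z \<otimes> t" for k
  proof (induction k)
    case 0 then show ?case using T(3) subgroup.one_closed[OF Z] by force
  next
    case (Suc k)
    then obtain t z where tz: "t \<in> T" "z \<in> Z" "x [^] k = z \<otimes> t" by blast
    then obtain z' t' where z': "z' \<in> Z" "t' \<in> T" "t \<otimes> x = z' \<otimes> t'" using T(4) by blast
    have "x [^] Suc k = z \<otimes> (t \<otimes> x)" using tz xc T(2) Nc Zc by (auto simp: m_assoc subset_eq)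
    also have "\<dots> = (z \<otimes> z') \<otimes> t'" using tz z' T(2) Nc Zc by (auto simp: m_assoc subset_eq)
    finally show ?case using z' tz subgroup.m_closed[OF Z] by blast
  qed
  then obtain f where f: "\<And>k::nat. f k \<in> T \<and> (\<exists>z \<in> Z. x [^] k = z \<otimes> f k)" by metis
  have "\<not> inj f" using T(1) f finite_imageD[of f UNIV] infinite_UNIV_nat
    by (metis finite_subset image_subset_iff)
  then obtain i j where ij: "i < j" "f i = f j" unfolding inj_def by (metis linorder_neqE_nat)
  obtain z z' where z: "z \<in> Z" "z' \<in> Z" "x [^] i = z \<otimes> f i" "x [^] j = z' \<otimes> f i"
    using f[of i] f[of j] ij by metis
  have c: "z \<in> carrier G" "z' \<in> carrier G" "f i \<in> carrier G" using z f[of i] T(2) Nc Zc by blast+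
  have "x [^] (j - i) \<otimes> x [^] i = x [^] j" using xc ij by (simp add: nat_pow_mult)
  then have "x [^] (j - i) \<otimes> z \<otimes> f i = z' \<otimes> f i" using z c xc by (simp add: m_assoc)
  then have "x [^] (j - i) \<otimes> z = z'" using c xc by simp
  then have "x [^] (j - i) = z' \<otimes> inv z" using c xc by (metis inv_solve_right nat_pow_closed)
  then have "x [^] (j - i) \<in> Z" using z subgroup.m_closed[OF Z] subgroup.m_inv_closed[OF Z] by simp
  then show ?thesis using ij by (intro exI[of _ "j - i"]) auto
qed

lemma subgroup_nat_pow_closed: "subgroup N G \<Longrightarrow> x \<in> N \<Longrightarrow> x [^] (k::nat) \<in> N"
  by (induction k) (auto simp: subgroup.one_closed subgroup.m_closed)

text \<open>Generators are adjoined one at a time. If \<open>a [^] k \<in> Z\<close>, the elements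
  of \<open>T\<close> times the powers of \<open>a\<close> below \<open>k\<close> represent
  everything: a new factor is moved past the powers of \<open>a\<close> and past \<open>T\<close> at
  the cost of elements of \<open>Z\<close>.\<close>

lemma lf_mod_abelian_periodic:
  assumes N: "subgroup N G" and Z: "subgroup Z G" "Z \<subseteq> N" and nor: "normalizes G N Z"
    and comm: "\<And>x y. x \<in> N \<Longrightarrow> y \<in> N \<Longrightarrow> x \<otimes> y \<otimes> inv x \<otimes> inv y \<in> Z"
    and per: "\<And>x. x \<in> N \<Longrightarrow> \<exists>k::nat. k > 0 \<and> x [^] k \<in> Z"
  shows "lf_mod G Z N"
  unfolding lf_mod_def
proof (intro allI impI)
  have Nc: "x \<in> N \<Longrightarrow> x \<in> carrier G" for x using N subgroup.mem_carrier by metis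
  have Zc: "x \<in> Z \<Longrightarrow> x \<in> carrier G" for x using Z Nc by blast
  fix A assume "finite A \<and> A \<subseteq> N"
  then have "finite A" "A \<subseteq> N" by auto
  then show "\<exists>T. finite T \<and> T \<subseteq> N \<and> \<one> \<in> T \<and> (\<forall>t \<in> T. \<forall>a \<in> A. \<exists>z \<in> Z. \<exists>t' \<in> T. t \<otimes> a = z \<otimes> t')"
  proof (induction A)
    case empty show ?case using subgroup.one_closed[OF N] by (intro exI[of _ "{\<one>}"]) auto
  next
    case (insert a A)
    then obtain T where T: "finite T" "T \<subseteq> N" "\<one> \<in> T"
      "\<And>t b. t \<in> T \<Longrightarrow> b \<in> A \<Longrightarrow> \<exists>z \<in> Z. \<exists>t' \<in> T. t \<otimes> b = z \<otimes> t'" by auto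
    have aN: "a \<in> N" using insert by auto
    obtain k :: nat where k: "k > 0" "a [^] k \<in> Z" using per[OF aN] by blast
    have pN: "a [^] i \<in> N" for i :: nat using subgroup_nat_pow_closed[OF N aN] .
    define U where "U = (\<lambda>(t, i). t \<otimes> a [^] i) ` (T \<times> {..<k})"
    have sw: "\<exists>z \<in> Z. x \<otimes> y = z \<otimes> (y \<otimes> x)" if "x \<in> N" "y \<in> N" for x y
    proof (intro bexI)
      have c: "x \<in> carrier G" "y \<in> carrier G" using that Nc by auto
      show "x \<otimes> y = (x \<otimes> y \<otimes> inv x \<otimes> inv y) \<otimes> (y \<otimes> x)" using c
        by (simp add: m_assoc inv_solve_left')
      show "x \<otimes> y \<otimes> inv x \<otimes> inv y \<in> Z" using comm that .
    qed
    have mv: "\<exists>z' \<in> Z. t \<otimes> z = z' \<otimes> t" if "t \<in> N" "z \<in> Z" for t z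
      using normalizesD[OF nor that] Nc[OF that(1)] Zc[OF that(2)]
      by (intro bexI[of _ "t \<otimes> z \<otimes> inv t"]) (auto simp: m_assoc)
    show ?case
    proof (intro exI[of _ U] conjI ballI)
      show "finite U" using T unfolding U_def by auto
      show "U \<subseteq> N" using T(2) pN subgroup.m_closed[OF N] unfolding U_def by auto
      show "\<one> \<in> U" using T(3) k unfolding U_def by (force intro!: image_eqI[of _ _ "(\<one>, 0::nat)"])
      fix u b assume "u \<in> U" and b: "b \<in> insert a A"
      then obtain t i where ti: "t \<in> T" "i < k" "u = t \<otimes> a [^] i" unfolding U_def by auto
      have tN: "t \<in> N" using ti T(2) by blast
      note c[simp] = Nc[OF tN] Nc[OF aN]
      show "\<exists>z \<in> Z. \<exists>t' \<in> U. u \<otimes> b = z \<otimes> t'"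
      proof (cases "b = a")
        case True
        have e: "u \<otimes> b = t \<otimes> a [^] Suc i" using ti True by (simp add: m_assoc)
        show ?thesis
        proof (cases "Suc i = k")
          case False
          then have "t \<otimes> a [^] Suc i \<in> U" using ti
            unfolding U_def by (intro image_eqI[of _ _ "(t, Suc i)"]) auto
          then show ?thesis using e subgroup.one_closed[OF Z(1)] tN
            by (intro bexI[of _ \<one>] bexI[of _ "t \<otimes> a [^] Suc i"]) auto
        next
          case True
          then obtain z' where "z' \<in> Z" "t \<otimes> a [^] k = z' \<otimes> t" using mv[OF tN k(2)] by blast
          moreover have "t \<in> U" using ti k unfolding U_def by (force intro!: image_eqI[of _ _ "(t, 0::nat)"])
          ultimately show ?thesis using e True by metis
        qed
      next
        case False
        then have bA: "b \<in> A" and bN: "b \<in> N" using b insert by auto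
        note c[simp] = Nc[OF bN]
        obtain z where z: "z \<in> Z" "a [^] i \<otimes> b = z \<otimes> (b \<otimes> a [^] i)" using sw[OF pN bN] by blast
        obtain z2 where z2: "z2 \<in> Z" "t \<otimes> z = z2 \<otimes> t" using mv[OF tN z(1)] by blast
        obtain z3 t' where z3: "z3 \<in> Z" "t' \<in> T" "t \<otimes> b = z3 \<otimes> t'" using T(4) ti bA by blast
        have t'N: "t' \<in> N" using z3 T(2) by blast
        note [simp] = Zc[OF z(1)] Zc[OF z2(1)] Zc[OF z3(1)] Nc[OF t'N]
        have "u \<otimes> b = t \<otimes> (a [^] i \<otimes> b)" using ti by (simp add: m_assoc)
        also have "\<dots> = (t \<otimes> z) \<otimes> (b \<otimes> a [^] i)" using z by (simp add: m_assoc)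
        also have "\<dots> = z2 \<otimes> (t \<otimes> b) \<otimes> a [^] i" using z2(2) by (simp add: m_assoc)
        also have "\<dots> = (z2 \<otimes> z3) \<otimes> (t' \<otimes> a [^] i)" unfolding z3(3) by (simp add: m_assoc)
        finally have "u \<otimes> b = (z2 \<otimes> z3) \<otimes> (t' \<otimes> a [^] i)" .
        moreover have "t' \<otimes> a [^] i \<in> U" using z3 ti unfolding U_def by auto
        ultimately show ?thesis using subgroup.m_closed[OF Z(1) z2(1) z3(1)] by blast
      qed
    qed
  qed
qed

end

section \<open>Periodic nilpotent groups and the factors of a radical series\<close>

context group
begin

lemma inv_cancel_left:
  "b \<in> carrier G \<Longrightarrow> z \<in> carrier G \<Longrightarrow> inv b \<otimes> (b \<otimes> z) = z"
  by (simp add: m_assoc[symmetric])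

lemma normalizes_generate:
  assumes "A \<subseteq> carrier G" "B \<subseteq> carrier G" and nor: "normalizes G B A"
  shows "normalizes G B (generate G A)"
proof -
  have "b \<otimes> x \<otimes> inv b \<in> generate G A" if b: "b \<in> B" and x: "x \<in> generate G A" for b x
    using x
  proof induction
    case one then show ?case using b assms by (auto simp: generate.one subset_eq)
  next
    case (incl h) then show ?case using normalizesD[OF nor b] by (blast intro: generate.incl)
  next
    case (inv h)
    then have "b \<otimes> inv h \<otimes> inv b = inv (b \<otimes> h \<otimes> inv b)"
      using b assms by (auto simp: inv_mult_group m_assoc subset_eq)
    then show ?case using normalizesD[OF nor b inv] by (auto intro: generate.inv)
  next
    case (eng h1 h2)
    have c: "h1 \<in> carrier G" "h2 \<in> carrier G" "b \<in> carrier G"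
      using eng generate_in_carrier assms b by blast+
    have "b \<otimes> (h1 \<otimes> h2) \<otimes> inv b = (b \<otimes> h1 \<otimes> inv b) \<otimes> (b \<otimes> h2 \<otimes> inv b)"
      using c by (simp add: m_assoc inv_cancel_left)
    then show ?case using eng.IH by (auto intro: generate.eng)
  qed
  then show ?thesis unfolding normalizes_def by blast
qed

lemma conj_commutator:
  assumes "b \<in> carrier G" "x \<in> carrier G" "y \<in> carrier G"
  shows "b \<otimes> (x \<otimes> y \<otimes> inv x \<otimes> inv y) \<otimes> inv b =
    (b \<otimes> x \<otimes> inv b) \<otimes> (b \<otimes> y \<otimes> inv b) \<otimes> inv (b \<otimes> x \<otimes> inv b) \<otimes> inv (b \<otimes> y \<otimes> inv b)"
  using assms by (simp add: inv_mult_group m_assoc inv_cancel_left)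

lemma lower_central_normal:
  "subgroup (lower_central G k) G \<and> normalizes G (carrier G) (lower_central G k)"
proof (induction k)
  case 0
  show ?case by (auto simp: normalizes_def intro: subgroup_self)
next
  case (Suc k)
  let ?L = "lower_central G k"
  let ?A = "\<Union>x \<in> ?L. \<Union>y \<in> carrier G. {x \<otimes> y \<otimes> inv x \<otimes> inv y}"
  have Lc: "?L \<subseteq> carrier G" using Suc subgroup.subset by blast
  have Ac: "?A \<subseteq> carrier G" using Lc by auto
  have "normalizes G (carrier G) ?A"
    unfolding normalizes_def
  proof (intro ballI)
    fix b m assume b: "b \<in> carrier G" and "m \<in> ?A"
    then obtain x y where xy: "x \<in> ?L" "y \<in> carrier G" "m = x \<otimes> y \<otimes> inv x \<otimes> inv y" by auto
    have "b \<otimes> x \<otimes> inv b \<in> ?L" using normalizesD[OF conjunct2[OF Suc] b xy(1)] .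
    moreover have "b \<otimes> y \<otimes> inv b \<in> carrier G" using b xy by simp
    moreover have "x \<in> carrier G" using xy Lc by blast
    ultimately show "b \<otimes> m \<otimes> inv b \<in> ?A" using xy(3) conj_commutator[OF b _ xy(2), of x] by blast
  qed
  then show ?case using generate_is_subgroup[OF Ac] normalizes_generate[OF Ac] by simp
qed

lemma lower_central_Suc_subset: "lower_central G (Suc k) \<subseteq> lower_central G k"
proof -
  let ?L = "lower_central G k"
  have L: "subgroup ?L G" "normalizes G (carrier G) ?L" using lower_central_normal by auto
  have Lc: "?L \<subseteq> carrier G" using L subgroup.subset by blast
  have "(\<Union>x \<in> ?L. \<Union>y \<in> carrier G. {x \<otimes> y \<otimes> inv x \<otimes> inv y}) \<subseteq> ?L"
  proof safe
    fix x y assume xy: "x \<in> ?L" "y \<in> carrier G"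
    then have "x \<otimes> (y \<otimes> inv x \<otimes> inv y) \<in> ?L"
      using normalizesD[OF L(2) xy(2)] subgroup.m_inv_closed[OF L(1)] subgroup.m_closed[OF L(1)] by blast
    then show "x \<otimes> y \<otimes> inv x \<otimes> inv y \<in> ?L" using xy Lc by (simp add: m_assoc subset_eq)
  qed
  then show ?thesis using generate_subgroup_incl[OF _ L(1)] by simp
qed

text \<open>Descent along the lower central series: each factor is abelian and periodic, hence
  locally finite, and \<open>lf_mod_trans\<close> carries the local finiteness of the group modulo
  one term to the next. Nilpotency makes the last term trivial.\<close>

lemma nilpotent_periodic_lf_mod:
  assumes "nilpotent_group G" "periodic_group G"
  shows "lf_mod G {\<one>} (carrier G)"
proof -
  have "lf_mod G (lower_central G k) (carrier G)" for k
  proof (induction k)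
    case 0
    show ?case unfolding lf_mod_def by (auto intro!: exI[of _ "{\<one>}"])
  next
    case (Suc k)
    let ?L = "lower_central G k" and ?M = "lower_central G (Suc k)"
    have L: "subgroup ?L G" "subgroup ?M G" using lower_central_normal by blast+
    have Lc: "?L \<subseteq> carrier G" using L subgroup.subset by blast
    have "lf_mod G ?M ?L"
    proof (rule lf_mod_abelian_periodic[OF L lower_central_Suc_subset])
      show "normalizes G ?L ?M" using lower_central_normal[of "Suc k"] Lc normalizes_mono by blast
      show "x \<otimes> y \<otimes> inv x \<otimes> inv y \<in> ?M" if "x \<in> ?L" "y \<in> ?L" for x y
        using that Lc by (auto intro!: generate.incl)
      show "\<exists>n::nat. n > 0 \<and> x [^] n \<in> ?M" if "x \<in> ?L" for x
        using assms(2) that Lc subgroup.one_closed[OF L(2)] unfolding periodic_group_def by (metis subsetD)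
    qed
    then show ?case using lf_mod_trans[OF subgroup_self Lc _ Suc] subgroup.subset[OF L(2)] by blast
  qed
  then show ?thesis using assms(1) unfolding nilpotent_group_def by metis
qed

lemma finite_generate_quotient_imp_lf_mod:
  assumes A: "A \<lhd> G" and fin: "\<And>W. finite W \<Longrightarrow> W \<subseteq> carrier (G Mod A) \<Longrightarrow> finite (generate (G Mod A) W)"
  shows "lf_mod G A (carrier G)"
  unfolding lf_mod_def
proof (intro allI impI)
  interpret normal A G by (rule A)
  let ?Q = "G Mod A"
  interpret Q: group ?Q by (rule factorgroup_is_group)
  fix S assume S: "finite S \<and> S \<subseteq> carrier G"
  define W where "W = (\<lambda>a. A #> a) ` S"
  define Y where "Y = generate ?Q W"
  have W: "finite W" "W \<subseteq> carrier ?Q" using S unfolding W_def by (auto simp: FactGroup_def RCOSETS_def)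
  have Yf: "finite Y" using fin[OF W] unfolding Y_def .
  have Yc: "Y \<subseteq> carrier ?Q" using Q.generate_incl[OF W(2)] unfolding Y_def .
  have "\<exists>r. r \<in> carrier G \<and> A #> r = c" if "c \<in> Y" for c
    using that Yc by (auto simp: FactGroup_def RCOSETS_def)
  then obtain r where r: "\<And>c. c \<in> Y \<Longrightarrow> r c \<in> carrier G \<and> A #> r c = c" by metis
  \<comment> \<open>The representative chosen for the coset \<open>A\<close> itself need not be
    \<open>\<one>\<close>, which \<open>lf_mod\<close> demands, so \<open>\<one>\<close> is added
    separately.\<close>
  define T where "T = insert \<one> (r ` Y)"
  have TY: "A #> t \<in> Y" if "t \<in> T" for t
  proof (cases "t = \<one>")
    case True
    have "A #> \<one> = A" by (rule coset_mult_one[OF subset])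
    then show ?thesis using True generate.one[of ?Q W] unfolding Y_def by simp
  qed (use that r in \<open>auto simp: T_def\<close>)
  show "\<exists>T. finite T \<and> T \<subseteq> carrier G \<and> \<one> \<in> T \<and> (\<forall>t \<in> T. \<forall>a \<in> S. \<exists>z \<in> A. \<exists>t' \<in> T. t \<otimes> a = z \<otimes> t')"
  proof (intro exI[of _ T] conjI ballI)
    show "finite T" "\<one> \<in> T" using Yf unfolding T_def by auto
    show Tc: "T \<subseteq> carrier G" using r unfolding T_def by auto
    fix t a assume t: "t \<in> T" and a: "a \<in> S"
    have c: "t \<in> carrier G" "a \<in> carrier G" using t a Tc S by auto
    have "A #> (t \<otimes> a) = (A #> t) <#> (A #> a)" using rcos_sum[OF c] by simp
    also have "\<dots> \<in> Y" using TY[OF t] a generate.eng[of _ ?Q W] generate.incl[of _ W ?Q]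
      unfolding Y_def W_def by simp
    finally have Y: "A #> (t \<otimes> a) \<in> Y" .
    have "t \<otimes> a \<in> A #> (t \<otimes> a)" using rcos_self[OF _ normal_imp_subgroup[OF A]] c by simp
    moreover define s where "s = r (A #> (t \<otimes> a))"
    have "A #> (t \<otimes> a) = A #> s" using r[OF Y] unfolding s_def by simp
    ultimately have "t \<otimes> a \<in> A #> s" by simp
    then obtain z where "z \<in> A" "t \<otimes> a = z \<otimes> r (A #> (t \<otimes> a))"
      unfolding r_coset_def s_def by auto
    then show "\<exists>z \<in> A. \<exists>t' \<in> T. t \<otimes> a = z \<otimes> t'" using Y unfolding T_def by blast
  qed
qed

text \<open>Periodicity removes the distinction between the two kinds of factors allowed in a
  radical series, since a finitely generated nilpotent periodic group is finite.\<close>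

lemma locally_nilpotent_periodic_finite_generate:
  assumes "locally_group nilpotent_group G \<or> locally_group finite_group G" and per: "periodic_group G"
    and W: "finite W" "W \<subseteq> carrier G"
  shows "finite (generate G W)"
proof -
  let ?Y = "G\<lparr>carrier := generate G W\<rparr>"
  have sub: "subgroup (generate G W) G" using generate_is_subgroup[OF W(2)] .
  interpret Y: group ?Y using subgroup.subgroup_is_group[OF sub is_group] .
  have XY: "W \<subseteq> generate G W" by (auto intro: generate.incl)
  have perY: "periodic_group ?Y"
    unfolding periodic_group_def
  proof
    fix x assume "x \<in> carrier ?Y"
    then have "x \<in> carrier G" using subgroup.subset[OF sub] by auto
    then show "\<exists>k::nat. k > 0 \<and> x [^]\<^bsub>?Y\<^esub> k = \<one>\<^bsub>?Y\<^esub>"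
      using per unfolding periodic_group_def by (simp add: nat_pow_def)
  qed
  consider "nilpotent_group ?Y" | "finite_group ?Y"
    using assms(1) W unfolding locally_group_def by blast
  then show ?thesis
  proof cases
    case 1
    have "finite (generate ?Y W)"
      by (rule Y.lf_mod_one_imp_finite_generate[OF Y.subgroup_self Y.nilpotent_periodic_lf_mod[OF 1 perY] W(1)])
        (simp add: XY)
    then show ?thesis using generate_consistent[OF XY sub] by simp
  qed (simp add: finite_group_def)
qed

lemma radical_step_lf_mod:
  assumes B: "subgroup B G" and step: "radical_step G A B" and per: "periodic_group G"
  shows "lf_mod G A B"
proof -
  let ?B = "G\<lparr>carrier := B\<rparr>"
  interpret B: group ?B using subgroup.subgroup_is_group[OF B is_group] .
  have A: "A \<lhd> ?B" using step unfolding radical_step_def by blast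
  interpret A: normal A ?B by (rule A)
  interpret Q: group "?B Mod A" by (rule A.factorgroup_is_group)
  have "periodic_group (?B Mod A)"
    unfolding periodic_group_def
  proof
    fix c assume "c \<in> carrier (?B Mod A)"
    then obtain b where b: "b \<in> B" "c = A #>\<^bsub>?B\<^esub> b" by (auto simp: FactGroup_def RCOSETS_def)
    have "b \<in> carrier G" using b B subgroup.mem_carrier by metis
    then obtain k :: nat where k: "k > 0" "b [^] k = \<one>" using per unfolding periodic_group_def by blast
    have "c [^]\<^bsub>?B Mod A\<^esub> k = A #>\<^bsub>?B\<^esub> (b [^]\<^bsub>?B\<^esub> k)"
      using A.FactGroup_pow[of b k] b by simp
    also have "b [^]\<^bsub>?B\<^esub> k = \<one>" using k by (simp add: nat_pow_def)
    also have "A #>\<^bsub>?B\<^esub> \<one> = \<one>\<^bsub>?B Mod A\<^esub>" using B.coset_mult_one[OF A.subset] by simp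
    finally show "\<exists>k::nat. k > 0 \<and> c [^]\<^bsub>?B Mod A\<^esub> k = \<one>\<^bsub>?B Mod A\<^esub>" using k by blast
  qed
  then have "finite (generate (?B Mod A) W)" if "finite W" "W \<subseteq> carrier (?B Mod A)" for W
    using Q.locally_nilpotent_periodic_finite_generate[OF _ _ that] step unfolding radical_step_def by blast
  then have "lf_mod ?B A (carrier ?B)" using B.finite_generate_quotient_imp_lf_mod[OF A] by blast
  then show ?thesis unfolding lf_mod_def by simp
qed

end

section \<open>Ascending series\<close>

text \<open>Well-founded induction along the index order. Monotonicity of \<open>S\<close> is proved
  in the same induction, because it makes the terms below a limit index a chain and puts
  \<open>H\<close> inside every term.\<close>

lemma ascending_series_induct:
  assumes ser: "ascending_series G step r S H K"
    and step_sub: "\<And>A B. step A B \<Longrightarrow> A \<subseteq> B"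
    and base: "P H"
    and step: "\<And>A B. subgroup A G \<Longrightarrow> subgroup B G \<Longrightarrow> step A B \<Longrightarrow> H \<subseteq> A \<Longrightarrow> P A \<Longrightarrow> P B"
    and lim: "\<And>C. C \<noteq> {} \<Longrightarrow> subset.chain UNIV C \<Longrightarrow>
      (\<And>A. A \<in> C \<Longrightarrow> subgroup A G \<and> H \<subseteq> A \<and> P A) \<Longrightarrow> subgroup (\<Union>C) G \<Longrightarrow> P (\<Union>C)"
  shows "P K"
proof -
  have wo: "Well_order r"
    and sub: "\<And>\<alpha>. \<alpha> \<in> Field r \<Longrightarrow> subgroup (S \<alpha>) G"
    and suc: "\<And>\<alpha> \<beta>. \<lbrakk>\<alpha> \<in> Field r; \<beta> \<in> Field r; underS r \<beta> = under r \<alpha>\<rbrakk> \<Longrightarrow> step (S \<alpha>) (S \<beta>)"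
    and limr: "\<And>l. \<lbrakk>l \<in> Field r; underS r l \<noteq> {}; \<not> (\<exists>\<alpha> \<in> Field r. underS r l = under r \<alpha>)\<rbrakk>
                \<Longrightarrow> S l = (\<Union>\<alpha> \<in> underS r l. S \<alpha>)"
    using ser unfolding ascending_series_def by blast+
  obtain z where z: "z \<in> Field r" "underS r z = {}" "S z = H"
    using ser unfolding ascending_series_def by blast
  obtain t where t: "t \<in> Field r" "S t = K"
    using ser unfolding ascending_series_def by blast
  have rf: "\<And>a. a \<in> Field r \<Longrightarrow> (a, a) \<in> r" and wf: "wf (r - Id)"
    using wo unfolding order_on_defs by (auto simp: refl_on_def)
  have tot: "\<And>a b. \<lbrakk>a \<in> Field r; b \<in> Field r\<rbrakk> \<Longrightarrow> (a, b) \<in> r \<or> (b, a) \<in> r"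
    using wo rf unfolding order_on_defs total_on_def by metis
  have zl: "(z, a) \<in> r" if "a \<in> Field r" for a
  proof (cases "a = z")
    case False
    then have "(a, z) \<notin> r" using z(2) unfolding underS_def by blast
    then show ?thesis using tot[OF z(1) that] by simp
  qed (use rf[OF z(1)] in simp)
  have "\<beta> \<in> Field r \<longrightarrow> P (S \<beta>) \<and> (\<forall>\<alpha> \<in> under r \<beta>. S \<alpha> \<subseteq> S \<beta>)" for \<beta>
  proof (induction \<beta> rule: wf_induct[OF wf])
    case (1 \<beta>)
    show ?case
    proof
      assume \<beta>: "\<beta> \<in> Field r"
      have IH: "P (S \<alpha>) \<and> (\<forall>\<gamma> \<in> under r \<alpha>. S \<gamma> \<subseteq> S \<alpha>)" "\<alpha> \<in> Field r" if "\<alpha> \<in> underS r \<beta>" for \<alpha>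
        using 1 that unfolding underS_def by (auto intro: FieldI1)
      have un: "\<gamma> = \<beta> \<or> \<gamma> \<in> underS r \<beta>" if "\<gamma> \<in> under r \<beta>" for \<gamma>
        using that unfolding under_def underS_def by blast
      have HS: "H \<subseteq> S \<alpha>" if "\<alpha> \<in> underS r \<beta>" for \<alpha>
      proof -
        have "z \<in> under r \<alpha>" using zl[OF IH(2)[OF that]] by (simp add: under_def)
        then show ?thesis using IH(1)[OF that] z(3) by blast
      qed
      show "P (S \<beta>) \<and> (\<forall>\<alpha> \<in> under r \<beta>. S \<alpha> \<subseteq> S \<beta>)"
      proof (cases "underS r \<beta> = {}")
        case True
        have "\<beta> = z"
        proof (rule ccontr)
          assume "\<beta> \<noteq> z"
          then have "z \<in> underS r \<beta>" using zl[OF \<beta>] by (simp add: underS_def)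
          then show False using True by simp
        qed
        then have "P (S \<beta>)" using base z(3) by simp
        moreover have "S \<gamma> \<subseteq> S \<beta>" if "\<gamma> \<in> under r \<beta>" for \<gamma>
          using un[OF that] True by simp
        ultimately show ?thesis by simp
      next
        case ne: False
        show ?thesis
        proof (cases "\<exists>\<alpha> \<in> Field r. underS r \<beta> = under r \<alpha>")
          case True
          then obtain \<alpha> where \<alpha>: "\<alpha> \<in> Field r" "underS r \<beta> = under r \<alpha>" by blast
          have \<alpha>U: "\<alpha> \<in> underS r \<beta>" using \<alpha> rf by (simp add: under_def)
          have st: "step (S \<alpha>) (S \<beta>)" using suc[OF \<alpha>(1) \<beta> \<alpha>(2)] .
          have "P (S \<beta>)" using step[OF sub[OF \<alpha>(1)] sub[OF \<beta>] st HS[OF \<alpha>U]] IH[OF \<alpha>U] by blast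
          moreover have "S \<gamma> \<subseteq> S \<beta>" if "\<gamma> \<in> under r \<beta>" for \<gamma>
            using un[OF that] \<alpha> IH[OF \<alpha>U] step_sub[OF st] by blast
          ultimately show ?thesis by blast
        next
          case False
          have e: "S \<beta> = \<Union>(S ` underS r \<beta>)" using limr[OF \<beta> ne False] .
          have ch: "subset.chain UNIV (S ` underS r \<beta>)"
            unfolding subset_chain_def
          proof (intro conjI ballI)
            fix U V assume "U \<in> S ` underS r \<beta>" "V \<in> S ` underS r \<beta>"
            then obtain a b where ab: "a \<in> underS r \<beta>" "b \<in> underS r \<beta>" "U = S a" "V = S b" by blast
            then show "U \<subseteq> V \<or> V \<subseteq> U"
              using tot[OF IH(2)[OF ab(1)] IH(2)[OF ab(2)]] IH(1)[OF ab(1)] IH(1)[OF ab(2)]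
              unfolding under_def by blast
          qed simp
          have "P (S \<beta>)"
            unfolding e
          proof (rule lim[OF _ ch])
            show "subgroup A G \<and> H \<subseteq> A \<and> P A" if "A \<in> S ` underS r \<beta>" for A
              using that IH sub HS by blast
            show "subgroup (\<Union>(S ` underS r \<beta>)) G" using sub[OF \<beta>] e by simp
          qed (use ne in simp)
          moreover have "S \<gamma> \<subseteq> S \<beta>" if "\<gamma> \<in> under r \<beta>" for \<gamma>
            using un[OF that] e by blast
          ultimately show ?thesis by blast
        qed
      qed
    qed
  qed
  then show ?thesis using t by blast
qed

lemma normal_subset: "A \<lhd> G\<lparr>carrier := B\<rparr> \<Longrightarrow> A \<subseteq> B"
  by (auto dest!: normal_imp_subgroup subgroup.subset)

lemma lf_mod_Union_chain:
  assumes "C \<noteq> {}" "subset.chain UNIV C" "\<And>A. A \<in> C \<Longrightarrow> lf_mod G Z A"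
  shows "lf_mod G Z (\<Union>C)"
  unfolding lf_mod_def
proof (intro allI impI)
  fix A assume A: "finite A \<and> A \<subseteq> \<Union>C"
  then obtain B where B: "B \<in> C" "A \<subseteq> B" using finite_subset_Union_chain[OF _ _ assms(1,2)] by metis
  then obtain T where "finite T" "T \<subseteq> B" "\<one>\<^bsub>G\<^esub> \<in> T"
    "\<And>t a. t \<in> T \<Longrightarrow> a \<in> A \<Longrightarrow> \<exists>z \<in> Z. \<exists>t' \<in> T. t \<otimes>\<^bsub>G\<^esub> a = z \<otimes>\<^bsub>G\<^esub> t'"
    using lf_modD[OF assms(3)[OF B(1)]] A by metis
  then show "\<exists>T. finite T \<and> T \<subseteq> \<Union>C \<and> \<one>\<^bsub>G\<^esub> \<in> T \<and>
      (\<forall>t \<in> T. \<forall>a \<in> A. \<exists>z \<in> Z. \<exists>t' \<in> T. t \<otimes>\<^bsub>G\<^esub> a = z \<otimes>\<^bsub>G\<^esub> t')"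
    using B(1) by (intro exI[of _ T]) blast
qed

section \<open>Local finiteness of periodic radical groups, and the locally finite radical\<close>

context group
begin

lemma generalized_radical_periodic_lf_mod:
  assumes "generalized_radical G" "periodic_group G"
  shows "lf_mod G {\<one>} (carrier G)"
proof -
  obtain r :: "'a set rel" and S where "ascending_series G (radical_step G) r S {\<one>} (carrier G)"
    using assms(1) unfolding generalized_radical_def by blast
  then show ?thesis
  proof (rule ascending_series_induct)
    show sub: "A \<subseteq> B" if "radical_step G A B" for A B
      using that normal_subset unfolding radical_step_def by blast
    show "lf_mod G {\<one>} {\<one>}" unfolding lf_mod_def by (auto intro!: exI[of _ "{\<one>}"])
    show "lf_mod G {\<one>} B" if "subgroup B G" "radical_step G A B" "lf_mod G {\<one>} A" for A B
      using lf_mod_trans[OF that(1) sub[OF that(2)] _ radical_step_lf_mod that(3)] that assms(2) by simp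
    show "lf_mod G {\<one>} (\<Union>C)" if "C \<noteq> {}" "subset.chain UNIV C"
      "\<And>A. A \<in> C \<Longrightarrow> subgroup A G \<and> {\<one>} \<subseteq> A \<and> lf_mod G {\<one>} A" for C
      by (rule lf_mod_Union_chain[OF that(1,2)]) (use that(3) in blast)
  qed
qed

lemma locally_generalized_radical_periodic_lf_mod:
  assumes "locally_group generalized_radical G" "periodic_group G"
  shows "lf_mod G {\<one>} (carrier G)"
proof (rule finite_generate_imp_lf_mod[OF subgroup_self])
  fix A assume A: "finite A" "A \<subseteq> carrier G"
  let ?Y = "G\<lparr>carrier := generate G A\<rparr>"
  have sub: "subgroup (generate G A) G" using generate_is_subgroup[OF A(2)] .
  interpret Y: group ?Y using subgroup.subgroup_is_group[OF sub is_group] .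
  have AY: "A \<subseteq> generate G A" by (auto intro: generate.incl)
  have "periodic_group ?Y"
    using assms(2) subgroup.subset[OF sub] unfolding periodic_group_def by (auto simp: nat_pow_def)
  then have "lf_mod ?Y {\<one>} (carrier ?Y)"
    using Y.generalized_radical_periodic_lf_mod assms(1) A unfolding locally_group_def by simp
  then have "finite (generate ?Y A)"
    using Y.lf_mod_one_imp_finite_generate[OF Y.subgroup_self, of A] A AY by simp
  then show "finite (generate G A)" using generate_consistent[OF AY sub] by simp
qed

text \<open>The representatives found for \<open>N\<close> may lie outside \<open>N'\<close>. For
  trivial \<open>Z\<close> the descent goes through finiteness of generated subgroups;
  \<open>lf_mod_Int\<close> treats general \<open>Z\<close>.\<close>

lemma lf_mod_one_subgroup:
  assumes "subgroup N G" "subgroup N' G" "N' \<subseteq> N" "lf_mod G {\<one>} N"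
  shows "lf_mod G {\<one>} N'"
  using assms lf_mod_one_imp_finite_generate finite_generate_imp_lf_mod by (meson subset_trans)

definition lf_normal :: "'a set \<Rightarrow> 'a set \<Rightarrow> 'a set \<Rightarrow> bool" where
  "lf_normal Z Y M \<longleftrightarrow> subgroup M G \<and> Z \<subseteq> M \<and> M \<subseteq> Y \<and> normalizes G Y M \<and> lf_mod G Z M"

text \<open>Second isomorphism theorem: in the product set \<open>M\<close> every element is
  congruent to one of \<open>M2\<close> modulo \<open>M1\<close>, so representatives for
  \<open>M2\<close> modulo \<open>Z \<subseteq> M1\<close> serve for \<open>M\<close> modulo
  \<open>M1\<close>. Transitivity then replaces \<open>M1\<close> by \<open>Z\<close>.\<close>

lemma lf_normal_product:
  assumes Y: "subgroup Y G" and M1: "lf_normal Z Y M1" and M2: "lf_normal Z Y M2"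
  shows "\<exists>M. lf_normal Z Y M \<and> M1 \<subseteq> M \<and> M2 \<subseteq> M"
proof -
  note d = M1[unfolded lf_normal_def] M2[unfolded lf_normal_def]
  have s: "subgroup M1 G" "subgroup M2 G" using d by auto
  have Yc: "x \<in> Y \<Longrightarrow> x \<in> carrier G" for x using Y subgroup.mem_carrier by metis
  have c: "x \<in> M1 \<Longrightarrow> x \<in> carrier G" "x \<in> M2 \<Longrightarrow> x \<in> carrier G" for x using d Yc by blast+
  define M where "M = (\<lambda>(x, y). x \<otimes> y) ` (M1 \<times> M2)"
  have MI: "x \<otimes> y \<in> M" if "x \<in> M1" "y \<in> M2" for x y using that unfolding M_def by auto
  have ME: "\<exists>x \<in> M1. \<exists>y \<in> M2. m = x \<otimes> y" if "m \<in> M" for m using that unfolding M_def by auto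
  have sub1: "M1 \<subseteq> M" "M2 \<subseteq> M"
  proof -
    show "M1 \<subseteq> M" using MI[OF _ subgroup.one_closed[OF s(2)]] c by fastforce
    show "M2 \<subseteq> M" using MI[OF subgroup.one_closed[OF s(1)]] c by fastforce
  qed
  have cj: "y \<otimes> x \<otimes> inv y \<in> M1" if "x \<in> M1" "y \<in> Y" for x y
    using normalizesD[of G Y M1 y x] that d by simp
  have sw: "y \<otimes> x = (y \<otimes> x \<otimes> inv y) \<otimes> y" if "x \<in> carrier G" "y \<in> carrier G" for x y
    using that by (simp add: m_assoc)
  have MY: "M \<subseteq> Y"
  proof
    fix m assume mM: "m \<in> M"
    obtain x y where "x \<in> M1" "y \<in> M2" "m = x \<otimes> y" using ME[OF mM] by blast
    moreover from this have "x \<in> Y" "y \<in> Y" using d by auto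
    ultimately show "m \<in> Y" using subgroup.m_closed[OF Y] by simp
  qed
  have subM: "subgroup M G"
  proof (rule subgroupI)
    show "M \<subseteq> carrier G" using MY Yc by blast
    show "M \<noteq> {}" using sub1 subgroup.one_closed[OF s(1)] by blast
    show "inv m \<in> M" if mM: "m \<in> M" for m
    proof -
      obtain x y where xy: "x \<in> M1" "y \<in> M2" "m = x \<otimes> y" using ME[OF mM] by blast
      have i: "inv x \<in> M1" "inv y \<in> M2"
        using subgroup.m_inv_closed[OF s(1) xy(1)] subgroup.m_inv_closed[OF s(2) xy(2)] by auto
      have iY: "inv y \<in> Y" using i d by auto
      have "inv m = inv y \<otimes> inv x" using xy c by (simp add: inv_mult_group)
      also have "\<dots> = (inv y \<otimes> inv x \<otimes> inv (inv y)) \<otimes> inv y"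
        by (rule sw) (use xy c in simp_all)
      finally show ?thesis using MI[OF cj[OF i(1) iY] i(2)] by simp
    qed
    show "m \<otimes> m' \<in> M" if mM: "m \<in> M" "m' \<in> M" for m m'
    proof -
      obtain x y where xy: "x \<in> M1" "y \<in> M2" "m = x \<otimes> y" using ME[OF mM(1)] by blast
      obtain x' y' where xy': "x' \<in> M1" "y' \<in> M2" "m' = x' \<otimes> y'" using ME[OF mM(2)] by blast
      have cc: "x \<in> carrier G" "y \<in> carrier G" "x' \<in> carrier G" "y' \<in> carrier G" using xy xy' c by auto
      have "m \<otimes> m' = x \<otimes> (y \<otimes> x') \<otimes> y'" using xy xy' cc by (simp add: m_assoc)
      also have "y \<otimes> x' = (y \<otimes> x' \<otimes> inv y) \<otimes> y" by (rule sw) (use cc in simp_all)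
      finally have "m \<otimes> m' = (x \<otimes> (y \<otimes> x' \<otimes> inv y)) \<otimes> (y \<otimes> y')"
        using cc by (simp add: m_assoc inv_cancel_left)
      moreover have "y \<in> Y" using xy d by auto
      ultimately show ?thesis
        using MI[OF subgroup.m_closed[OF s(1) xy(1) cj[OF xy'(1)]] subgroup.m_closed[OF s(2) xy(2) xy'(2)]]
        by simp
    qed
  qed
  have norM: "normalizes G Y M"
    unfolding normalizes_def
  proof (intro ballI)
    fix b m assume b: "b \<in> Y" and mM: "m \<in> M"
    obtain x y where xy: "x \<in> M1" "y \<in> M2" "m = x \<otimes> y" using ME[OF mM] by blast
    have cc: "x \<in> carrier G" "y \<in> carrier G" "b \<in> carrier G"
      using c(1)[OF xy(1)] c(2)[OF xy(2)] Yc[OF b] by auto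
    have "b \<otimes> m \<otimes> inv b = (b \<otimes> x \<otimes> inv b) \<otimes> (b \<otimes> y \<otimes> inv b)"
      using cc xy by (simp add: m_assoc inv_cancel_left)
    moreover have "b \<otimes> y \<otimes> inv b \<in> M2" using normalizesD[of G Y M2 b y] b xy d by simp
    ultimately show "b \<otimes> m \<otimes> inv b \<in> M" using MI cj[OF xy(1) b] by simp
  qed
  have "lf_mod G M1 M"
    unfolding lf_mod_def
  proof (intro allI impI)
    fix A assume A: "finite A \<and> A \<subseteq> M"
    obtain f g where fg: "\<And>a. a \<in> M \<Longrightarrow> f a \<in> M1 \<and> g a \<in> M2 \<and> a = f a \<otimes> g a" using ME by metis
    have "finite (g ` A)" "g ` A \<subseteq> M2" using A fg by auto
    then obtain T where T: "finite T" "T \<subseteq> M2" "\<one> \<in> T"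
      "\<And>t a. t \<in> T \<Longrightarrow> a \<in> g ` A \<Longrightarrow> \<exists>z \<in> Z. \<exists>t' \<in> T. t \<otimes> a = z \<otimes> t'"
      using lf_modD[of G Z M2] d by metis
    show "\<exists>T. finite T \<and> T \<subseteq> M \<and> \<one> \<in> T \<and> (\<forall>t \<in> T. \<forall>a \<in> A. \<exists>z \<in> M1. \<exists>t' \<in> T. t \<otimes> a = z \<otimes> t')"
    proof (intro exI[of _ T] conjI ballI)
      show "finite T" "\<one> \<in> T" "T \<subseteq> M" using T sub1 by auto
      fix t a assume t: "t \<in> T" and a: "a \<in> A"
      obtain z t' where z: "z \<in> Z" "t' \<in> T" "t \<otimes> g a = z \<otimes> t'" using T(4) t a by blast
      have fa: "f a \<in> M1" "g a \<in> M2" "a = f a \<otimes> g a" using fg a A by auto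
      have zM: "z \<in> M1" using z d by blast
      have tM: "t \<in> M2" "t' \<in> M2" using t z T by auto
      have cc: "t \<in> carrier G" "t' \<in> carrier G" "z \<in> carrier G" "f a \<in> carrier G" "g a \<in> carrier G"
        using tM zM fa c by auto
      have "t \<otimes> a = t \<otimes> (f a \<otimes> g a)" using fa by simp
      also have "\<dots> = (t \<otimes> f a \<otimes> inv t) \<otimes> (t \<otimes> g a)" using cc by (simp add: m_assoc inv_cancel_left)
      also have "\<dots> = ((t \<otimes> f a \<otimes> inv t) \<otimes> z) \<otimes> t'" using z cc by (simp add: m_assoc)
      finally have "t \<otimes> a = ((t \<otimes> f a \<otimes> inv t) \<otimes> z) \<otimes> t'" .
      moreover have "t \<in> Y" using tM d by auto
      ultimately show "\<exists>z \<in> M1. \<exists>t' \<in> T. t \<otimes> a = z \<otimes> t'"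
        using subgroup.m_closed[OF s(1) cj[OF fa(1)] zM] z by blast
    qed
  qed
  then have "lf_mod G Z M"
    using lf_mod_trans[OF subM sub1(1)] d c by blast
  then have "lf_normal Z Y M" unfolding lf_normal_def using subM norM MY sub1 d by blast
  then show ?thesis using sub1 by blast
qed

text \<open>The locally finite counterpart of the Hirsch-Plotkin radical of \<open>Y\<close>, taken
  relative to \<open>Z\<close>.\<close>

definition lf_radical :: "'a set \<Rightarrow> 'a set \<Rightarrow> 'a set" where
  "lf_radical Z Y = \<Union>{M. lf_normal Z Y M}"

text \<open>By \<open>lf_normal_product\<close> the members of the union are directed, so finitely
  many elements already lie in one member; both the subgroup property and local finiteness concern
  finitely many elements at a time.\<close>

lemma lf_radical:
  assumes Y: "subgroup Y G" and Z: "subgroup Z G" "Z \<subseteq> Y" "normalizes G Y Z"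
  shows "lf_normal Z Y (lf_radical Z Y)"
proof -
  let ?R = "lf_radical Z Y"
  have Yc: "x \<in> Y \<Longrightarrow> x \<in> carrier G" for x using Y subgroup.mem_carrier by metis
  have "lf_mod G Z Z"
    unfolding lf_mod_def using subgroup.one_closed[OF Z(1)] subgroup.mem_carrier[OF Z(1)]
    by (auto intro!: exI[of _ "{\<one>}"])
  then have Z0: "lf_normal Z Y Z" unfolding lf_normal_def using Z by blast
  have fin: "\<exists>M. lf_normal Z Y M \<and> A \<subseteq> M" if "finite A" "A \<subseteq> ?R" for A
    using that
  proof (induction A)
    case empty then show ?case using Z0 by blast
  next
    case (insert a A)
    then obtain M M' where "lf_normal Z Y M" "A \<subseteq> M" "lf_normal Z Y M'" "a \<in> M'"
      unfolding lf_radical_def by auto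
    then show ?case using lf_normal_product[OF Y, of Z M M'] by blast
  qed
  have sub: "M \<subseteq> ?R" if "lf_normal Z Y M" for M using that unfolding lf_radical_def by blast
  have "subgroup ?R G"
  proof (rule subgroupI)
    show "?R \<subseteq> carrier G" unfolding lf_radical_def lf_normal_def using Yc by blast
    show "?R \<noteq> {}" using sub[OF Z0] subgroup.one_closed[OF Z(1)] by blast
    show "inv a \<in> ?R" if "a \<in> ?R" for a
      using that sub subgroup.m_inv_closed unfolding lf_radical_def lf_normal_def by fastforce
    show "a \<otimes> b \<in> ?R" if ab: "a \<in> ?R" "b \<in> ?R" for a b
    proof -
      obtain M where M: "lf_normal Z Y M" "{a, b} \<subseteq> M" using fin[of "{a, b}"] ab by auto
      then have "a \<otimes> b \<in> M" using subgroup.m_closed[of M G a b] unfolding lf_normal_def by blast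
      then show ?thesis using sub[OF M(1)] by blast
    qed
  qed
  moreover have "normalizes G Y ?R"
    unfolding lf_radical_def lf_normal_def normalizes_def by blast
  moreover have "lf_mod G Z ?R"
    unfolding lf_mod_def
  proof (intro allI impI)
    fix A assume A: "finite A \<and> A \<subseteq> ?R"
    then obtain M where M: "lf_normal Z Y M" "A \<subseteq> M" using fin by blast
    then have lf: "lf_mod G Z M" unfolding lf_normal_def by blast
    obtain T where "finite T" "T \<subseteq> M" "\<one> \<in> T"
      "\<And>t a. t \<in> T \<Longrightarrow> a \<in> A \<Longrightarrow> \<exists>z \<in> Z. \<exists>t' \<in> T. t \<otimes> a = z \<otimes> t'"
      using lf_modD[OF lf _ M(2)] A by metis
    then show "\<exists>T. finite T \<and> T \<subseteq> ?R \<and> \<one> \<in> T \<and> (\<forall>t \<in> T. \<forall>a \<in> A. \<exists>z \<in> Z. \<exists>t' \<in> T. t \<otimes> a = z \<otimes> t')"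
      using sub[OF M(1)] by (intro exI[of _ T]) blast
  qed
  moreover have "?R \<subseteq> Y" unfolding lf_radical_def lf_normal_def by blast
  ultimately show ?thesis unfolding lf_normal_def using sub[OF Z0] by blast
qed

text \<open>The radical is invariant under automorphisms: conjugation by \<open>b\<close> maps
  \<open>Y\<close> and \<open>Z\<close> onto themselves (the inverse of \<open>b\<close> gives
  surjectivity), so it permutes the subgroups of which the radical is the union.\<close>

lemma normalizes_lf_radical:
  assumes Y: "subgroup Y G" and B: "subgroup B G"
    and nor: "normalizes G B Y" "normalizes G B Z"
  shows "normalizes G B (lf_radical Z Y)"
  unfolding normalizes_def
proof (intro ballI)
  fix b x assume b: "b \<in> B" and "x \<in> lf_radical Z Y"
  then obtain M where M: "lf_normal Z Y M" and x: "x \<in> M" unfolding lf_radical_def by blast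
  note d = M[unfolded lf_normal_def]
  have Yc: "x \<in> Y \<Longrightarrow> x \<in> carrier G" for x using Y subgroup.mem_carrier by metis
  have Mc: "x \<in> M \<Longrightarrow> x \<in> carrier G" for x using d Yc by blast
  have Zc: "x \<in> Z \<Longrightarrow> x \<in> carrier G" for x using d Mc by blast
  have bc: "b \<in> carrier G" and ib: "inv b \<in> B"
    using b B subgroup.mem_carrier subgroup.m_inv_closed by metis+
  define f where "f x = b \<otimes> x \<otimes> inv b" for x
  have fm: "f (x \<otimes> y) = f x \<otimes> f y" if "x \<in> carrier G" "y \<in> carrier G" for x y
    using that bc unfolding f_def by (simp add: m_assoc inv_cancel_left)
  have fc: "f x \<in> carrier G" if "x \<in> carrier G" for x using that bc unfolding f_def by simp
  have f1: "f \<one> = \<one>" using bc unfolding f_def by simp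
  have fi: "f (inv b \<otimes> x \<otimes> inv (inv b)) = x" if "x \<in> carrier G" for x
    using that bc unfolding f_def by (simp add: m_assoc[symmetric]) (simp add: m_assoc)
  have finv: "f (inv x) = inv (f x)" if "x \<in> carrier G" for x
    using that bc unfolding f_def by (simp add: inv_mult_group m_assoc)
  have fY: "x \<in> Y \<Longrightarrow> f x \<in> Y" and fZ: "x \<in> Z \<Longrightarrow> f x \<in> Z" for x
    using nor b unfolding f_def normalizes_def by auto
  have gY: "x \<in> Y \<Longrightarrow> \<exists>y \<in> Y. x = f y" and gZ: "x \<in> Z \<Longrightarrow> \<exists>y \<in> Z. x = f y" for x
    using fi Yc Zc nor ib unfolding normalizes_def by metis+
  have "lf_normal Z Y (f ` M)"
    unfolding lf_normal_def
  proof (intro conjI)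
    show "subgroup (f ` M) G"
    proof (rule subgroupI)
      show "f ` M \<noteq> {}" using x by blast
      show "f ` M \<subseteq> carrier G" using fc Mc by blast
      have sM: "subgroup M G" using d by blast
      show "inv a \<in> f ` M" if aM: "a \<in> f ` M" for a
      proof -
        obtain m where m: "m \<in> M" "a = f m" using aM by blast
        then have "inv a = f (inv m)" using finv[OF Mc[OF m(1)]] by simp
        then show ?thesis using subgroup.m_inv_closed[OF sM m(1)] by simp
      qed
      show "a \<otimes> a' \<in> f ` M" if aM: "a \<in> f ` M" "a' \<in> f ` M" for a a'
      proof -
        obtain m m' where m: "m \<in> M" "a = f m" "m' \<in> M" "a' = f m'" using aM by blast
        then have "a \<otimes> a' = f (m \<otimes> m')" using fm[OF Mc[OF m(1)] Mc[OF m(3)]] by simp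
        then show ?thesis using subgroup.m_closed[OF sM m(1,3)] by simp
      qed
    qed
    show "Z \<subseteq> f ` M" using gZ d by blast
    show "f ` M \<subseteq> Y" using fY d by blast
    show "normalizes G Y (f ` M)"
      unfolding normalizes_def
    proof (intro ballI)
      fix y m assume "y \<in> Y" "m \<in> f ` M"
      then obtain y' m' where *: "y' \<in> Y" "y = f y'" "m' \<in> M" "m = f m'" using gY by blast
      then have "y \<otimes> m \<otimes> inv y = f (y' \<otimes> m' \<otimes> inv y')" using fm finv Yc Mc by simp
      moreover have "y' \<otimes> m' \<otimes> inv y' \<in> M" using normalizesD[of G Y M y' m'] * d by simp
      ultimately show "y \<otimes> m \<otimes> inv y \<in> f ` M" by simp
    qed
    show "lf_mod G Z (f ` M)"
      unfolding lf_mod_def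
    proof (intro allI impI)
      fix A assume "finite A \<and> A \<subseteq> f ` M"
      then obtain A' where A': "finite A'" "A' \<subseteq> M" "A = f ` A'" by (meson finite_subset_image)
      have lf: "lf_mod G Z M" using d by blast
      obtain T where T: "finite T" "T \<subseteq> M" "\<one> \<in> T"
        "\<And>t a. t \<in> T \<Longrightarrow> a \<in> A' \<Longrightarrow> \<exists>z \<in> Z. \<exists>t' \<in> T. t \<otimes> a = z \<otimes> t'"
        using lf_modD[OF lf A'(1,2)] by metis
      show "\<exists>T. finite T \<and> T \<subseteq> f ` M \<and> \<one> \<in> T \<and> (\<forall>t \<in> T. \<forall>a \<in> A. \<exists>z \<in> Z. \<exists>t' \<in> T. t \<otimes> a = z \<otimes> t')"
      proof (intro exI[of _ "f ` T"] conjI ballI)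
        show "finite (f ` T)" "f ` T \<subseteq> f ` M" using T by auto
        show "\<one> \<in> f ` T" using T(3) f1 by force
        fix t a assume "t \<in> f ` T" "a \<in> A"
        then obtain s c where sc: "s \<in> T" "t = f s" "c \<in> A'" "a = f c" using A' by blast
        then obtain z s' where z: "z \<in> Z" "s' \<in> T" "s \<otimes> c = z \<otimes> s'" using T(4) by blast
        have cc: "s \<in> carrier G" "c \<in> carrier G" "s' \<in> carrier G" using sc z A' T Mc by auto
        have "t \<otimes> a = f (s \<otimes> c)" using sc fm[OF cc(1,2)] by simp
        then have "t \<otimes> a = f z \<otimes> f s'" using z(3) fm[OF Zc[OF z(1)] cc(3)] by simp
        then show "\<exists>z \<in> Z. \<exists>t' \<in> f ` T. t \<otimes> a = z \<otimes> t'" using fZ z by blast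
      qed
    qed
  qed
  then show "b \<otimes> x \<otimes> inv b \<in> lf_radical Z Y" using x unfolding lf_radical_def f_def by blast
qed

lemma normalizesI_normal:
  assumes "A \<lhd> G\<lparr>carrier := B\<rparr>" and B: "subgroup B G"
  shows "normalizes G B A"
  using normal.inv_op_closed2[OF assms(1)] m_inv_consistent[OF B] unfolding normalizes_def by simp

text \<open>Transfinite induction on the statement that the normal closure of \<open>H\<close> in a
  term \<open>A\<close> is locally finite. That closure lies in the radical of \<open>A\<close>,
  which the next term normalizes, so the radical also contains the next closure; at a limit the
  closure is the union of the earlier ones. The induction carries along that the terms are subgroups
  of \<open>G\<close>, which for the last term is the first conclusion, later applied to the carrier
  of \<open>SL n\<close>.\<close>

theorem ascendant_locally_radical_periodic:
  assumes C: "C \<subseteq> carrier G" and H: "subgroup H (G\<lparr>carrier := C\<rparr>)"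
    and per: "periodic_group (G\<lparr>carrier := H\<rparr>)"
    and rad: "locally_group generalized_radical (G\<lparr>carrier := H\<rparr>)"
    and asc: "ascendant H (G\<lparr>carrier := C\<rparr>)"
  shows "subgroup C G" "\<exists>M. lf_normal {\<one>} C M \<and> H \<subseteq> M"
proof -
  have HC: "H \<subseteq> C" using subgroup.subset[OF H] by simp
  have subH: "subgroup H G"
  proof (rule subgroupI)
    show Hc: "H \<subseteq> carrier G" using HC C by blast
    show "H \<noteq> {}" using subgroup.one_closed[OF H] by auto
    show m: "a \<otimes> b \<in> H" if "a \<in> H" "b \<in> H" for a b using subgroup.m_closed[OF H that] by simp
    show "inv a \<in> H" if a: "a \<in> H" for a
    proof -
      \<comment> \<open>\<open>H\<close> is a subgroup of the record with carrier \<open>C\<close>,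
        whose inverses are not yet known to agree with those of \<open>G\<close>. By periodicity the
        inverse in \<open>G\<close> is a power of \<open>a\<close>, and powers are formed from
        products alone.\<close>
      have pw: "a [^] k \<in> H" for k :: nat
        using subgroup.one_closed[OF H] a m by (induction k) auto
      obtain k :: nat where k: "k > 0" "a [^] k = \<one>"
        using per a unfolding periodic_group_def by (auto simp: nat_pow_def)
      have ac: "a \<in> carrier G" using a Hc by blast
      have "a [^] (k - 1) \<otimes> a = \<one>" using k ac by (metis Suc_diff_1 nat_pow_Suc)
      then have "inv a = a [^] (k - 1)" using ac inv_equality by simp
      then show ?thesis using pw by simp
    qed
  qed
  interpret H: group "G\<lparr>carrier := H\<rparr>" using subgroup.subgroup_is_group[OF subH is_group] .
  have lfH: "lf_mod G {\<one>} H"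
    using H.locally_generalized_radical_periodic_lf_mod[OF rad per] unfolding lf_mod_def by simp
  \<comment> \<open>\<open>N A\<close> is the normal closure of \<open>H\<close> under conjugation
    by \<open>A\<close>.\<close>
  define N where "N A = generate G (\<Union>a \<in> A. (\<lambda>h. a \<otimes> h \<otimes> inv a) ` H)" for A
  define P where "P A \<longleftrightarrow> subgroup A G \<and> A \<subseteq> C \<and> lf_mod G {\<one>} (N A)" for A
  have gc: "(\<Union>a \<in> A. (\<lambda>h. a \<otimes> h \<otimes> inv a) ` H) \<subseteq> carrier G" if "A \<subseteq> carrier G" for A
    using that subgroup.subset[OF subH] by (auto simp: subset_eq)
  have subN: "subgroup (N A) G" if "A \<subseteq> carrier G" for A
    unfolding N_def using generate_is_subgroup[OF gc[OF that]] .
  have HN: "H \<subseteq> N A" if "\<one> \<in> A" for A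
  proof
    fix h assume h: "h \<in> H"
    then have "h = \<one> \<otimes> h \<otimes> inv \<one>" using subgroup.mem_carrier[OF subH] by simp
    then show "h \<in> N A" using h that unfolding N_def by (blast intro: generate.incl)
  qed
  have NB: "N A \<subseteq> B" if "subgroup B G" "\<And>a h. a \<in> A \<Longrightarrow> h \<in> H \<Longrightarrow> a \<otimes> h \<otimes> inv a \<in> B" for A B
    unfolding N_def using that by (intro generate_subgroup_incl) blast+
  have NA: "N A \<subseteq> A" if A: "subgroup A G" "H \<subseteq> A" for A
  proof (rule NB[OF A(1)])
    fix a h assume "a \<in> A" "h \<in> H"
    then have "a \<in> A" "h \<in> A" "inv a \<in> A" using A(2) subgroup.m_inv_closed[OF A(1)] by auto
    then show "a \<otimes> h \<otimes> inv a \<in> A" by (intro subgroup.m_closed[OF A(1)])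
  qed
  have norN: "normalizes G A (N A)" if A: "subgroup A G" for A
    unfolding N_def
  proof (rule normalizes_generate[OF gc])
    show Ac: "A \<subseteq> carrier G" "A \<subseteq> carrier G" using A subgroup.subset by blast+
    show "normalizes G A (\<Union>a \<in> A. (\<lambda>h. a \<otimes> h \<otimes> inv a) ` H)"
      unfolding normalizes_def
    proof (intro ballI)
      fix b m assume b: "b \<in> A" and "m \<in> (\<Union>a \<in> A. (\<lambda>h. a \<otimes> h \<otimes> inv a) ` H)"
      then obtain a h where ah: "a \<in> A" "h \<in> H" "m = a \<otimes> h \<otimes> inv a" by blast
      then have "b \<otimes> m \<otimes> inv b = (b \<otimes> a) \<otimes> h \<otimes> inv (b \<otimes> a)"
        using b Ac subgroup.mem_carrier[OF subH] by (simp add: inv_mult_group m_assoc subset_eq)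
      then show "b \<otimes> m \<otimes> inv b \<in> (\<Union>a \<in> A. (\<lambda>h. a \<otimes> h \<otimes> inv a) ` H)"
        using subgroup.m_closed[OF A b ah(1)] ah(2) by blast
    qed
  qed
  obtain r :: "'a set rel" and S where
    "ascending_series (G\<lparr>carrier := C\<rparr>) (\<lambda>A B. A \<lhd> G\<lparr>carrier := B\<rparr>) r S H C"
    using asc unfolding ascendant_def by auto
  then have "P C"
  proof (rule ascending_series_induct)
    show "A \<subseteq> B" if "A \<lhd> G\<lparr>carrier := B\<rparr>" for A B using normal_subset[OF that] .
    show "P H"
      unfolding P_def using subH HC lf_mod_one_subgroup[OF subH subN NA[OF subH order_refl] lfH] C by blast
  next
    fix A B assume sB: "subgroup B (G\<lparr>carrier := C\<rparr>)" and n: "A \<lhd> G\<lparr>carrier := B\<rparr>"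
      and HA: "H \<subseteq> A" and "P A"
    then have A: "subgroup A G" "A \<subseteq> C" "lf_mod G {\<one>} (N A)" unfolding P_def by auto
    have BC: "B \<subseteq> C" using subgroup.subset[OF sB] by simp
    \<comment> \<open>Here the ambient \<open>C\<close> is not known to be a group. That
      \<open>B\<close> is one is part of the definition of the normality of \<open>A\<close> in
      \<open>B\<close>.\<close>
    have "group (G\<lparr>carrier := B\<rparr>)" using n by (simp add: normal_def)
    then have B: "subgroup B G" using group_incl_imp_subgroup BC C by blast
    have Ac: "A \<subseteq> carrier G" and Bc: "B \<subseteq> carrier G" using A(2) BC C by auto
    have one: "subgroup {\<one>} G" "{\<one>} \<subseteq> A" "normalizes G A {\<one>}" "normalizes G B {\<one>}"
      using subgroup.one_closed[OF A(1)] Ac Bc triv_subgroup unfolding normalizes_def by auto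
    have R: "lf_normal {\<one>} A (lf_radical {\<one>} A)" using lf_radical[OF A(1) one(1-3)] .
    have "lf_normal {\<one>} A (N A)"
      unfolding lf_normal_def using subN[OF Ac] subgroup.one_closed[OF subN[OF Ac]] NA[OF A(1) HA]
        norN[OF A(1)] A(3) by blast
    then have "N A \<subseteq> lf_radical {\<one>} A" unfolding lf_radical_def by blast
    then have HR: "H \<subseteq> lf_radical {\<one>} A" using HN[of A] subgroup.one_closed[OF A(1)] by blast
    have nR: "normalizes G B (lf_radical {\<one>} A)"
      using normalizes_lf_radical[OF A(1) B normalizesI_normal[OF n B] one(4)] .
    have sR: "subgroup (lf_radical {\<one>} A) G" "lf_mod G {\<one>} (lf_radical {\<one>} A)"
      using R unfolding lf_normal_def by auto
    \<comment> \<open>The radical of \<open>A\<close> is a subgroup that contains \<open>H\<close>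
      and is normalized by \<open>B\<close>, so it contains all conjugates of \<open>H\<close> under
      \<open>B\<close>.\<close>
    have "N B \<subseteq> lf_radical {\<one>} A"
    proof (rule NB[OF sR(1)])
      fix b h assume "b \<in> B" "h \<in> H"
      then show "b \<otimes> h \<otimes> inv b \<in> lf_radical {\<one>} A" using normalizesD[OF nR] HR by blast
    qed
    then have "lf_mod G {\<one>} (N B)" using lf_mod_one_subgroup[OF sR(1) subN[OF Bc] _ sR(2)] by blast
    then show "P B" unfolding P_def using B BC by blast
  next
    fix D assume D: "D \<noteq> {}" "subset.chain UNIV D"
      and DP: "\<And>A. A \<in> D \<Longrightarrow> subgroup A (G\<lparr>carrier := C\<rparr>) \<and> H \<subseteq> A \<and> P A"
    have sD: "subgroup A G" "A \<subseteq> C" "A \<subseteq> carrier G" if "A \<in> D" for A using DP[OF that] C unfolding P_def by auto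
    have dir: "\<exists>A \<in> D. x \<in> A \<and> y \<in> A" if "x \<in> \<Union>D" "y \<in> \<Union>D" for x y
      using finite_subset_Union_chain[OF _ _ D, of "{x, y}"] that by (metis empty_subsetI finite.intros insert_subset)
    have sU: "subgroup (\<Union>D) G"
    proof (rule subgroupI)
      show "\<Union>D \<subseteq> carrier G" using sD by blast
      show "\<Union>D \<noteq> {}" using D(1) subgroup.one_closed[OF sD(1)] by blast
      show "inv a \<in> \<Union>D" if "a \<in> \<Union>D" for a using that subgroup.m_inv_closed[OF sD(1)] by blast
      show "a \<otimes> b \<in> \<Union>D" if "a \<in> \<Union>D" "b \<in> \<Union>D" for a b
        using dir[OF that] subgroup.m_closed[OF sD(1)] by blast
    qed
    have mono: "N A \<subseteq> N B" if "A \<subseteq> B" for A B unfolding N_def using that by (intro mono_generate) blast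
    have ch: "subset.chain UNIV (N ` D)"
      unfolding subset_chain_def
    proof (intro conjI ballI)
      fix a b assume "a \<in> N ` D" "b \<in> N ` D"
      then obtain A B where "A \<in> D" "B \<in> D" "a = N A" "b = N B" by blast
      moreover from this have "A \<subseteq> B \<or> B \<subseteq> A" using D(2) unfolding subset_chain_def by blast
      ultimately show "a \<subseteq> b \<or> b \<subseteq> a" using mono by blast
    qed simp
    have dirN: "\<exists>A \<in> D. x \<in> N A \<and> y \<in> N A" if "x \<in> \<Union>(N ` D)" "y \<in> \<Union>(N ` D)" for x y
    proof -
      have "\<exists>B \<in> N ` D. {x, y} \<subseteq> B"
        using finite_subset_Union_chain[OF _ _ _ ch, of "{x, y}"] that D(1)
        by (metis empty_subsetI finite.intros image_is_empty insert_subset)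
      then show ?thesis by blast
    qed
    have sUN: "subgroup (\<Union>(N ` D)) G"
    proof (rule subgroupI)
      show "\<Union>(N ` D) \<subseteq> carrier G" using subgroup.subset[OF subN[OF sD(3)]] by blast
      show "\<Union>(N ` D) \<noteq> {}" using D(1) subgroup.one_closed[OF subN[OF sD(3)]] by blast
      show "inv a \<in> \<Union>(N ` D)" if "a \<in> \<Union>(N ` D)" for a
        using that subgroup.m_inv_closed[OF subN[OF sD(3)]] by blast
      show "a \<otimes> b \<in> \<Union>(N ` D)" if "a \<in> \<Union>(N ` D)" "b \<in> \<Union>(N ` D)" for a b
        using dirN[OF that] subgroup.m_closed[OF subN[OF sD(3)]] by blast
    qed
    have "N (\<Union>D) \<subseteq> \<Union>(N ` D)"
    proof (rule NB[OF sUN])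
      fix a h assume "a \<in> \<Union>D" "h \<in> H"
      then show "a \<otimes> h \<otimes> inv a \<in> \<Union>(N ` D)" unfolding N_def by (blast intro: generate.incl)
    qed
    moreover have "lf_mod G {\<one>} (\<Union>(N ` D))"
      using lf_mod_Union_chain[OF _ ch, of G "{\<one>}"] D(1) DP unfolding P_def by blast
    ultimately have "lf_mod G {\<one>} (N (\<Union>D))"
      using lf_mod_one_subgroup[OF sUN subN] subgroup.subset[OF sU] by blast
    then show "P (\<Union>D)" unfolding P_def using sU sD(2) by blast
  qed
  then have PC: "subgroup C G" "lf_mod G {\<one>} (N C)" unfolding P_def by auto
  show "subgroup C G" by (rule PC)
  have "lf_normal {\<one>} C (N C)"
    unfolding lf_normal_def using subN[OF C] subgroup.one_closed[OF subN[OF C]] NA[OF PC(1) HC] norN[OF PC(1)] PC(2)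
    by blast
  then show "\<exists>M. lf_normal {\<one>} C M \<and> H \<subseteq> M" using HN[of C] subgroup.one_closed[OF PC(1)] by blast
qed

end

section \<open>Transfer into a central subgroup\<close>

text \<open>From each class of \<open>T\<close> modulo \<open>Z\<close> that meets \<open>K\<close>
  a representative in \<open>K\<close> is chosen. The factor relating a product to its
  representative is then a quotient of elements of \<open>K\<close>, so it lies in \<open>K\<close>
  as well as in \<open>Z\<close>.\<close>

lemma (in group) lf_mod_Int:
  assumes N: "subgroup N G" and Z: "subgroup Z G" and lf: "lf_mod G Z N"
    and K: "subgroup K G" "K \<subseteq> N"
  shows "lf_mod G (Z \<inter> K) K"
  unfolding lf_mod_def
proof (intro allI impI)
  have Nc: "x \<in> N \<Longrightarrow> x \<in> carrier G" for x using N subgroup.mem_carrier by metis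
  have Zc: "x \<in> Z \<Longrightarrow> x \<in> carrier G" for x using Z subgroup.mem_carrier by metis
  fix A assume A: "finite A \<and> A \<subseteq> K"
  obtain T where T: "finite T" "T \<subseteq> N" "\<one> \<in> T"
    "\<And>t a. t \<in> T \<Longrightarrow> a \<in> A \<Longrightarrow> \<exists>z \<in> Z. \<exists>t' \<in> T. t \<otimes> a = z \<otimes> t'"
    using lf_modD[OF lf, of A] A K(2) by (metis subset_trans)
  \<comment> \<open>The value at \<open>\<one>\<close> is prescribed so that \<open>\<one>\<close>
    occurs among the chosen representatives.\<close>
  define f where "f t = (if t = \<one> then \<one> else (SOME s. s \<in> K \<and> (\<exists>z \<in> Z. s = z \<otimes> t)))" for t
  define T' where "T' = {t \<in> T. \<exists>s \<in> K. \<exists>z \<in> Z. s = z \<otimes> t}"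
  have f: "f t \<in> K \<and> (\<exists>z \<in> Z. f t = z \<otimes> t)" if t: "t \<in> T'" for t
  proof (cases "t = \<one>")
    case True
    then show ?thesis
      unfolding f_def using subgroup.one_closed[OF K(1)] subgroup.one_closed[OF Z]
      by (auto intro!: bexI[of _ \<one>])
  next
    case False
    have "\<exists>s. s \<in> K \<and> (\<exists>z \<in> Z. s = z \<otimes> t)" using t unfolding T'_def by blast
    from someI_ex[OF this] show ?thesis unfolding f_def using False by simp
  qed
  have one: "\<one> \<in> T'"
    unfolding T'_def using T(3) subgroup.one_closed[OF K(1)] subgroup.one_closed[OF Z] by force
  show "\<exists>T. finite T \<and> T \<subseteq> K \<and> \<one> \<in> T \<and> (\<forall>t \<in> T. \<forall>a \<in> A. \<exists>z \<in> Z \<inter> K. \<exists>t' \<in> T. t \<otimes> a = z \<otimes> t')"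
  proof (intro exI[of _ "f ` T'"] conjI ballI)
    show "finite (f ` T')" using T(1) unfolding T'_def by simp
    show "f ` T' \<subseteq> K" using f by blast
    show "\<one> \<in> f ` T'" using one by (intro image_eqI[of _ _ \<one>]) (simp_all add: f_def)
    fix s a assume "s \<in> f ` T'" and a: "a \<in> A"
    then obtain t where t: "t \<in> T'" "s = f t" by blast
    obtain z where z: "z \<in> Z" "s = z \<otimes> t" using f[OF t(1)] t(2) by blast
    have tT: "t \<in> T" using t(1) unfolding T'_def by blast
    obtain y t' where y: "y \<in> Z" "t' \<in> T" "t \<otimes> a = y \<otimes> t'" using T(4)[OF tT a] by blast
    have sK: "s \<in> K" using f[OF t(1)] t(2) by simp
    have aK: "a \<in> K" using a A by blast
    have c: "t \<in> carrier G" "t' \<in> carrier G" "a \<in> carrier G" "z \<in> carrier G" "y \<in> carrier G"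
      using tT y T(2) Nc aK K(2) Zc z by auto
    have saK: "s \<otimes> a \<in> K" using subgroup.m_closed[OF K(1) sK aK] .
    have e: "s \<otimes> a = (z \<otimes> y) \<otimes> t'" unfolding z(2) using c y(3) by (simp add: m_assoc)
    have "t' \<in> T'" unfolding T'_def using y(2) saK e subgroup.m_closed[OF Z z(1) y(1)] by blast
    then obtain w where w: "w \<in> Z" "f t' = w \<otimes> t'" "f t' \<in> K" using f by blast
    have wc: "w \<in> carrier G" using Zc w by simp
    have "t' = inv w \<otimes> f t'" using w(2) c wc by (simp add: inv_solve_left)
    then have e2: "s \<otimes> a = (z \<otimes> y \<otimes> inv w) \<otimes> f t'" using e c wc w(2) by (simp add: m_assoc)
    have zZ: "z \<otimes> y \<otimes> inv w \<in> Z"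
      using subgroup.m_closed[OF Z subgroup.m_closed[OF Z z(1) y(1)] subgroup.m_inv_closed[OF Z w(1)]] .
    have fc: "f t' \<in> carrier G" using w(2) wc c by simp
    have "z \<otimes> y \<otimes> inv w = (s \<otimes> a) \<otimes> inv (f t')" using e2 fc zZ Zc by (simp add: m_assoc)
    then have "z \<otimes> y \<otimes> inv w \<in> K"
      using subgroup.m_closed[OF K(1) saK subgroup.m_inv_closed[OF K(1) w(3)]] by simp
    then show "\<exists>z \<in> Z \<inter> K. \<exists>t' \<in> f ` T'. s \<otimes> a = z \<otimes> t'" using zZ e2 \<open>t' \<in> T'\<close> by blast
  qed
qed

text \<open>
  The transfer homomorphism: right multiplication by \<open>h\<close> permutes a transversal \<open>T\<close> modulo the
  central subgroup \<open>Z\<close> up to factors from \<open>Z\<close>, and \<open>V h\<close> is the product of these factors.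
\<close>

lemma (in group) transfer:
  assumes N: "subgroup N G" and Z: "subgroup Z G" and cen: "\<And>z x. z \<in> Z \<Longrightarrow> x \<in> N \<Longrightarrow> z \<otimes> x = x \<otimes> z"
    and zz: "\<And>z x. z \<in> Z \<Longrightarrow> x \<in> Z \<Longrightarrow> z \<otimes> x = x \<otimes> z"
    and lf: "lf_mod G Z N" and A: "finite A" "A \<subseteq> N"
  shows "\<exists>H V k. A \<subseteq> H \<and> H \<subseteq> N \<and> Z \<inter> N \<subseteq> H \<and> (k::nat) > 0 \<and>
    (\<forall>x \<in> H. \<forall>y \<in> H. x \<otimes> y \<in> H \<and> V (x \<otimes> y) = V x \<otimes> V y) \<and> (\<forall>x \<in> H. V x \<in> Z) \<and>
    (\<forall>z \<in> Z \<inter> N. V z = z [^] k)"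
proof -
  have Nc: "x \<in> N \<Longrightarrow> x \<in> carrier G" for x using N subgroup.mem_carrier by metis
  have Zc: "x \<in> Z \<Longrightarrow> x \<in> carrier G" for x using Z subgroup.mem_carrier by metis
  let ?Z = "G\<lparr>carrier := Z\<rparr>"
  interpret ZG: comm_group ?Z
    by (rule group.group_comm_groupI[OF subgroup.subgroup_is_group[OF Z is_group]]) (simp add: zz)
  obtain T0 where T0: "finite T0" "T0 \<subseteq> N" "\<one> \<in> T0"
    "\<And>t a. t \<in> T0 \<Longrightarrow> a \<in> A \<Longrightarrow> \<exists>z \<in> Z. \<exists>t' \<in> T0. t \<otimes> a = z \<otimes> t'"
    using lf_modD[OF lf A] by metis
  define cls where "cls t = (\<lambda>z. z \<otimes> t) ` Z" for t
  have cls_eq: "cls s = cls t" if zt: "z \<in> Z" "s = z \<otimes> t" "t \<in> carrier G" for s t z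
  proof -
    have "y \<otimes> s \<in> cls t" if "y \<in> Z" for y
      unfolding cls_def using that zt Zc subgroup.m_closed[OF Z that zt(1)]
      by (intro image_eqI[of _ _ "y \<otimes> z"]) (simp_all add: m_assoc)
    moreover have "y \<otimes> t \<in> cls s" if "y \<in> Z" for y
      unfolding cls_def using that zt Zc subgroup.m_closed[OF Z that subgroup.m_inv_closed[OF Z zt(1)]]
      by (intro image_eqI[of _ _ "y \<otimes> inv z"]) (simp_all add: m_assoc inv_cancel_left)
    ultimately show ?thesis unfolding cls_def by blast
  qed
  have cls_self: "t \<in> cls t" if "t \<in> carrier G" for t
    unfolding cls_def using subgroup.one_closed[OF Z] that by (intro image_eqI[of _ _ \<one>]) simp_all
  define rep where "rep C = (SOME s. s \<in> T0 \<and> cls s = C)" for C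
  have rep: "rep (cls t) \<in> T0 \<and> cls (rep (cls t)) = cls t" if "t \<in> T0" for t
    unfolding rep_def by (rule someI[of _ t]) (use that in simp)
  \<comment> \<open>\<open>T0\<close> may contain several representatives of one class modulo
    \<open>Z\<close>. Keeping one per class makes the factor and the target of
    \<open>t \<otimes> h\<close> unique, and right multiplication a permutation of
    \<open>T\<close>.\<close>
  define T where "T = rep ` cls ` T0"
  have T: "finite T" "T \<noteq> {}" "T \<subseteq> T0" using T0(1,3) rep unfolding T_def by auto
  have TN: "t \<in> N" "t \<in> carrier G" if "t \<in> T" for t using that T(3) T0(2) Nc by auto
  have Tinj: "s = t" if st: "s \<in> T" "t \<in> T" "cls s = cls t" for s t
  proof -
    obtain s' t' where "s' \<in> T0" "t' \<in> T0" "s = rep (cls s')" "t = rep (cls t')" using st unfolding T_def by blast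
    then show ?thesis using rep[of s'] rep[of t'] st(3) by simp
  qed
  have Trep: "\<exists>z \<in> Z. \<exists>t \<in> T. s = z \<otimes> t" if s: "s \<in> T0" for s
  proof -
    have "s \<in> cls (rep (cls s))" using rep[OF s] cls_self[of s] s T0(2) Nc by auto
    moreover have "rep (cls s) \<in> T" using s unfolding T_def by blast
    ultimately show ?thesis unfolding cls_def by blast
  qed
  \<comment> \<open>The index of \<open>Z\<close> may be infinite, so the transfer exists only
    locally: on the elements that send every class of \<open>T\<close> to a class of
    \<open>T\<close>. These are closed under products and include \<open>A\<close>.\<close>
  define H where "H = {h \<in> N. \<forall>t \<in> T. \<exists>z \<in> Z. \<exists>t' \<in> T. t \<otimes> h = z \<otimes> t'}"
  have HN: "H \<subseteq> N" unfolding H_def by blast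
  define c where "c h t = (SOME z. z \<in> Z \<and> (\<exists>t' \<in> T. t \<otimes> h = z \<otimes> t'))" for h t
  define p where "p h t = (SOME t'. t' \<in> T \<and> t \<otimes> h = c h t \<otimes> t')" for h t
  have cp: "c h t \<in> Z" "p h t \<in> T" "t \<otimes> h = c h t \<otimes> p h t" if ht: "h \<in> H" "t \<in> T" for h t
  proof -
    have "\<exists>z. z \<in> Z \<and> (\<exists>t' \<in> T. t \<otimes> h = z \<otimes> t')" using ht unfolding H_def by blast
    from someI_ex[OF this] have c: "c h t \<in> Z \<and> (\<exists>t' \<in> T. t \<otimes> h = c h t \<otimes> t')" unfolding c_def .
    then have "\<exists>t'. t' \<in> T \<and> t \<otimes> h = c h t \<otimes> t'" by blast
    from someI_ex[OF this] have "p h t \<in> T \<and> t \<otimes> h = c h t \<otimes> p h t" unfolding p_def .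
    then show "c h t \<in> Z" "p h t \<in> T" "t \<otimes> h = c h t \<otimes> p h t" using c by auto
  qed
  have uniq: "c h t = z \<and> p h t = t'" if h: "h \<in> H" "t \<in> T" "z \<in> Z" "t' \<in> T" "t \<otimes> h = z \<otimes> t'" for h t z t'
  proof -
    have e: "c h t \<otimes> p h t = z \<otimes> t'" using cp(3)[OF h(1,2)] h(5) by simp
    have zc: "z \<in> carrier G" "c h t \<in> carrier G" "t' \<in> carrier G" "p h t \<in> carrier G"
      using Zc h(3) cp(1)[OF h(1,2)] TN(2) h(4) cp(2)[OF h(1,2)] by auto
    have "p h t = inv (c h t) \<otimes> (z \<otimes> t')" using e zc by (simp add: inv_solve_left)
    then have e2: "p h t = (inv (c h t) \<otimes> z) \<otimes> t'" using zc by (simp add: m_assoc)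
    have "inv (c h t) \<otimes> z \<in> Z"
      using subgroup.m_closed[OF Z subgroup.m_inv_closed[OF Z cp(1)[OF h(1,2)]] h(3)] .
    then have pt: "p h t = t'" using Tinj[OF cp(2)[OF h(1,2)] h(4)] cls_eq e2 zc by blast
    then show ?thesis using e zc by simp
  qed
  define V where "V h = finprod ?Z (c h) T" for h
  have cf: "c h \<in> T \<rightarrow> carrier ?Z" if "h \<in> H" for h using cp(1)[OF that] by simp
  have VZ: "V h \<in> Z" if "h \<in> H" for h using ZG.finprod_closed[OF cf[OF that]] unfolding V_def by simp
  have pbij: "inj_on (p h) T" "p h ` T = T" if h: "h \<in> H" for h
  proof -
    show inj: "inj_on (p h) T"
    proof (rule inj_onI)
      fix s t assume st: "s \<in> T" "t \<in> T" "p h s = p h t"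
      have hc: "h \<in> carrier G" using h HN Nc by blast
      have zc: "c h s \<in> Z" "c h t \<in> Z" "c h s \<in> carrier G" "c h t \<in> carrier G" "p h t \<in> carrier G"
        using cp(1)[OF h] st Zc TN(2) cp(2)[OF h] by auto
      have "p h t = inv (c h t) \<otimes> (t \<otimes> h)"
        using cp(3)[OF h st(2)] zc hc TN(2)[OF st(2)] by (simp add: inv_solve_left)
      then have "s \<otimes> h = c h s \<otimes> (inv (c h t) \<otimes> (t \<otimes> h))" using cp(3)[OF h st(1)] st(3) by simp
      then have "s \<otimes> h = (c h s \<otimes> inv (c h t) \<otimes> t) \<otimes> h" using zc hc TN(2)[OF st(2)] by (simp add: m_assoc)
      then have "s = (c h s \<otimes> inv (c h t)) \<otimes> t" using zc hc TN(2)[OF st(1)] TN(2)[OF st(2)] by simp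
      moreover have "c h s \<otimes> inv (c h t) \<in> Z" using subgroup.m_closed[OF Z zc(1) subgroup.m_inv_closed[OF Z zc(2)]] .
      ultimately show "s = t" using Tinj[OF st(1,2)] cls_eq TN(2)[OF st(2)] by blast
    qed
    show "p h ` T = T" using endo_inj_surj[OF T(1) _ inj] cp(2)[OF h] by blast
  qed
  have mult: "x \<otimes> y \<in> H \<and> V (x \<otimes> y) = V x \<otimes> V y" if xy: "x \<in> H" "y \<in> H" for x y
  proof -
    have c1: "x \<in> carrier G" "y \<in> carrier G" using xy HN Nc by auto
    have st: "t \<otimes> (x \<otimes> y) = (c x t \<otimes> c y (p x t)) \<otimes> p y (p x t)" if t: "t \<in> T" for t
    proof -
      have k: "t \<in> carrier G" "c x t \<in> carrier G" "p x t \<in> carrier G" "c y (p x t) \<in> carrier G" "p y (p x t) \<in> carrier G"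
        using TN(2) t cp(1)[OF xy(1) t] cp(2)[OF xy(1) t] cp(1)[OF xy(2)] cp(2)[OF xy(2)] Zc by auto
      have "t \<otimes> (x \<otimes> y) = c x t \<otimes> (p x t \<otimes> y)" using cp(3)[OF xy(1) t] c1 k by (simp add: m_assoc[symmetric])
      also have "p x t \<otimes> y = c y (p x t) \<otimes> p y (p x t)" using cp(3)[OF xy(2) cp(2)[OF xy(1) t]] .
      finally show ?thesis using k by (simp add: m_assoc)
    qed
    have cZ: "c x t \<otimes> c y (p x t) \<in> Z" "p y (p x t) \<in> T" if t: "t \<in> T" for t
      using subgroup.m_closed[OF Z] cp(1)[OF xy(1) t] cp(1)[OF xy(2)] cp(2)[OF xy(1) t] cp(2)[OF xy(2)] by auto
    have "x \<otimes> y \<in> N" using subgroup.m_closed[OF N] xy HN by blast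
    then have H: "x \<otimes> y \<in> H" unfolding H_def using st cZ by blast
    have "V (x \<otimes> y) = finprod ?Z (\<lambda>t. c x t \<otimes>\<^bsub>?Z\<^esub> c y (p x t)) T"
      unfolding V_def
    proof (rule ZG.finprod_cong')
      show "(\<lambda>t. c x t \<otimes>\<^bsub>?Z\<^esub> c y (p x t)) \<in> T \<rightarrow> carrier ?Z" using cZ by simp
      show "c (x \<otimes> y) t = c x t \<otimes>\<^bsub>?Z\<^esub> c y (p x t)" if "t \<in> T" for t
        using uniq[OF H that cZ(1)[OF that] cZ(2)[OF that] st[OF that]] by simp
    qed simp
    also have "\<dots> = V x \<otimes>\<^bsub>?Z\<^esub> finprod ?Z (\<lambda>t. c y (p x t)) T"
      unfolding V_def using cf[OF xy(1)] cp(1)[OF xy(2)] cp(2)[OF xy(1)] by (intro ZG.finprod_multf) auto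
    also have "finprod ?Z (\<lambda>t. c y (p x t)) T = V y"
      unfolding V_def using ZG.finprod_reindex[OF _ pbij(1)[OF xy(1)], of "c y"] pbij(2)[OF xy(1)] cf[OF xy(2)]
      by simp
    finally show ?thesis using H by simp
  qed
  have Vz: "z \<in> H \<and> V z = z [^] card T" if z: "z \<in> Z \<inter> N" for z
  proof -
    have zZ: "z \<in> Z" "z \<in> N" using z by auto
    have e: "t \<otimes> z = z \<otimes> t" if "t \<in> T" for t using cen[OF zZ(1) TN(1)[OF that]] by simp
    have H: "z \<in> H" unfolding H_def using zZ e by blast
    have "V z = finprod ?Z (\<lambda>t. z) T"
      unfolding V_def
      by (rule ZG.finprod_cong') (use uniq[OF H _ zZ(1) _ e] zZ(1) in auto)
    also have "\<dots> = z [^]\<^bsub>?Z\<^esub> card T" using ZG.finprod_const[of z T] zZ(1) by simp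
    finally show ?thesis using H by (simp add: nat_pow_def)
  qed
  have AH: "A \<subseteq> H"
  proof
    fix a assume a: "a \<in> A"
    have "\<exists>z \<in> Z. \<exists>t' \<in> T. t \<otimes> a = z \<otimes> t'" if t: "t \<in> T" for t
    proof -
      obtain z s where z: "z \<in> Z" "s \<in> T0" "t \<otimes> a = z \<otimes> s" using T0(4) a t T(3) by blast
      obtain y t' where y: "y \<in> Z" "t' \<in> T" "s = y \<otimes> t'" using Trep[OF z(2)] by blast
      have "t \<otimes> a = (z \<otimes> y) \<otimes> t'" using z y Zc TN(2) by (simp add: m_assoc)
      then show ?thesis using subgroup.m_closed[OF Z z(1) y(1)] y(2) by blast
    qed
    then show "a \<in> H" unfolding H_def using a A(2) by blast
  qed
  have "card T > 0" using T by (simp add: card_gt_0_iff)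
  then show ?thesis
    using AH HN Vz mult VZ by (intro exI[of _ H] exI[of _ V] exI[of _ "card T"] conjI) blast+
qed

section \<open>Wedderburn's little theorem\<close>

text \<open>Euclidean descent on the exponent: modulo \<open>q ^ d - 1\<close> the number
  \<open>q ^ n - 1\<close> equals \<open>q ^ (n - d) - 1\<close>, and below \<open>d\<close> only
  exponent 0 is possible.\<close>

lemma pow_minus_one_dvd_imp_dvd:
  fixes q :: nat
  assumes "q \<ge> 2" "d > 0" "q ^ d - 1 dvd q ^ n - 1"
  shows "d dvd n"
  using assms(3)
proof (induction n rule: less_induct)
  case (less n)
  show ?case
  proof (cases "n < d")
    case True
    then have "q ^ n < q ^ d" using assms by (simp add: power_strict_increasing)
    then have "q ^ n - 1 < q ^ d - 1" using assms by (simp add: diff_less_mono)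
    then have "q ^ n - 1 = 0" using less.prems by (metis nat_dvd_not_less not_gr_zero)
    then have "n = 0" using assms by (metis One_nat_def diff_is_0_eq le_numeral_extra(4) one_less_power
          less_le_trans not_le one_less_numeral_iff semiring_norm(76) gr0I)
    then show ?thesis by simp
  next
    case False
    have ge: "q ^ (n - d) \<ge> 1" "q ^ d \<ge> 1" using assms by auto
    have "q ^ n = q ^ (n - d) * q ^ d" using False by (simp add: power_add[symmetric])
    then have "q ^ n - 1 = q ^ (n - d) * (q ^ d - 1) + (q ^ (n - d) - 1)"
      using ge by (simp add: algebra_simps)
    then have "q ^ d - 1 dvd q ^ (n - d) - 1" using less.prems by (metis dvd_add_right_iff dvd_triv_right)
    then have "d dvd n - d" using less.IH[of "n - d"] False assms(2) by simp
    then show ?thesis using False by (simp add: dvd_minus_self)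
  qed
qed

text \<open>The number \<open>m\<close> is the absolute value at \<open>q\<close> of the
  \<open>n\<close>-th cyclotomic polynomial, obtained up to sign as the quotient
  \<open>\<Phi>\<close> of \<open>P n\<close> by the least common multiple of the \<open>P d\<close>
  for proper divisors \<open>d\<close>. The divisibilities are then formal; the inequality compares
  the distances from \<open>q\<close> to the roots of \<open>\<Phi>\<close> with the distance from
  \<open>q\<close> to 1.\<close>

lemma cyclotomic_value:
  fixes q n :: nat
  assumes q: "q \<ge> 2" and n: "n > 1"
  shows "\<exists>m. m dvd q ^ n - 1 \<and> (\<forall>d. d dvd n \<and> d < n \<longrightarrow> m * (q ^ d - 1) dvd q ^ n - 1) \<and> q - 1 < m"
proof -
  define P :: "nat \<Rightarrow> int poly" where "P k = monom 1 k - 1" for k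
  define S where "S = {d. d dvd n \<and> d < n}"
  define L where "L = Lcm (P ` S)"
  have S0: "d > 0" if "d \<in> S" for d using that n unfolding S_def by (auto intro: Nat.gr0I)
  have finS: "finite S" unfolding S_def by simp
  have S1: "1 \<in> S" using n unfolding S_def by auto
  have pP: "poly (P k) x = x ^ k - 1" for k x unfolding P_def by (simp add: poly_monom)
  have PdP: "P d dvd P n" if dS: "d \<in> S" for d
  proof -
    obtain k where k: "n = d * k" using dS unfolding S_def by blast
    have "P n = (monom 1 d) ^ k - 1 ^ k" unfolding P_def k by (simp add: monom_power)
    moreover have "monom 1 d - 1 dvd (monom 1 d) ^ k - (1 :: int poly) ^ k"
      by (subst power_diff_sumr2) (rule dvd_triv_left)
    ultimately show ?thesis unfolding P_def by simp
  qed
  have "L dvd P n" unfolding L_def using PdP by (auto intro: Lcm_least)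
  then obtain \<Phi> where \<Phi>: "P n = L * \<Phi>" by blast
  have PL: "P d dvd L" if "d \<in> S" for d unfolding L_def using that by (simp add: dvd_Lcm)
  define c where "c p = map_poly complex_of_int p" for p
  have cm: "c (p * r) = c p * c r" for p r
    unfolding c_def by (intro poly_eqI) (simp add: coeff_map_poly coeff_mult)
  have cprod: "c (prod f A) = (\<Prod>a \<in> A. c (f a))" if "finite A" for f and A :: "nat set"
    using that by (induction A) (simp_all add: cm, simp add: c_def)
  have ci: "poly (c p) (of_int x) = of_int (poly p x)" for p x
    unfolding c_def by (induction p) (simp_all add: map_poly_pCons)
  have cP: "poly (c (P k)) z = z ^ k - 1" for k z
  proof -
    have "c (P k) = monom 1 k - 1"
      unfolding c_def P_def by (intro poly_eqI) (simp add: coeff_map_poly)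
    then show ?thesis by (simp add: poly_monom)
  qed
  have L1: "poly L 1 = 0"
  proof -
    obtain r where "L = P 1 * r" using PL[OF S1] by blast
    then show ?thesis by (simp add: pP)
  qed
  \<comment> \<open>1 is a root of \<open>L\<close>, while the derivative of \<open>P n\<close> at 1
    is \<open>n\<close>, so 1 is a simple root of \<open>P n\<close> and cannot be a root of the
    cofactor as well.\<close>
  have \<Phi>1: "poly \<Phi> 1 \<noteq> 0"
  proof
    assume "poly \<Phi> 1 = 0"
    then have "poly (pderiv (P n)) 1 = 0" unfolding \<Phi> by (simp add: pderiv_mult L1)
    moreover have "poly (pderiv (P n)) 1 = int n"
      unfolding P_def by (simp add: pderiv_diff pderiv_monom poly_monom)
    ultimately show False using n by simp
  qed
  have root: "z ^ n = 1" "z \<noteq> 1" if "poly (c \<Phi>) z = 0" for z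
  proof -
    have "poly (c (P n)) z = 0" unfolding \<Phi> using that by (simp add: cm)
    then show "z ^ n = 1" by (simp add: cP)
    show "z \<noteq> 1" using that ci[of \<Phi> 1] \<Phi>1 by auto
  qed
  define \<omega> where "\<omega> = cis (2 * pi * real 1 / real n)"
  have \<omega>: "\<omega> ^ d \<noteq> 1" if "0 < d" "d < n" for d
  proof
    have "\<omega> ^ d = cis (2 * pi * real d / real n)" unfolding \<omega>_def by (simp add: DeMoivre field_simps)
    moreover assume "\<omega> ^ d = 1"
    ultimately have "cis (2 * pi * real d / real n) = cis (2 * pi * real 0 / real n)" by simp
    moreover have "inj_on (\<lambda>k. cis (2 * pi * real k / real n)) {..<n}"
      using bij_betw_roots_unity[of n] n unfolding bij_betw_def by simp
    ultimately show False using that inj_onD[of _ "{..<n}" d 0] by fastforce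
  qed
  \<comment> \<open>A primitive root of unity is no root of the product of the \<open>P d\<close>, a
    multiple of \<open>L\<close>, so it must be a root of \<open>\<Phi>\<close>. Having at least one
    root makes the final inequality strict.\<close>
  have \<omega>root: "poly (c \<Phi>) \<omega> = 0"
  proof -
    have "\<omega> ^ n = cis (2 * pi)" unfolding \<omega>_def DeMoivre using n by simp
    then have "poly (c (P n)) \<omega> = 0" by (simp add: cP)
    then have "poly (c L) \<omega> = 0 \<or> poly (c \<Phi>) \<omega> = 0" unfolding \<Phi> by (simp add: cm)
    moreover have "poly (c L) \<omega> \<noteq> 0"
    proof
      assume 0: "poly (c L) \<omega> = 0"
      have "L dvd (\<Prod>d \<in> S. P d)"
        unfolding L_def by (rule Lcm_least) (auto intro: dvd_prodI finS)
      then obtain r where "(\<Prod>d \<in> S. P d) = L * r" by blast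
      then have "poly (c (\<Prod>d \<in> S. P d)) \<omega> = 0" using 0 by (simp add: cm)
      then have "(\<Prod>d \<in> S. \<omega> ^ d - 1) = 0" by (simp add: cprod[OF finS] poly_prod cP)
      then obtain d where "d \<in> S" "\<omega> ^ d = 1" using finS by auto
      then show False using \<omega>[of d] S0 unfolding S_def by auto
    qed
    ultimately show ?thesis by blast
  qed
  have lc: "norm (lead_coeff (c \<Phi>)) = 1"
  proof -
    have co: "coeff (P n) k = (if k = n then 1 else 0) - (if k = 0 then 1 else 0)" for k
      unfolding P_def by simp
    have "degree (P n) = n"
    proof (rule antisym)
      show "degree (P n) \<le> n" by (rule degree_le) (auto simp: co)
      have "coeff (P n) n \<noteq> 0" using n by (simp add: co)
      then show "n \<le> degree (P n)" by (rule le_degree)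
    qed
    then have "lead_coeff (P n) = 1" using n co[of n] by simp
    then have "lead_coeff L * lead_coeff \<Phi> = 1" using lead_coeff_mult[of L \<Phi>] \<Phi> by simp
    then have "\<bar>lead_coeff \<Phi>\<bar> = 1" using zmult_eq_1_iff by fastforce
    moreover have "degree (c \<Phi>) = degree \<Phi>" unfolding c_def by (rule degree_map_poly) simp
    ultimately show ?thesis unfolding c_def by (simp add: coeff_map_poly norm_of_int)
  qed
  have c0: "c \<Phi> \<noteq> 0" using lc by auto
  \<comment> \<open>The contribution of the root \<open>z\<close>, with multiplicity, to the
    absolute value of \<open>\<Phi>\<close> at \<open>q\<close>. It exceeds \<open>q - 1\<close>
    because \<open>z\<close> lies on the unit circle and is not 1, so its real part is less than
    1.\<close>
  define f where "f z = norm (of_nat q - z) ^ order z (c \<Phi>)" for z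
  have fg: "f z > real q - 1" if z: "poly (c \<Phi>) z = 0" for z
  proof -
    have "norm z ^ n = 1" using root(1)[OF z] by (metis norm_one norm_power)
    then have nz: "norm z = 1" using n power_eq_imp_eq_base[of "norm z" n 1] by simp
    have "Re z < 1"
    proof (rule ccontr)
      assume "\<not> Re z < 1"
      then have r: "Re z = 1" using complex_Re_le_cmod[of z] nz by simp
      then have "Im z = 0" using nz cmod_power2[of z] by simp
      then have "z = 1" using r by (simp add: complex_eq_iff)
      then show False using root(2)[OF z] by simp
    qed
    then have "real q - 1 < Re (of_nat q - z)" by simp
    also have "\<dots> \<le> norm (of_nat q - z)" by (rule complex_Re_le_cmod)
    finally have 1: "real q - 1 < norm (of_nat q - z)" .
    have "order z (c \<Phi>) \<ge> 1" using order_root[of "c \<Phi>" z] z c0 by simp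
    then have "norm (of_nat q - z) ^ 1 \<le> f z" unfolding f_def using 1 q by (intro power_increasing) auto
    then show ?thesis using 1 by simp
  qed
  have finZ: "finite {z. poly (c \<Phi>) z = 0}" using c0 by (rule poly_roots_finite)
  have "norm (poly (c \<Phi>) (of_nat q)) = (\<Prod>z | poly (c \<Phi>) z = 0. f z)"
  proof -
    have "poly (c \<Phi>) (of_nat q) = lead_coeff (c \<Phi>) * (\<Prod>z | poly (c \<Phi>) z = 0. (of_nat q - z) ^ order z (c \<Phi>))"
      by (subst complex_poly_decompose[of "c \<Phi>", symmetric]) (simp add: poly_prod)
    then show ?thesis using lc unfolding f_def by (simp add: norm_mult norm_power flip: prod_norm)
  qed
  also have "\<dots> = f \<omega> * prod f ({z. poly (c \<Phi>) z = 0} - {\<omega>})"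
    using \<omega>root by (intro prod.remove finZ) simp
  also have "\<dots> \<ge> f \<omega> * 1"
  proof (rule mult_left_mono)
    show "1 \<le> prod f ({z. poly (c \<Phi>) z = 0} - {\<omega>})"
      using fg q by (intro prod_ge_1) force
  qed (simp add: f_def)
  finally have big: "norm (poly (c \<Phi>) (of_nat q)) > real q - 1" using fg[OF \<omega>root] by simp
  define m where "m = nat \<bar>poly \<Phi> (int q)\<bar>"
  have "poly (c \<Phi>) (of_nat q) = of_int (poly \<Phi> (int q))" using ci[of \<Phi> "int q"] by simp
  then have "real m > real q - 1" using big unfolding m_def by (simp add: norm_of_int)
  then have m1: "q - 1 < m" using q by linarith
  have iq: "int (q ^ k - 1) = int q ^ k - 1" for k using q by (simp add: of_nat_diff)
  have val: "int q ^ n - 1 = poly L (int q) * poly \<Phi> (int q)"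
    using pP[of n "int q"] unfolding \<Phi> by simp
  have "int m dvd int (q ^ n - 1)" unfolding iq val m_def by simp
  then have m2: "m dvd q ^ n - 1" by (simp only: of_nat_dvd_iff)
  have m3: "m * (q ^ d - 1) dvd q ^ n - 1" if dn: "d dvd n \<and> d < n" for d
  proof -
    have "P d dvd L" using PL dn unfolding S_def by blast
    then obtain r where r: "L = P d * r" by blast
    have "int q ^ n - 1 = poly \<Phi> (int q) * (int q ^ d - 1) * poly r (int q)"
      unfolding val r by (simp add: pP)
    then have "int m * (int q ^ d - 1) dvd int q ^ n - 1" unfolding m_def by simp
    then have "int (m * (q ^ d - 1)) dvd int (q ^ n - 1)" by (simp only: iq of_nat_mult)
    then show ?thesis by (simp only: of_nat_dvd_iff)
  qed
  show ?thesis using m1 m2 m3 by blast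
qed

text \<open>Dimension without bases: among the subspaces whose cardinality is a power of that of
  \<open>F\<close>, one of maximal size must be \<open>V\<close>, since adjoining a vector
  \<open>v\<close> multiplies the cardinality by that of \<open>F\<close>.\<close>

lemma card_subspace:
  fixes F V :: "'a::division_ring set"
  assumes F: "finite F" "0 \<in> F" "1 \<in> F" "\<And>x y. x \<in> F \<Longrightarrow> y \<in> F \<Longrightarrow> x - y \<in> F"
      "\<And>x y. x \<in> F \<Longrightarrow> y \<in> F \<Longrightarrow> x * y \<in> F" "\<And>x. x \<in> F \<Longrightarrow> inverse x \<in> F"
    and V: "finite V" "0 \<in> V" "\<And>x y. x \<in> V \<Longrightarrow> y \<in> V \<Longrightarrow> x - y \<in> V"
      "\<And>f x. f \<in> F \<Longrightarrow> x \<in> V \<Longrightarrow> f * x \<in> V"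
  shows "\<exists>k. card V = card F ^ k"
proof -
  define Q where "Q U \<longleftrightarrow> U \<subseteq> V \<and> 0 \<in> U \<and> (\<forall>x \<in> U. \<forall>y \<in> U. x - y \<in> U) \<and> (\<forall>f \<in> F. \<forall>x \<in> U. f * x \<in> U) \<and>
     (\<exists>k. card U = card F ^ k)" for U
  have "Q {0}" unfolding Q_def using V by (auto intro!: exI[of _ 0])
  moreover have "card U \<le> card V" if "Q U" for U using that V(1) unfolding Q_def by (auto intro: card_mono)
  ultimately obtain U where U: "Q U" and max: "\<And>W. Q W \<Longrightarrow> card W \<le> card U"
    using ex_has_greatest_nat[of Q "{0}" card "Suc (card V)"] by (auto simp: less_Suc_eq_le)
  have "U = V"
  proof (rule ccontr)
    assume "U \<noteq> V"
    then obtain v where v: "v \<in> V" "v \<notin> U" using U unfolding Q_def by blast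
    have Ud: "x - y \<in> U" if "x \<in> U" "y \<in> U" for x y using U that unfolding Q_def by blast
    have Us: "f * x \<in> U" if "f \<in> F" "x \<in> U" for f x using U that unfolding Q_def by blast
    have U0: "0 \<in> U" "U \<subseteq> V" using U unfolding Q_def by auto
    define W where "W = (\<lambda>(f, u). u + f * v) ` (F \<times> U)"
    have WI: "u + f * v \<in> W" if "f \<in> F" "u \<in> U" for f u using that unfolding W_def by force
    have inj: "inj_on (\<lambda>(f, u). u + f * v) (F \<times> U)"
    proof (rule inj_onI, clarify)
      fix f u f' u' assume *: "f \<in> F" "u \<in> U" "f' \<in> F" "u' \<in> U" "u + f * v = u' + f' * v"
      have e: "(f - f') * v = u' - u" using *(5) by (simp add: algebra_simps)
      have "f = f'"
      proof (rule ccontr)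
        assume "f \<noteq> f'"
        then have "v = inverse (f - f') * (u' - u)" using e by (simp flip: e mult.assoc)
        then show False using v(2) Us[OF F(6)[OF F(4)[OF *(1,3)]] Ud[OF *(4,2)]] by simp
      qed
      then show "f = f' \<and> u = u'" using *(5) by simp
    qed
    have neg: "- x \<in> V" if "x \<in> V" for x using V(3)[OF V(2) that] by simp
    have add: "x + y \<in> V" if "x \<in> V" "y \<in> V" for x y using V(3)[OF that(1) neg[OF that(2)]] by simp
    obtain k where k: "card U = card F ^ k" using U unfolding Q_def by blast
    have cW: "card W = card F * card U" unfolding W_def using card_image[OF inj] by (simp add: card_cartesian_product)
    have "Q W"
      unfolding Q_def
    proof (intro conjI ballI)
      show "W \<subseteq> V" unfolding W_def using add V(4) v(1) U0 by auto
      show "0 \<in> W" using WI[OF F(2) U0(1)] by simp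
      show "\<exists>k. card W = card F ^ k" using cW k by (intro exI[of _ "Suc k"]) simp
    next
      fix x y assume "x \<in> W" "y \<in> W"
      then obtain f u f' u' where *: "f \<in> F" "u \<in> U" "f' \<in> F" "u' \<in> U" "x = u + f * v" "y = u' + f' * v"
        unfolding W_def by auto
      have "x - y = (u - u') + (f - f') * v" using * by (simp add: algebra_simps)
      then show "x - y \<in> W" using WI[OF F(4)[OF *(1,3)] Ud[OF *(2,4)]] by simp
    next
      fix g x assume g: "g \<in> F" and "x \<in> W"
      then obtain f u where *: "f \<in> F" "u \<in> U" "x = u + f * v" unfolding W_def by auto
      have "g * x = g * u + (g * f) * v" using * by (simp add: algebra_simps)
      then show "g * x \<in> W" using WI[OF F(5)[OF g *(1)] Us[OF g *(2)]] by simp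
    qed
    then have "card F * card U \<le> card U" using max cW by metis
    moreover have "card F \<ge> 2"
      using card_mono[OF F(1), of "{0, 1}"] F(2,3) by simp
    moreover have "card U > 0" using U0 V(1) finite_subset by (metis card_gt_0_iff empty_iff)
    ultimately show False by simp
  qed
  then show ?thesis using U unfolding Q_def by blast
qed

text \<open>Witt's argument with the class equation. If the centre \<open>F\<close> has
  \<open>q\<close> elements and \<open>R\<close> has \<open>q ^ n\<close>, a noncentral class has
  \<open>(q ^ n - 1) / (q ^ d - 1)\<close> elements for a proper divisor \<open>d\<close> of
  \<open>n\<close>, a multiple of the \<open>m\<close> of \<open>cyclotomic_value\<close>. So
  \<open>m\<close> divides \<open>q ^ n - q\<close> and \<open>q ^ n - 1\<close>, hence
  \<open>q - 1\<close>, although it is larger.\<close>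

theorem Wedderburn_little:
  fixes R :: "'a::division_ring set"
  assumes R: "finite R" "1 \<in> R" "\<And>x y. x \<in> R \<Longrightarrow> y \<in> R \<Longrightarrow> x - y \<in> R"
    "\<And>x y. x \<in> R \<Longrightarrow> y \<in> R \<Longrightarrow> x * y \<in> R"
    and ab: "a \<in> R" "b \<in> R"
  shows "a * b = b * a"
proof -
  have R0: "0 \<in> R" using R(3)[OF R(2,2)] by simp
  have Ri: "inverse x \<in> R" if x: "x \<in> R" for x
  proof (cases "x = 0")
    case False
    have "inj_on ((*) x) R" using False by (auto intro: inj_onI)
    moreover have "(*) x ` R \<subseteq> R" using R(4) x by auto
    ultimately have "(*) x ` R = R" using R(1) endo_inj_surj by metis
    then obtain y where "y \<in> R" "x * y = 1" using R(2) by (metis imageE)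
    then show ?thesis using False by (metis inverse_unique)
  qed (use R0 in simp)
  define F where "F = {z \<in> R. \<forall>x \<in> R. z * x = x * z}"
  define C where "C x = {y \<in> R. y * x = x * y}" for x
  have invc: "inverse z * x = x * inverse z" if "z * x = x * z" for x z :: 'a
    using that by (rule mult_commute_imp_mult_inverse_commute)
  have ig: "inverse g * (g * z) = z" "g * (inverse g * z) = z" if "g \<noteq> 0" for g z :: 'a
    using that by (simp_all add: mult.assoc[symmetric])
  have mulc: "x * y * z = z * (x * y)" if "x * z = z * x" "y * z = z * y" for x y z :: 'a
    using that by (metis mult.assoc)
  have F: "finite F" "0 \<in> F" "1 \<in> F" "x \<in> F \<Longrightarrow> y \<in> F \<Longrightarrow> x - y \<in> F"
    "x \<in> F \<Longrightarrow> y \<in> F \<Longrightarrow> x * y \<in> F" "x \<in> F \<Longrightarrow> inverse x \<in> F" for x y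
  proof -
    show "x * y \<in> F" if "x \<in> F" "y \<in> F"
      unfolding F_def mem_Collect_eq
    proof (intro conjI ballI)
      show "x * y \<in> R" using that R(4) unfolding F_def by blast
      show "x * y * z = z * (x * y)" if "z \<in> R" for z
        by (rule mulc) (use \<open>x \<in> F\<close> \<open>y \<in> F\<close> that in \<open>unfold F_def, blast+\<close>)
    qed
    show "inverse x \<in> F" if "x \<in> F"
      unfolding F_def mem_Collect_eq
    proof (intro conjI ballI)
      show "inverse x \<in> R" using that Ri unfolding F_def by blast
      show "inverse x * z = z * inverse x" if "z \<in> R" for z
        by (rule invc) (use \<open>x \<in> F\<close> that in \<open>unfold F_def, blast\<close>)
    qed
  qed (use R R0 in \<open>auto simp: F_def algebra_simps\<close>)
  define q where "q = card F"
  have q: "q \<ge> 2" unfolding q_def using card_mono[OF F(1), of "{0, 1}"] F(2,3) by simp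
  have Cc: "\<exists>k. card (C x) = q ^ k" if "x \<in> R" for x
    unfolding q_def
  proof (rule card_subspace[OF F])
    show "f * y \<in> C x" if "f \<in> F" "y \<in> C x" for f y
      unfolding C_def mem_Collect_eq
    proof
      show "f * y \<in> R" using that R(4) unfolding C_def F_def by blast
      show "f * y * x = x * (f * y)"
        by (rule mulc) (use that \<open>x \<in> R\<close> in \<open>unfold F_def C_def, blast+\<close>)
    qed
  qed (use R R0 in \<open>auto simp: C_def algebra_simps\<close>)
  have FR: "F \<subseteq> R" unfolding F_def by blast
  have "C 1 = R" unfolding C_def by auto
  then obtain n where n: "card R = q ^ n" using Cc[OF R(2)] by auto
  have "F = R"
  proof (rule ccontr)
    assume ne: "F \<noteq> R"
    have lt: "q < q ^ n" using n psubset_card_mono[OF R(1), of F] FR ne unfolding q_def by auto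
    then have n1: "n > 1" using q by (metis less_one linorder_neqE_nat nat_neq_iff not_less_iff_gr_or_eq
          power_0 power_one_right less_irrefl one_less_numeral_iff semiring_norm(76) less_le_trans)
    obtain m where m: "m dvd q ^ n - 1" "\<And>d. d dvd n \<Longrightarrow> d < n \<Longrightarrow> m * (q ^ d - 1) dvd q ^ n - 1" "q - 1 < m"
      using cyclotomic_value[OF q n1] by blast
    define K where "K x = (\<lambda>g. g * x * inverse g) ` (R - {0})" for x
    \<comment> \<open>Orbit and stabilizer: the fibres of \<open>g\<close> mapped to
      \<open>g * x * inverse g\<close> are the translates of the nonzero part of the centralizer
      \<open>C x\<close>.\<close>
    have cardK: "card (K x) * (card (C x) - 1) = q ^ n - 1" if x: "x \<in> R" for x
    proof -
      define fib where "fib y = {g \<in> R - {0}. g * x * inverse g = y}" for y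
      have fc: "card (fib y) = card (C x) - 1" if y: "y \<in> K x" for y
      proof -
        obtain g where g: "g \<in> R" "g \<noteq> 0" "y = g * x * inverse g" using y unfolding K_def by blast
        have "fib y = (*) g ` (C x - {0})"
        proof (intro equalityI subsetI)
          fix h assume "h \<in> fib y"
          then have h: "h \<in> R" "h \<noteq> 0" "h * x * inverse h = g * x * inverse g" unfolding fib_def g by auto
          have "h * x = (h * x * inverse h) * h" using h(2) by (simp add: mult.assoc)
          then have e: "h * x = g * x * inverse g * h" unfolding h(3) .
          have "inverse g * h * x = x * (inverse g * h)"
            unfolding mult.assoc e using g(2) by (simp add: mult.assoc ig)
          then have "inverse g * h \<in> C x - {0}" using h(1,2) g(1,2) Ri R(4) unfolding C_def by simp
          moreover have "h = g * (inverse g * h)" using g(2) by (simp add: ig)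
          ultimately show "h \<in> (*) g ` (C x - {0})" by blast
        next
          fix h assume "h \<in> (*) g ` (C x - {0})"
          then obtain c where c: "c \<in> R" "c * x = x * c" "c \<noteq> 0" "h = g * c" unfolding C_def by auto
          have "c * x * inverse c = x" using c by (simp add: mult.assoc)
          moreover have "h * x * inverse h = g * (c * x * inverse c) * inverse g"
            using c(3,4) g(2) by (simp add: nonzero_inverse_mult_distrib mult.assoc)
          ultimately have "h * x * inverse h = y" using g(3) by simp
          then show "h \<in> fib y" unfolding fib_def using c(1,3,4) g(1,2) R(4) by simp
        qed
        moreover have "inj_on ((*) g) (C x - {0})" using g by (auto intro: inj_onI)
        ultimately have "card (fib y) = card (C x - {0})" using card_image by metis
        also have "\<dots> = card (C x) - 1" using R0 unfolding C_def by (intro card_Diff_singleton) simp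
        finally show ?thesis .
      qed
      have "R - {0} = (\<Union>y \<in> K x. fib y)" unfolding K_def fib_def by blast
      moreover have "card (\<Union>y \<in> K x. fib y) = (\<Sum>y \<in> K x. card (fib y))"
        by (rule card_UN_disjoint) (use R(1) in \<open>auto simp: K_def fib_def\<close>)
      ultimately have "card (R - {0}) = (\<Sum>y \<in> K x. card (fib y))" by simp
      also have "\<dots> = card (K x) * (card (C x) - 1)" using fc by simp
      finally show ?thesis using n R0 R(1) by simp
    qed
    have dvdK: "m dvd card (K x)" if x: "x \<in> R - F" for x
    proof -
      have xR: "x \<in> R" using x by blast
      obtain d where d: "card (C x) = q ^ d" using Cc[OF xR] by blast
      obtain y where "y \<in> R" "x * y \<noteq> y * x" using x unfolding F_def by blast
      then have "y \<in> R" "y \<notin> C x" unfolding C_def by auto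
      moreover have "C x \<subseteq> R" unfolding C_def by blast
      ultimately have "C x \<subset> R" by blast
      then have "q ^ d < q ^ n" using d n psubset_card_mono[OF R(1)] by metis
      then have dn: "d < n" using q power_less_imp_less_exp[of q d n] by linarith
      have "{0, 1} \<subseteq> C x" unfolding C_def using R R0 by auto
      then have "card {0::'a, 1} \<le> card (C x)" using R(1) unfolding C_def by (intro card_mono) auto
      then have qd: "q ^ d \<ge> 2" using d by simp
      then have d0: "d > 0" by (cases d) auto
      have "q ^ d - 1 dvd q ^ n - 1" using cardK[OF xR] d by (metis dvd_triv_right)
      then have "d dvd n" using pow_minus_one_dvd_imp_dvd[OF q d0] by blast
      then have "m * (q ^ d - 1) dvd card (K x) * (q ^ d - 1)" using m(2) dn cardK[OF xR] d by simp
      then show ?thesis using qd by simp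
    qed
    have KI: "x \<in> K x" if "x \<in> R" for x unfolding K_def using R(2) by (force intro: image_eqI[of _ _ 1])
    have Kt: "K y = K x" if yK: "x \<in> R" "y \<in> K x" for x y
    proof -
      obtain g where g: "g \<in> R" "g \<noteq> 0" "y = g * x * inverse g" using yK unfolding K_def by blast
      have 1: "h * y * inverse h = (h * g) * x * inverse (h * g)" if "h \<noteq> 0" for h
        using g that by (simp add: nonzero_inverse_mult_distrib mult.assoc)
      have 2: "h * x * inverse h = (h * inverse g) * y * inverse (h * inverse g)" if "h \<noteq> 0" for h
        using g that by (simp add: nonzero_inverse_mult_distrib mult.assoc ig)
      show ?thesis
      proof (intro equalityI subsetI)
        fix z assume "z \<in> K y"
        then obtain h where h: "h \<in> R" "h \<noteq> 0" "z = h * y * inverse h" unfolding K_def by blast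
        show "z \<in> K x"
          unfolding K_def
        proof (rule image_eqI)
          show "z = h * g * x * inverse (h * g)" using h(3) 1[OF h(2)] by (rule trans)
          show "h * g \<in> R - {0}" using h(1,2) g(1,2) R(4) by simp
        qed
      next
        fix z assume "z \<in> K x"
        then obtain h where h: "h \<in> R" "h \<noteq> 0" "z = h * x * inverse h" unfolding K_def by blast
        show "z \<in> K y"
          unfolding K_def
        proof (rule image_eqI)
          show "z = h * inverse g * y * inverse (h * inverse g)" using h(3) 2[OF h(2)] by (rule trans)
          show "h * inverse g \<in> R - {0}" using h(1,2) g(1,2) R(4) Ri by simp
        qed
      qed
    qed
    have KR: "K x \<subseteq> R - F" if x: "x \<in> R - F" for x
    proof
      fix y assume y: "y \<in> K x"
      have "y \<in> R" using y x R(4) Ri unfolding K_def by auto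
      moreover have "y \<notin> F"
      proof
        assume "y \<in> F"
        then have "h * y * inverse h = y" if "h \<in> R" "h \<noteq> 0" for h
        proof -
          have "h * y = y * h" using \<open>y \<in> F\<close> that(1) unfolding F_def by simp
          then show ?thesis using that(2) by (simp add: mult.assoc)
        qed
        then have "K y \<subseteq> {y}" unfolding K_def by blast
        then show False using Kt[of x y] KI[of x] x y \<open>y \<in> F\<close> by auto
      qed
      ultimately show "y \<in> R - F" by blast
    qed
    have un: "\<Union>(K ` (R - F)) = R - F" using KR KI by blast
    have "m dvd card (\<Union>(K ` (R - F)))"
    proof (rule dvd_partition)
      show "finite (\<Union>(K ` (R - F)))" unfolding un using R(1) by simp
      show "\<forall>c \<in> K ` (R - F). m dvd card c" using dvdK by blast
      show "\<forall>c1 \<in> K ` (R - F). \<forall>c2 \<in> K ` (R - F). c1 \<noteq> c2 \<longrightarrow> c1 \<inter> c2 = {}"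
        using Kt by blast
    qed
    also have "card (\<Union>(K ` (R - F))) = q ^ n - q"
      unfolding un using card_Diff_subset[OF F(1) FR] n q_def by simp
    finally have "m dvd q ^ n - q" .
    then have "m dvd (q ^ n - 1) - (q ^ n - q)" using m(1) by (rule dvd_diff_nat[rotated])
    moreover have "(q ^ n - 1) - (q ^ n - q) = q - 1" using lt q by simp
    ultimately show False using m(3) q by (auto dest: dvd_imp_le)
  qed
  then show ?thesis using ab unfolding F_def by blast
qed

text \<open>A local form of Schur's theorem. For the transfer \<open>V\<close>, if
  \<open>w [^] i \<in> Z\<close> then \<open>w [^] (i * k)\<close> equals \<open>V w [^] i\<close>,
  so \<open>w\<close> has finite order as soon as \<open>V w\<close> has. Since \<open>V\<close>
  takes values in the abelian \<open>Z\<close>, it kills commutators and sends products of torsion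
  elements to torsion elements.\<close>

lemma (in group) torsion_subgroup_of_lf_mod_center:
  assumes N: "subgroup N G" and Z: "subgroup Z G" and cen: "\<And>z x. z \<in> Z \<Longrightarrow> x \<in> carrier G \<Longrightarrow> z \<otimes> x = x \<otimes> z"
    and lf: "lf_mod G Z N"
  defines "K \<equiv> {x \<in> N. \<exists>k::nat. k > 0 \<and> x [^] k = \<one>}"
  shows "subgroup K G" "lf_mod G {\<one>} K" "\<And>x y. x \<in> N \<Longrightarrow> y \<in> N \<Longrightarrow> x \<otimes> y \<otimes> inv x \<otimes> inv y \<in> K"
proof -
  have Nc: "x \<in> N \<Longrightarrow> x \<in> carrier G" for x using N subgroup.mem_carrier by metis
  have Zc: "x \<in> Z \<Longrightarrow> x \<in> carrier G" for x using Z subgroup.mem_carrier by metis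
  have hom: "\<exists>V k. (k::nat) > 0 \<and> (\<forall>x \<in> generate G A. V x \<in> Z) \<and> (\<forall>z \<in> Z \<inter> generate G A. V z = z [^] k) \<and>
      (\<forall>x \<in> generate G A. \<forall>y \<in> generate G A. V (x \<otimes> y) = V x \<otimes> V y)"
    if A: "finite A" "A \<subseteq> N" for A
  proof -
    have Ac: "A \<subseteq> carrier G" using A Nc by blast
    have f: "finite (insert \<one> (A \<union> m_inv G ` A))" "insert \<one> (A \<union> m_inv G ` A) \<subseteq> N"
      using A subgroup.m_inv_closed[OF N] subgroup.one_closed[OF N] by auto
    have cN: "z \<otimes> x = x \<otimes> z" if "z \<in> Z" "x \<in> N" for z x using cen[OF that(1) Nc[OF that(2)]] .
    have cZ: "z \<otimes> x = x \<otimes> z" if "z \<in> Z" "x \<in> Z" for z x using cen[OF that(1) Zc[OF that(2)]] .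
    have "\<exists>H V k. insert \<one> (A \<union> m_inv G ` A) \<subseteq> H \<and> H \<subseteq> N \<and> Z \<inter> N \<subseteq> H \<and> (k::nat) > 0 \<and>
        (\<forall>x \<in> H. \<forall>y \<in> H. x \<otimes> y \<in> H \<and> V (x \<otimes> y) = V x \<otimes> V y) \<and> (\<forall>x \<in> H. V x \<in> Z) \<and>
        (\<forall>z \<in> Z \<inter> N. V z = z [^] k)"
      by (rule transfer[OF N Z _ _ lf f]) (use cN cZ in blast)+
    then obtain H V k where H: "insert \<one> (A \<union> m_inv G ` A) \<subseteq> H" and HN: "H \<subseteq> N" and "Z \<inter> N \<subseteq> H"
      and k: "(k::nat) > 0" and V: "\<forall>x \<in> H. \<forall>y \<in> H. x \<otimes> y \<in> H \<and> V (x \<otimes> y) = V x \<otimes> V y"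
        "\<forall>x \<in> H. V x \<in> Z" "\<forall>z \<in> Z \<inter> N. V z = z [^] k"
      by (elim exE conjE) (rule that)
    have gH: "x \<in> H" if "x \<in> generate G A" for x
      using that
    proof induction
      case (eng x y) then show ?case using V(1) by blast
    qed (use H in auto)
    show ?thesis
    proof (intro exI[of _ V] exI[of _ k] conjI ballI)
      show "V x \<in> Z" if "x \<in> generate G A" for x using V(2) gH[OF that] by blast
      show "V z = z [^] k" if "z \<in> Z \<inter> generate G A" for z using V(3) gH[of z] HN that by blast
      show "V (x \<otimes> y) = V x \<otimes> V y" if "x \<in> generate G A" "y \<in> generate G A" for x y
        using V(1) gH[OF that(1)] gH[OF that(2)] by blast
    qed (rule k)
  qed
  have tor: "\<exists>k::nat. k > 0 \<and> w [^] k = \<one>"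
    if A: "finite A" "A \<subseteq> N" and w: "w \<in> generate G A"
      and Vt: "\<And>V. (\<forall>x \<in> generate G A. V x \<in> Z) \<Longrightarrow> V \<one> = \<one> \<Longrightarrow>
        (\<forall>x \<in> generate G A. \<forall>y \<in> generate G A. V (x \<otimes> y) = V x \<otimes> V y) \<Longrightarrow> \<exists>j::nat. j > 0 \<and> V w [^] j = \<one>"
    for A w
  proof -
    obtain V and k :: nat where k: "k > 0" and V: "\<forall>x \<in> generate G A. V x \<in> Z"
      "\<forall>z \<in> Z \<inter> generate G A. V z = z [^] k"
      "\<forall>x \<in> generate G A. \<forall>y \<in> generate G A. V (x \<otimes> y) = V x \<otimes> V y"
      using hom[OF A] by (elim exE conjE) (rule that)
    have Ac: "A \<subseteq> carrier G" using A Nc by blast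
    have sub: "subgroup (generate G A) G" using generate_is_subgroup[OF Ac] .
    have wN: "w \<in> N" using generate_subgroup_incl[OF A(2) N] w by blast
    have wc: "w \<in> carrier G" using Nc[OF wN] .
    have V1: "V \<one> = \<one>" using V(2) subgroup.one_closed[OF Z] generate.one[of G A] by simp
    then obtain j :: nat where j: "j > 0" "V w [^] j = \<one>" using Vt[OF V(1) _ V(3)] by blast
    have Vp: "V (w [^] (i::nat)) = V w [^] i" for i
    proof (induction i)
      case (Suc i)
      then show ?case using V(3) subgroup_nat_pow_closed[OF sub w] w by simp
    qed (simp add: V1)
    obtain i :: nat where i: "i > 0" "w [^] i \<in> Z" using lf_mod_pow[OF N Z lf wN] by blast
    have Vwc: "V w \<in> carrier G" using V(1) w Zc by blast
    have "w [^] (i * k) = V (w [^] i)" using V(2) i(2) subgroup_nat_pow_closed[OF sub w] wc by (simp add: nat_pow_pow)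
    also have "\<dots> = V w [^] i" by (rule Vp)
    finally have "w [^] (i * k * j) = (V w [^] i) [^] j" using wc by (simp add: nat_pow_pow[symmetric])
    also have "\<dots> = (V w [^] j) [^] i" using Vwc by (simp add: nat_pow_pow mult.commute)
    finally have "w [^] (i * k * j) = \<one>" using j by simp
    then show ?thesis using i(1) k j(1) by (intro exI[of _ "i * k * j"]) simp
  qed
  have Zpow: "(x \<otimes> y) [^] (n::nat) = x [^] n \<otimes> y [^] n" if "x \<in> Z" "y \<in> Z" for x y n
    using pow_mult_distrib[OF cen[OF that(1) Zc[OF that(2)]] Zc[OF that(1)] Zc[OF that(2)]] .
  have KN: "K \<subseteq> N" unfolding K_def by blast
  show subK: "subgroup K G"
  proof (rule subgroupI)
    show "K \<subseteq> carrier G" using KN Nc by blast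
    show "K \<noteq> {}" using subgroup.one_closed[OF N] unfolding K_def by (auto intro!: exI[of _ \<one>] exI[of _ "1::nat"])
    show "inv x \<in> K" if x: "x \<in> K" for x
      using x subgroup.m_inv_closed[OF N] Nc unfolding K_def by (auto simp: nat_pow_inv)
    show "x \<otimes> y \<in> K" if x: "x \<in> K" and y: "y \<in> K" for x y
    proof -
      have xN: "x \<in> N" "y \<in> N" using x y KN by auto
      have g: "x \<in> generate G {x, y}" "y \<in> generate G {x, y}" by (auto intro: generate.incl)
      have "\<exists>k::nat. k > 0 \<and> (x \<otimes> y) [^] k = \<one>"
      proof (rule tor[of "{x, y}"])
        show "x \<otimes> y \<in> generate G {x, y}" using g by (rule generate.eng)
        fix V assume V: "\<forall>x \<in> generate G {x, y}. V x \<in> Z" "V \<one> = \<one>"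
          "\<forall>a \<in> generate G {x, y}. \<forall>b \<in> generate G {x, y}. V (a \<otimes> b) = V a \<otimes> V b"
        have sub: "subgroup (generate G {x, y}) G" using generate_is_subgroup xN Nc by simp
        have Vp: "V (w [^] (i::nat)) = V w [^] i" if w: "w \<in> generate G {x, y}" for w i
          by (induction i) (use V subgroup_nat_pow_closed[OF sub w] w in auto)
        have VZ: "V x \<in> Z" "V y \<in> Z" using V(1) g by auto
        obtain i j :: nat where ij: "i > 0" "x [^] i = \<one>" "j > 0" "y [^] j = \<one>"
          using x y unfolding K_def by blast
        have "V x [^] i = \<one>" using Vp[OF g(1), of i] ij(2) V(2) by simp
        moreover have "V y [^] j = \<one>" using Vp[OF g(2), of j] ij(4) V(2) by simp
        moreover have "V (x \<otimes> y) = V x \<otimes> V y" using V(3) g by blast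
        moreover have "(V x \<otimes> V y) [^] (i * j) = (V x [^] i) [^] j \<otimes> (V y [^] j) [^] i"
          using Zpow[OF VZ] Zc[OF VZ(1)] Zc[OF VZ(2)] by (simp add: nat_pow_pow mult.commute)
        ultimately have "V (x \<otimes> y) [^] (i * j) = \<one>" by simp
        then show "\<exists>j::nat. j > 0 \<and> V (x \<otimes> y) [^] j = \<one>" using ij by (intro exI[of _ "i * j"]) simp
      qed (use xN in auto)
      then show ?thesis unfolding K_def using subgroup.m_closed[OF N xN] by blast
    qed
  qed
  show "x \<otimes> y \<otimes> inv x \<otimes> inv y \<in> K" if xy: "x \<in> N" "y \<in> N" for x y
  proof -
    let ?c = "x \<otimes> y \<otimes> inv x \<otimes> inv y"
    have c: "x \<in> carrier G" "y \<in> carrier G" using xy Nc by auto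
    have g: "x \<in> generate G {x, y}" "y \<in> generate G {x, y}" by (auto intro: generate.incl)
    have sub: "subgroup (generate G {x, y}) G" using generate_is_subgroup c by simp
    have gc: "?c \<in> generate G {x, y}"
      using g subgroup.m_inv_closed[OF sub] by (intro subgroup.m_closed[OF sub]) auto
    have "\<exists>k::nat. k > 0 \<and> ?c [^] k = \<one>"
    proof (rule tor[of "{x, y}", OF _ _ gc])
      fix V assume V: "\<forall>x \<in> generate G {x, y}. V x \<in> Z" "V \<one> = \<one>"
        "\<forall>a \<in> generate G {x, y}. \<forall>b \<in> generate G {x, y}. V (a \<otimes> b) = V a \<otimes> V b"
      have VZ: "V x \<in> Z" "V y \<in> Z" "V ?c \<in> Z" using V(1) g gc by auto
      have e: "?c \<otimes> (y \<otimes> x) = x \<otimes> y" using c by (simp add: m_assoc inv_cancel_left)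
      have "V ?c \<otimes> (V y \<otimes> V x) = V (?c \<otimes> (y \<otimes> x))"
        using V(3) gc g subgroup.m_closed[OF sub g(2) g(1)] by simp
      also have "\<dots> = V x \<otimes> V y" unfolding e using V(3) g by blast
      also have "\<dots> = V y \<otimes> V x" using cen[OF VZ(1) Zc[OF VZ(2)]] .
      finally have "V ?c = \<one>" using VZ Zc by simp
      then show "\<exists>j::nat. j > 0 \<and> V ?c [^] j = \<one>" by (intro exI[of _ 1]) simp
    qed (use xy in auto)
    then show ?thesis
      unfolding K_def using xy subgroup.m_inv_closed[OF N] by (auto intro!: subgroup.m_closed[OF N])
  qed
  \<comment> \<open>\<open>K\<close> is locally finite because it is so modulo
    \<open>Z \<inter> K\<close>, and this intersection is an abelian torsion group.\<close>
  have ZK: "subgroup (Z \<inter> K) G" using subgroups_Inter_pair[OF Z subK] .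
  have 1: "lf_mod G (Z \<inter> K) K" using lf_mod_Int[OF N Z lf subK KN] .
  have 2: "lf_mod G {\<one>} (Z \<inter> K)"
  proof (rule lf_mod_abelian_periodic[OF ZK])
    show "subgroup {\<one>} G" by (rule triv_subgroup)
    show "{\<one>} \<subseteq> Z \<inter> K" using subgroup.one_closed[OF ZK] by simp
    show "normalizes G (Z \<inter> K) {\<one>}" using Zc unfolding normalizes_def by simp
    show "x \<otimes> y \<otimes> inv x \<otimes> inv y \<in> {\<one>}" if "x \<in> Z \<inter> K" "y \<in> Z \<inter> K" for x y
      using that Zc[of x] Zc[of y] cen[of x y] by (simp add: m_assoc inv_cancel_left)
    show "\<exists>k::nat. k > 0 \<and> x [^] k \<in> {\<one>}" if "x \<in> Z \<inter> K" for x using that unfolding K_def by simp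
  qed
  show "lf_mod G {\<one>} K" by (rule lf_mod_trans[OF subK Int_lower2 _ 1 2]) simp
qed

section \<open>Normal subgroups of the multiplicative group\<close>

lemma mult_group_simps [simp]:
  "carrier (mult_group :: 'a::division_ring monoid) = {x. x \<noteq> 0}"
  "x \<otimes>\<^bsub>mult_group\<^esub> y = x * (y :: 'a)" "\<one>\<^bsub>mult_group\<^esub> = (1 :: 'a)"
proof -
  have "x \<in> Units ring_of_type_algebra \<longleftrightarrow> x \<noteq> 0" for x :: 'a
  proof
    assume "x \<in> Units ring_of_type_algebra"
    then show "x \<noteq> 0" by (auto simp: Units_def ring_of_type_algebra_def)
  next
    assume "x \<noteq> 0"
    then show "x \<in> Units ring_of_type_algebra"
      by (auto simp: Units_def ring_of_type_algebra_def intro!: exI[of _ "inverse x"])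
  qed
  then show "carrier (mult_group :: 'a monoid) = {x. x \<noteq> 0}"
    "x \<otimes>\<^bsub>mult_group\<^esub> y = x * (y :: 'a)" "\<one>\<^bsub>mult_group\<^esub> = (1 :: 'a)"
    by (auto simp: mult_group_def units_of_def ring_of_type_algebra_def)
qed

lemma group_mult_group: "group (mult_group :: 'a::division_ring monoid)"
proof (rule groupI)
  show "\<exists>y \<in> carrier mult_group. y \<otimes>\<^bsub>mult_group\<^esub> x = \<one>\<^bsub>mult_group\<^esub>"
    if "x \<in> carrier mult_group" for x :: 'a
    using that by (intro bexI[of _ "inverse x"]) auto
qed (auto simp: mult.assoc)

interpretation mult_group: group "mult_group :: 'a::division_ring monoid"
  by (rule group_mult_group)

lemma mult_group_inv [simp]: "x \<noteq> 0 \<Longrightarrow> inv\<^bsub>mult_group\<^esub> x = inverse (x :: 'a::division_ring)"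
  by (rule mult_group.inv_equality) auto

lemma mult_group_pow [simp]: "x [^]\<^bsub>mult_group\<^esub> (n::nat) = (x :: 'a::division_ring) ^ n"
  by (induction n) (simp_all add: power_Suc2 del: power_Suc)

lemma center_mult_group:
  "z \<in> center mult_group \<longleftrightarrow> z \<noteq> 0 \<and> (\<forall>x :: 'a::division_ring. z * x = x * z)"
  unfolding center_def by (auto, metis mult_zero_left mult_zero_right)

lemma subgroup_center_mult_group: "subgroup (center mult_group) (mult_group :: 'a::division_ring monoid)"
proof (rule mult_group.subgroupI)
  show "inv\<^bsub>mult_group\<^esub> a \<in> center mult_group" if "a \<in> center mult_group" for a :: 'a
    using that by (auto simp: center_mult_group intro: mult_commute_imp_mult_inverse_commute)
  show "a \<otimes>\<^bsub>mult_group\<^esub> b \<in> center mult_group" if "a \<in> center mult_group" "b \<in> center mult_group" for a b :: 'a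
  proof -
    have nz: "a \<noteq> 0" "b \<noteq> 0" and c: "\<And>x. a * x = x * a" "\<And>x. b * x = x * b"
      using that unfolding center_mult_group by blast+
    have "a * b * x = x * (a * b)" for x
      using c(1)[of x] c(2)[of x] by (metis mult.assoc)
    then show ?thesis using nz unfolding center_mult_group by simp
  qed
  have "1 \<in> center (mult_group :: 'a monoid)" unfolding center_mult_group by simp
  then show "center (mult_group :: 'a monoid) \<noteq> {}" by blast
qed (auto simp: center_def)

definition conj_closed :: "'a::division_ring set \<Rightarrow> bool" where
  "conj_closed N \<longleftrightarrow> (\<forall>x a. x \<noteq> 0 \<longrightarrow> a \<in> N \<longrightarrow> x * a * inverse x \<in> N)"

text \<open>
  The Cartan--Brauer--Hua identity: if \<open>p\<close> and \<open>r\<close> are the conjugates of \<open>a\<close> by \<open>x\<close> and by \<open>x + 1\<close>,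
  then \<open>(r - p) x = a - r\<close>.
\<close>

lemma abelian_normal_central:
  fixes N :: "'a::division_ring set"
  assumes nor: "conj_closed N"
    and comm: "\<And>a b. a \<in> N \<Longrightarrow> b \<in> N \<Longrightarrow> a * b = b * a" and a: "a \<in> N"
  shows "a * x = x * a"
proof (rule ccontr)
  assume ne: "a * x \<noteq> x * a"
  have x0: "x \<noteq> 0" using ne by auto
  have x1: "x + 1 \<noteq> 0"
  proof
    assume "x + 1 = 0"
    then have "x = - 1" by (simp add: eq_neg_iff_add_eq_0)
    then show False using ne by simp
  qed
  define p where "p = x * a * inverse x"
  define r where "r = (x + 1) * a * inverse (x + 1)"
  have pN: "p \<in> N" "r \<in> N" using nor a x0 x1 unfolding p_def r_def conj_closed_def by auto
  have p: "p * x = x * a" unfolding p_def using x0 by (simp add: mult.assoc)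
  have r: "r * (x + 1) = (x + 1) * a" unfolding r_def using x1 by (simp add: mult.assoc)
  have e: "(r - p) * x = a - r" using r by (simp add: algebra_simps p)
  have "r \<noteq> p"
  proof
    assume rp: "r = p"
    then have "a = p" using e by simp
    then show False using ne p by simp
  qed
  then have "r - p \<noteq> 0" by simp
  then have "inverse (r - p) * ((r - p) * x) = x" by (simp add: mult.assoc[symmetric])
  \<comment> \<open>This expresses \<open>x\<close> through \<open>a\<close> and its conjugates
    \<open>p\<close> and \<open>r\<close>, all in the commutative set \<open>N\<close>, so
    \<open>x\<close> commutes with \<open>a\<close>.\<close>
  then have x: "x = inverse (r - p) * (a - r)" unfolding e by (rule sym)
  have "(r - p) * a = a * (r - p)"
    using comm[OF a pN(1)] comm[OF a pN(2)] by (simp add: left_diff_distrib right_diff_distrib)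
  then have "inverse (r - p) * a = a * inverse (r - p)" by (rule mult_commute_imp_mult_inverse_commute)
  moreover have "(a - r) * a = a * (a - r)"
    using comm[OF a pN(2)] by (simp add: left_diff_distrib right_diff_distrib)
  ultimately have "inverse (r - p) * (a - r) * a = a * (inverse (r - p) * (a - r))" by (metis mult.assoc)
  then have "x * a = a * x" unfolding x[symmetric] .
  then show False using ne by simp
qed

text \<open>For a finite multiplicative group \<open>H\<close> this is the image of its integral
  group ring. Coefficients range over all of \<open>H\<close>, which is meaningful for finite
  \<open>H\<close> only: a sum over an infinite set is 0 by convention.\<close>

definition int_span :: "'a::ring_1 set \<Rightarrow> 'a set" where
  "int_span H = {(\<Sum>h \<in> H. of_int (n h) * h) | n. True}"

lemma int_spanI: "x = (\<Sum>h \<in> H. of_int (n h) * h) \<Longrightarrow> x \<in> int_span H"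
  unfolding int_span_def by blast

lemma int_span_0: "0 \<in> int_span H"
  by (rule int_spanI[where n = "\<lambda>_. 0"]) simp

lemma int_span_add: "x \<in> int_span H \<Longrightarrow> y \<in> int_span H \<Longrightarrow> x + y \<in> int_span H"
proof -
  assume "x \<in> int_span H" "y \<in> int_span H"
  then obtain n m where "x = (\<Sum>h \<in> H. of_int (n h) * h)" "y = (\<Sum>h \<in> H. of_int (m h) * h)"
    unfolding int_span_def by blast
  then show ?thesis
    by (intro int_spanI[where n = "\<lambda>h. n h + m h"]) (simp add: distrib_right sum.distrib)
qed

lemma int_span_of_int: "x \<in> int_span H \<Longrightarrow> of_int k * x \<in> int_span H"
proof -
  assume "x \<in> int_span H"
  then obtain n where "x = (\<Sum>h \<in> H. of_int (n h) * h)" unfolding int_span_def by blast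
  then show ?thesis
    by (intro int_spanI[where n = "\<lambda>h. k * n h"]) (simp add: sum_distrib_left mult.assoc)
qed

lemma int_span_diff: "x \<in> int_span H \<Longrightarrow> y \<in> int_span H \<Longrightarrow> x - y \<in> int_span H"
  using int_span_add[of x H "of_int (- 1) * y"] int_span_of_int[of y H "- 1"] by simp

lemma int_span_sum: "(\<And>i. i \<in> I \<Longrightarrow> f i \<in> int_span H) \<Longrightarrow> sum f I \<in> int_span H"
  by (induction I rule: infinite_finite_induct) (auto simp: int_span_0 int_span_add)

lemma int_span_base: "finite H \<Longrightarrow> h \<in> H \<Longrightarrow> h \<in> int_span H"
  by (rule int_spanI[where n = "\<lambda>g. if g = h then 1 else 0"]) (simp add: if_distrib[of of_int] if_distrib[of "\<lambda>c. c * _"] cong: if_cong)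

lemma int_span_mult:
  assumes H: "finite H" "\<And>g h. g \<in> H \<Longrightarrow> h \<in> H \<Longrightarrow> g * h \<in> H"
    and x: "x \<in> int_span H" and y: "y \<in> int_span H"
  shows "x * y \<in> int_span H"
proof -
  obtain n m where nm: "x = (\<Sum>h \<in> H. of_int (n h) * h)" "y = (\<Sum>h \<in> H. of_int (m h) * h)"
    using x y unfolding int_span_def by blast
  have "of_int (n g) * g * (of_int (m h) * h) = of_int (n g * m h) * (g * h)" for g h
  proof -
    have "g * (of_int (m h) * h) = of_int (m h) * (g * h)"
      using mult_of_int_commute[of "m h" g] by (simp add: mult.assoc[symmetric])
    then show ?thesis by (simp add: mult.assoc)
  qed
  then have e: "x * y = (\<Sum>g \<in> H. \<Sum>h \<in> H. of_int (n g * m h) * (g * h))"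
    unfolding nm sum_product by simp
  show ?thesis
    unfolding e by (intro int_span_sum int_span_of_int int_span_base H)
qed

lemma finite_int_span:
  fixes H :: "'a::ring_1 set"
  assumes H: "finite H" and m: "(m::nat) > 0" "of_nat m = (0 :: 'a)"
  shows "finite (int_span H)"
proof -
  let ?F = "H \<rightarrow>\<^sub>E {0..<int m}"
  have "int_span H \<subseteq> (\<lambda>n. \<Sum>h \<in> H. of_int (n h) * h) ` ?F"
  proof
    fix x assume "x \<in> int_span H"
    then obtain n where n: "x = (\<Sum>h \<in> H. of_int (n h) * h)" unfolding int_span_def by blast
    define n' where "n' = restrict (\<lambda>h. n h mod int m) H"
    have "of_int (n h) = (of_int (n h mod int m) :: 'a)" for h
    proof -
      have "n h = int m * (n h div int m) + n h mod int m" by simp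
      then have "(of_int (n h) :: 'a) = of_int (int m) * of_int (n h div int m) + of_int (n h mod int m)"
        by (metis of_int_add of_int_mult)
      then show ?thesis using m(2) by simp
    qed
    then have "x = (\<Sum>h \<in> H. of_int (n' h) * h)" unfolding n n'_def by simp
    moreover have "n' \<in> ?F" unfolding n'_def using m(1) by auto
    ultimately show "x \<in> (\<lambda>n. \<Sum>h \<in> H. of_int (n h) * h) ` ?F" by blast
  qed
  moreover have "finite ?F" using H by (intro finite_PiE) auto
  ultimately show ?thesis using finite_surj by blast
qed

text \<open>Nakayama's lemma for the prime 3, by elimination of one generator at a time.\<close>

lemma nakayama_three:
  fixes e :: "'i \<Rightarrow> 'a::ring_1" and u :: "'i \<Rightarrow> int" and M :: "'i \<Rightarrow> 'i \<Rightarrow> int"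
  assumes "finite I" and tf: "\<And>(k::int) (x::'a). \<not> 3 dvd k \<Longrightarrow> of_int k * x = 0 \<Longrightarrow> x = 0"
    and "\<And>i. i \<in> I \<Longrightarrow> \<not> 3 dvd u i"
    and "\<And>i. i \<in> I \<Longrightarrow> of_int (u i) * e i = (\<Sum>j \<in> I. of_int (3 * M i j) * e j)"
    and "i \<in> I"
  shows "e i = 0"
  using assms(1,3-)
proof (induction I arbitrary: u M i rule: finite_induct)
  case (insert k I)
  have oim: "of_int a * (of_int b * y) = of_int (a * b) * (y :: 'a)" for a b y by (simp add: mult.assoc)
  \<comment> \<open>The coefficient of \<open>e k\<close> after its diagonal term is moved to the
    left; it is congruent to \<open>u k\<close> modulo 3, so it stays prime to 3.\<close>
  define v where "v = u k - 3 * M k k"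
  have v: "\<not> 3 dvd v"
  proof
    assume "3 dvd v"
    then have "3 dvd v + 3 * M k k" by simp
    then show False using insert.prems(1)[of k] unfolding v_def by simp
  qed
  have ek: "of_int v * e k = (\<Sum>j \<in> I. of_int (3 * M k j) * e j)"
    using insert.prems(2)[of k] insert.hyps unfolding v_def by (simp add: algebra_simps)
  \<comment> \<open>The new system arises by multiplying row \<open>i\<close> by \<open>v\<close>
    and substituting row \<open>k\<close> for \<open>of_int v * e k\<close>; the substituted term
    carries the factor 9, so all coefficients on the right remain multiples of 3.\<close>
  have eI: "e i = 0" if i: "i \<in> I" for i
  proof (rule insert.IH[of "\<lambda>i. v * u i" "\<lambda>i j. v * M i j + 3 * M i k * M k j"])
    show "\<not> 3 dvd v * u j" if "j \<in> I" for j
      using v insert.prems(1)[of j] that prime_dvd_mult_iff[of "3::int"] by auto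
    show "of_int (v * u j) * e j = (\<Sum>l \<in> I. of_int (3 * (v * M j l + 3 * M j k * M k l)) * e l)" if j: "j \<in> I" for j
    proof -
      have "of_int (v * u j) * e j = of_int v * (of_int (u j) * e j)" by (simp add: mult.assoc)
      also have "of_int (u j) * e j = of_int (3 * M j k) * e k + (\<Sum>l \<in> I. of_int (3 * M j l) * e l)"
        using insert.prems(2)[of j] insert.hyps j by simp
      also have "of_int v * (of_int (3 * M j k) * e k + (\<Sum>l \<in> I. of_int (3 * M j l) * e l)) =
          of_int v * (of_int (3 * M j k) * e k) + (\<Sum>l \<in> I. of_int (v * (3 * M j l)) * e l)"
        by (simp only: distrib_left sum_distrib_left oim)
      also have "of_int v * (of_int (3 * M j k) * e k) = of_int (3 * M j k) * (of_int v * e k)"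
        unfolding oim by (simp only: mult.commute)
      also have "\<dots> = (\<Sum>l \<in> I. of_int (3 * M j k * (3 * M k l)) * e l)"
        unfolding ek sum_distrib_left oim ..
      also have "\<dots> + (\<Sum>l \<in> I. of_int (v * (3 * M j l)) * e l) =
          (\<Sum>l \<in> I. of_int (3 * M j k * (3 * M k l) + v * (3 * M j l)) * e l)"
        by (simp only: sum.distrib[symmetric] distrib_right[symmetric] of_int_add[symmetric])
      also have "\<dots> = (\<Sum>l \<in> I. of_int (3 * (v * M j l + 3 * M j k * M k l)) * e l)"
        by (intro sum.cong refl arg_cong2[where f = "(*)"] arg_cong[where f = of_int]) (simp add: algebra_simps)
      finally show ?thesis .
    qed
  qed (use i in auto)
  show ?case
  proof (cases "i = k")
    case True
    have "of_int v * e k = 0" unfolding ek using eI by simp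
    then show ?thesis using tf[OF v] True by blast
  next
    case False
    then show ?thesis using eI insert.prems(3) by simp
  qed
qed simp

lemma of_int_neq_0_of_nat:
  assumes "\<And>m::nat. m > 0 \<Longrightarrow> of_nat m \<noteq> (0 :: 'a::ring_1)" "k \<noteq> 0"
  shows "of_int k \<noteq> (0 :: 'a)"
proof (cases k rule: int_cases3)
  case (pos n) then show ?thesis using assms(1)[of n] by simp
next
  case (neg n) then show ?thesis using assms(1)[of n] by simp
qed (use assms(2) in simp)

lemma one_minus_mult_geometric_sum: "(1 - x) * (\<Sum>i<n. x ^ i) = 1 - (x :: 'a::ring_1) ^ n"
  by (induction n) (simp_all add: distrib_left, simp add: left_diff_distrib)

text \<open>Multiplying \<open>of_int u = 3 * w\<close> on the right by each
  \<open>g \<in> H\<close> gives a linear system for the elements of \<open>H\<close> with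
  right-hand coefficients divisible by 3. If \<open>u\<close> were prime to 3,
  \<open>nakayama_three\<close> would yield \<open>1 = 0\<close>.\<close>

lemma three_not_unit_mod_int_span:
  fixes H :: "'a::division_ring set"
  assumes ch: "\<And>m::nat. m > 0 \<Longrightarrow> of_nat m \<noteq> (0 :: 'a)"
    and H: "finite H" "1 \<in> H" "0 \<notin> H" "\<And>g h. g \<in> H \<Longrightarrow> h \<in> H \<Longrightarrow> g * h \<in> H"
      "\<And>g. g \<in> H \<Longrightarrow> inverse g \<in> H"
    and w: "w \<in> int_span H" and u: "of_int u = 3 * w"
  shows "3 dvd u"
proof (rule ccontr)
  assume nd: "\<not> 3 dvd u"
  obtain n where n: "w = (\<Sum>h \<in> H. of_int (n h) * h)" using w unfolding int_span_def by blast
  have tf: "x = 0" if "\<not> 3 dvd k" "of_int k * x = (0::'a)" for k x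
  proof -
    have "k \<noteq> 0" using that(1) by auto
    then show ?thesis using of_int_neq_0_of_nat[OF ch, of k] that(2) by simp
  qed
  have e: "of_int u * g = (\<Sum>j \<in> H. of_int (3 * n (j * inverse g)) * j)" if g: "g \<in> H" for g
  proof -
    have g0: "g \<noteq> 0" using g H(3) by auto
    have "of_int u * g = (\<Sum>h \<in> H. of_int (3 * n h) * (h * g))"
      unfolding u n by (simp add: sum_distrib_left sum_distrib_right mult.assoc)
    also have "\<dots> = (\<Sum>j \<in> H. of_int (3 * n (j * inverse g)) * j)"
      by (rule sum.reindex_bij_witness[of _ "\<lambda>j. j * inverse g" "\<lambda>h. h * g"])
        (use g g0 H(4,5) in \<open>auto simp: mult.assoc\<close>)
    finally show ?thesis .
  qed
  have "(1::'a) = 0"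
    using nakayama_three[of H "\<lambda>_. u" "\<lambda>x. x" "\<lambda>g j. n (j * inverse g)" 1] H(1,2) tf nd e by blast
  then show False by simp
qed

text \<open>
  In characteristic zero let \<open>R\<close> be the localization of \<open>\<int>[H]\<close> at 3. The element
  \<open>c = (1 + 3b)(1 + 3b')\<^sup>-\<^sup>1\<close> with \<open>b' = a b a\<^sup>-\<^sup>1\<close> is the product of \<open>(1 + 3b) a (1 + 3b)\<^sup>-\<^sup>1\<close> and \<open>a\<^sup>-\<^sup>1\<close>, so it lies
  in \<open>N\<close> and has finite order; but it is congruent to 1 modulo \<open>3R\<close>, and \<open>3\<close> is not a unit of \<open>R\<close>.
\<close>

lemma lf_normal_imp_commute:
  fixes N :: "'a::division_ring set"
  assumes N: "subgroup N mult_group" and nor: "conj_closed N" and lf: "lf_mod mult_group {1} N"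
    and ab: "a \<in> N" "b \<in> N"
  shows "a * b = b * a"
proof (rule ccontr)
  assume ne: "a * b \<noteq> b * a"
  have N0: "x \<noteq> 0" if "x \<in> N" for x using subgroup.mem_carrier[OF N that] by simp
  have Nm: "x * y \<in> N" if "x \<in> N" "y \<in> N" for x y using subgroup.m_closed[OF N that] by simp
  have Ni: "inverse x \<in> N" if "x \<in> N" for x using subgroup.m_inv_closed[OF N that] N0[OF that] by simp
  have sub: "{a, b} \<subseteq> N" using ab by simp
  define H where "H = generate mult_group {a, b}"
  have Hf: "finite H"
    unfolding H_def using mult_group.lf_mod_one_imp_finite_generate[OF N _ _ sub] lf by simp
  have sH: "subgroup H mult_group"
    unfolding H_def using mult_group.generate_is_subgroup[of "{a, b}"] N0 ab by auto
  have HN: "H \<subseteq> N" unfolding H_def using mult_group.generate_subgroup_incl[OF sub N] .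
  have H0: "x \<noteq> 0" if "x \<in> H" for x using HN N0 that by blast
  have H1: "1 \<in> H" using subgroup.one_closed[OF sH] by simp
  have Hm: "x * y \<in> H" if "x \<in> H" "y \<in> H" for x y using subgroup.m_closed[OF sH that] by simp
  have Hi: "inverse x \<in> H" if "x \<in> H" for x using subgroup.m_inv_closed[OF sH that] H0[OF that] by simp
  have abH: "a \<in> H" "b \<in> H" unfolding H_def by (auto intro: generate.incl)
  define \<Lambda> where "\<Lambda> = int_span H"
  have \<Lambda>H: "x \<in> \<Lambda>" if "x \<in> H" for x unfolding \<Lambda>_def using int_span_base[OF Hf that] .
  have \<Lambda>m: "x * y \<in> \<Lambda>" if "x \<in> \<Lambda>" "y \<in> \<Lambda>" for x y
    using int_span_mult[OF Hf Hm] that unfolding \<Lambda>_def by blast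
  show False
  proof (cases "\<exists>m::nat. m > 0 \<and> of_nat m = (0::'a)")
    case True
    then have "finite \<Lambda>" unfolding \<Lambda>_def using finite_int_span[OF Hf] by blast
    then have "a * b = b * a"
      by (rule Wedderburn_little) (use \<Lambda>H H1 abH \<Lambda>m int_span_diff in \<open>auto simp: \<Lambda>_def\<close>)
    then show False using ne by simp
  next
    case False
    then have ch: "of_nat m \<noteq> (0::'a)" if "m > 0" for m :: nat using that by blast
    have i0: "of_int k \<noteq> (0::'a)" if "k \<noteq> 0" for k using of_int_neq_0_of_nat[OF ch that] .
    have t0: "(3::'a) \<noteq> 0" using i0[of 3] by simp
    have pw: "\<exists>k::nat. k > 0 \<and> x ^ k = 1" if "x \<in> N" for x
      using mult_group.lf_mod_pow[OF N mult_group.triv_subgroup _ that] lf by simp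
    define R where "R = {x. \<exists>s::int. \<not> 3 dvd s \<and> of_int s * x \<in> \<Lambda>}"
    have RI: "x \<in> R" if "\<not> 3 dvd s" "of_int s * x \<in> \<Lambda>" for x and s :: int
      using that unfolding R_def by blast
    have RE: "\<exists>s::int. \<not> 3 dvd s \<and> of_int s * x \<in> \<Lambda>" if "x \<in> R" for x
      using that unfolding R_def by blast
    have pr: "\<not> 3 dvd s * t" if "\<not> 3 dvd s" "\<not> 3 dvd t" for s t :: int
      using that prime_dvd_mult_iff[of "3::int" s t] by auto
    have oc: "x * of_int s = of_int s * x" for x :: 'a and s by (rule mult_of_int_commute[symmetric])
    have \<Lambda>R: "x \<in> R" if "x \<in> \<Lambda>" for x unfolding R_def using that by (auto intro!: exI[of _ 1])
    have Radd: "x + y \<in> R" if "x \<in> R" "y \<in> R" for x y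
    proof -
      obtain s t where st: "\<not> 3 dvd s" "of_int s * x \<in> \<Lambda>" "\<not> 3 dvd t" "of_int t * y \<in> \<Lambda>"
        using RE[OF \<open>x \<in> R\<close>] RE[OF \<open>y \<in> R\<close>] by (elim exE conjE) (rule that)
      have "of_int (s * t) * (x + y) = of_int t * (of_int s * x) + of_int s * (of_int t * y)"
        by (simp add: distrib_left mult.assoc[symmetric] flip: of_int_mult) (simp add: mult.commute)
      then have "of_int (s * t) * (x + y) \<in> \<Lambda>"
        using int_span_add[OF int_span_of_int int_span_of_int] st(2,4) unfolding \<Lambda>_def by metis
      then show ?thesis using RI pr[OF st(1,3)] by blast
    qed
    have Rmul: "x * y \<in> R" if "x \<in> R" "y \<in> R" for x y
    proof -
      obtain s t where st: "\<not> 3 dvd s" "of_int s * x \<in> \<Lambda>" "\<not> 3 dvd t" "of_int t * y \<in> \<Lambda>"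
        using RE[OF \<open>x \<in> R\<close>] RE[OF \<open>y \<in> R\<close>] by (elim exE conjE) (rule that)
      have "of_int s * x * (of_int t * y) = of_int s * (x * of_int t) * y" by (simp add: mult.assoc)
      also have "\<dots> = of_int (s * t) * (x * y)" unfolding oc by (simp add: mult.assoc)
      finally have "of_int (s * t) * (x * y) \<in> \<Lambda>" using \<Lambda>m[OF st(2,4)] by simp
      then show ?thesis using RI pr[OF st(1,3)] by blast
    qed
    have Rm: "- x \<in> R" if "x \<in> R" for x
      using Rmul[OF \<Lambda>R that, of "- 1"] int_span_of_int[of 1 H "- 1"] \<Lambda>H[OF H1] unfolding \<Lambda>_def by simp
    have R0: "0 \<in> R" using \<Lambda>R int_span_0 unfolding \<Lambda>_def by blast
    have Rsum: "sum f I \<in> R" if "\<And>i. i \<in> I \<Longrightarrow> f i \<in> R" for f and I :: "nat set"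
      using that by (induction I rule: infinite_finite_induct) (auto simp: R0 Radd)
    have no: False if k: "\<not> 3 dvd k" "of_int k = 3 * r" "r \<in> R" for k r
    proof -
      obtain s where s: "\<not> 3 dvd s" "of_int s * r \<in> \<Lambda>" using RE[OF \<open>r \<in> R\<close>] by (elim exE conjE) (rule that)
      have "of_int (s * k) = of_int s * (3 * r)" using k(2) by simp
      also have "\<dots> = 3 * (of_int s * r)" using oc[of 3 s] by (simp add: mult.assoc[symmetric])
      finally have "3 dvd s * k"
        using three_not_unit_mod_int_span[OF ch Hf H1 _ Hm Hi s(2)[unfolded \<Lambda>_def]] H0 by blast
      then show False using pr[OF s(1) k(1)] by blast
    qed
    have unit: "1 + 3 * g \<noteq> 0 \<and> inverse (1 + 3 * g) \<in> R" if g: "g \<in> H" for g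
    proof -
      obtain m :: nat where m: "m > 0" "g ^ m = 1" using pw HN g by blast
      \<comment> \<open>The inverse of \<open>1 + 3 * g\<close> comes from the finite geometric
        series in \<open>- 3 * g\<close>. As \<open>g ^ m = 1\<close>, the series times
        \<open>1 + 3 * g\<close> is the integer \<open>K\<close>, which is congruent to 1 modulo
        3.\<close>
      define K where "K = 1 - (- 3 :: int) ^ m"
      define S where "S = (\<Sum>i<m. (- 3 * g) ^ i)"
      have "(- 3 * g) ^ i = of_int ((- 3) ^ i) * g ^ i" for i
      proof (induction i)
        case (Suc i)
        have "(- 3 * g) ^ Suc i = of_int (- 3) * (g * of_int ((- 3) ^ i)) * g ^ i"
          using Suc by (simp add: mult.assoc)
        also have "\<dots> = of_int ((- 3) ^ Suc i) * g ^ Suc i" unfolding oc by (simp add: mult.assoc)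
        finally show ?case .
      qed simp
      note pg = this
      have Hp: "g ^ i \<in> H" for i by (induction i) (auto simp: H1 Hm g)
      have K3: "\<not> 3 dvd K"
      proof
        assume "3 dvd K"
        moreover have "(3::int) dvd (- 3) ^ m"
          using m(1) dvd_trans[of "3::int" "- 3" "(- 3) ^ m"] dvd_power[of m "- 3 :: int"] by simp
        ultimately have "3 dvd K + (- 3) ^ m" by (rule dvd_add)
        then show False unfolding K_def by simp
      qed
      have "(1 - (- 3 * g)) * S = 1 - (- 3 * g) ^ m" unfolding S_def by (rule one_minus_mult_geometric_sum)
      then have e: "(1 + 3 * g) * S = of_int K" unfolding pg m(2) K_def by simp
      have K0: "of_int K \<noteq> (0::'a)" using i0[of K] K3 by auto
      have n0: "1 + 3 * g \<noteq> 0" using e K0 by auto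
      have "S = inverse (1 + 3 * g) * ((1 + 3 * g) * S)" using n0 by (simp add: mult.assoc[symmetric])
      also have "\<dots> = of_int K * inverse (1 + 3 * g)" unfolding e oc ..
      finally have "of_int K * inverse (1 + 3 * g) = S" ..
      also have "S \<in> \<Lambda>"
        unfolding S_def pg \<Lambda>_def by (intro int_span_sum int_span_of_int int_span_base Hf Hp)
      finally show ?thesis unfolding R_def using n0 K3 by blast
    qed
    define b' where "b' = a * b * inverse a"
    have b'H: "b' \<in> H" unfolding b'_def using Hm Hi abH by simp
    have a0: "a \<noteq> 0" using N0 ab by simp
    have bb': "b \<noteq> b'"
    proof
      assume "b = b'"
      then have "b * a = a * b" unfolding b'_def using a0 by (metis mult.assoc left_inverse mult_1_right)
      then show False using ne by simp
    qed
    define x where "x = 1 + 3 * b"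
    define x' where "x' = 1 + 3 * b'"
    have x0: "x \<noteq> 0" "x' \<noteq> 0" "inverse x' \<in> R" using unit abH b'H unfolding x_def x'_def by auto
    have ax: "a * x = x' * a"
    proof -
      have "a * 3 = 3 * a" using oc[of a 3] by simp
      moreover have "b' * a = a * b" unfolding b'_def using a0 by (simp add: mult.assoc)
      ultimately show ?thesis unfolding x_def x'_def
        by (simp add: distrib_left distrib_right mult.assoc) (simp add: mult.assoc[symmetric])
    qed
    define c where "c = x * inverse x'"
    define y where "y = (b - b') * inverse x'"
    have "c = (x * a * inverse x) * inverse a"
    proof -
      have "a * inverse x = inverse x' * a"
      proof -
        have "x' * a * inverse x = a" unfolding ax[symmetric] using x0(1) by (simp add: mult.assoc)
        then have "inverse x' * (x' * (a * inverse x)) = inverse x' * a" by (simp add: mult.assoc)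
        then show ?thesis using x0(2) by (simp add: mult.assoc[symmetric])
      qed
      then have "a * inverse x * inverse a = inverse x'" using a0 by (simp add: mult.assoc)
      then show ?thesis unfolding c_def by (simp add: mult.assoc)
    qed
    moreover have "x * a * inverse x \<in> N" using nor ab(1) x0(1) unfolding conj_closed_def by blast
    ultimately have cN: "c \<in> N" using Nm Ni[OF ab(1)] by simp
    have "b - b' \<in> \<Lambda>" using int_span_diff \<Lambda>H[OF abH(2)] \<Lambda>H[OF b'H] unfolding \<Lambda>_def by blast
    then have yR: "y \<in> R" unfolding y_def using Rmul[OF \<Lambda>R x0(3)] by simp
    have cy: "c = 1 + 3 * y"
    proof -
      have "x = x' + 3 * (b - b')" unfolding x_def x'_def by (simp add: right_diff_distrib)
      then have "x * inverse x' = (x' + 3 * (b - b')) * inverse x'" by (rule arg_cong)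
      then show ?thesis unfolding c_def y_def by (simp only: distrib_right mult.assoc right_inverse[OF x0(2)])
    qed
    have c1: "c \<noteq> 1"
    proof
      assume "c = 1"
      then have "y = 0" using cy t0 by simp
      then show False unfolding y_def using bb' x0 by simp
    qed
    define k where "k = (LEAST k::nat. k > 0 \<and> c ^ k = 1)"
    have k: "k > 0" "c ^ k = 1" using LeastI_ex[OF pw[OF cN]] unfolding k_def by auto
    have least: "c ^ j \<noteq> 1" if "0 < j" "j < k" for j using not_less_Least[of j] that unfolding k_def by blast
    have "k \<noteq> 1" using k(2) c1 by auto
    then obtain q where q: "prime q" "q dvd k" using prime_factor_nat by blast
    \<comment> \<open>A power of \<open>c\<close> of prime order \<open>q\<close>, still congruent
      to 1 modulo 3. The sum of its powers below \<open>q\<close> is 0, and this sum is now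
      evaluated modulo 3.\<close>
    define d where "d = c ^ (k div q)"
    have kq: "k = (k div q) * q" using q(2) by simp
    have qk: "0 < k div q" "k div q < k"
      using q prime_gt_1_nat[OF q(1)] k(1) by (auto simp: div_greater_zero_iff dvd_imp_le)
    have d1: "d \<noteq> 1" unfolding d_def using least[OF qk] .
    have dq: "d ^ q = 1" unfolding d_def power_mult[symmetric] using kq k(2) by simp
    have P: "\<exists>r \<in> R. z ^ i = 1 + 3 * r" if z: "z = 1 + 3 * w" "w \<in> R" for z w :: 'a and i
    proof (induction i)
      case (Suc i)
      then obtain r where r: "r \<in> R" "z ^ i = 1 + 3 * r" by blast
      have w3: "w * 3 = 3 * w" using oc[of w 3] by simp
      have "3 * w * (3 * r) = 3 * (w * 3) * r" by (simp only: mult.assoc)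
      also have "\<dots> = 3 * (3 * (w * r))" by (simp only: w3 mult.assoc)
      finally have w33: "3 * w * (3 * r) = 3 * (3 * (w * r))" .
      have "z ^ Suc i = (1 + 3 * w) * (1 + 3 * r)" using r(2) z(1) by (metis power_Suc)
      also have "\<dots> = 1 + 3 * (r + w + 3 * (w * r))"
        by (simp only: distrib_left distrib_right mult_1_left mult_1_right w33 add_ac)
      finally have "z ^ Suc i = 1 + 3 * (r + w + 3 * (w * r))" .
      moreover have "3 * (w * r) \<in> R"
        using Rmul[OF \<Lambda>R Rmul[OF z(2) r(1)], of 3] int_span_of_int[of 1 H 3] \<Lambda>H[OF H1] unfolding \<Lambda>_def by simp
      ultimately show ?case using Radd[OF Radd[OF r(1) z(2)]] by blast
    next
      case 0
      show ?case by (rule bexI[OF _ R0]) simp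
    qed
    obtain w where w: "w \<in> R" "d = 1 + 3 * w" unfolding d_def using P[OF cy yR] by blast
    have "(1 - d) * (\<Sum>i<q. d ^ i) = 0" using one_minus_mult_geometric_sum[of d q] dq by simp
    then have S0: "(\<Sum>i<q. d ^ i) = 0" using d1 by simp
    show False
    \<comment> \<open>For \<open>q \<noteq> 3\<close> the vanishing sum is congruent to
      \<open>q\<close> modulo 3, so 3 would divide \<open>q\<close>. For \<open>q = 3\<close> that
      congruence is empty and one more order is used: the sum is 3 times an element congruent to 1
      modulo 3.\<close>
    proof (cases "q = 3")
      case True
      have w3: "w * 3 = 3 * w" using oc[of w 3] by simp
      have "(\<Sum>i<q. d ^ i) = 1 + d + d * d" using True by (simp add: eval_nat_numeral)
      also have "\<dots> = 3 * (1 + 3 * (w + w * w))"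
      proof -
        have "3 * w * (3 * w) = 3 * (w * 3) * w" by (simp only: mult.assoc)
        also have "\<dots> = 3 * (3 * (w * w))" by (simp only: w3 mult.assoc)
        finally have ww: "3 * w * (3 * w) = 3 * (3 * (w * w))" .
        have "d * d = 1 + 3 * w + 3 * w + 3 * (3 * (w * w))"
          unfolding w(2) by (simp only: distrib_left distrib_right mult_1_left mult_1_right ww add_ac)
        then have "1 + d + d * d = (1 + 1 + 1) + (3 * w + 3 * w + 3 * w) + 3 * (3 * (w * w))"
          unfolding w(2) by (simp only: add_ac)
        also have "3 * w + 3 * w + 3 * w = (1 + 1 + 1) * (3 * w)" by (simp only: distrib_right mult_1_left)
        also have "(1 + 1 + 1 :: 'a) = 3" by simp
        also have "3 + 3 * (3 * w) + 3 * (3 * (w * w)) = 3 * (1 + 3 * (w + w * w))"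
          by (simp only: distrib_left mult_1_right add_ac)
        finally show ?thesis .
      qed
      finally have "3 * (1 + 3 * (w + w * w)) = 0" using S0 by (rule trans[OF sym])
      then have "1 + 3 * (w + w * w) = 0" by (simp only: mult_eq_0_iff t0 simp_thms)
      then have "of_int 1 = 3 * (- (w + w * w))" by (simp only: eq_neg_iff_add_eq_0 of_int_1 mult_minus_right)
      then show False using no[OF _ _ Rm[OF Radd[OF w(1) Rmul[OF w(1) w(1)]]], of 1] by simp
    next
      case False
      have "\<forall>i. \<exists>r. r \<in> R \<and> d ^ i = 1 + 3 * r" using P[OF w(2,1)] by blast
      from choice[OF this] obtain r where r: "\<forall>i. r i \<in> R \<and> d ^ i = 1 + 3 * r i"
        by (elim exE) (rule that)
      have "(\<Sum>i<q. d ^ i) = (\<Sum>i<q. 1 + 3 * r i)" by (rule sum.cong[OF refl]) (use r in blast)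
      also have "\<dots> = of_nat q + 3 * (\<Sum>i<q. r i)" by (simp add: sum.distrib sum_distrib_left)
      finally have "(\<Sum>i<q. d ^ i) = of_nat q + 3 * (\<Sum>i<q. r i)" .
      then have "of_int (int q) = 3 * (- (\<Sum>i<q. r i))" using S0 by (simp add: eq_neg_iff_add_eq_0)
      moreover have "\<not> 3 dvd int q"
      proof
        assume "3 dvd int q"
        then have "3 dvd q" using int_dvd_int_iff[of 3 q] by simp
        then show False using q(1) False by (auto simp: prime_nat_iff)
      qed
      ultimately show False using no Rm[OF Rsum[of _ r]] r by blast
    qed
  qed
qed

text \<open>
  For \<open>s = b + t\<close> the element \<open>s (a s a\<^sup>-\<^sup>1)\<^sup>-\<^sup>1\<close> lies in \<open>N\<close>, hence differs from its conjugate by \<open>a\<close> only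
  by a central factor. Clearing denominators gives a quadratic equation for \<open>b\<close> over the centre.
\<close>

lemma class_two_relation:
  fixes a b l t :: "'a::division_ring"
  assumes nor: "conj_closed N"
    and m: "\<And>x y. x \<in> N \<Longrightarrow> y \<in> N \<Longrightarrow> x * y \<in> N" and i: "\<And>x. x \<in> N \<Longrightarrow> inverse x \<in> N"
    and cen: "\<And>x y z. x \<in> N \<Longrightarrow> y \<in> N \<Longrightarrow> x * y * inverse x * inverse y * z = z * (x * y * inverse x * inverse y)"
    and ab: "a \<in> N" "b \<in> N" "a \<noteq> 0" "b \<noteq> 0" and l: "a * b = l * (b * a)" "l \<noteq> 1"
    and lc: "\<And>z. l * z = z * l" and t: "t \<noteq> 0" "\<And>z. t * z = z * t"
  shows "l * (l * (l * (b * b))) = t * t"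
proof -
  \<comment> \<open>\<open>s1\<close> and \<open>s2\<close> are the conjugates of \<open>s\<close>
    by \<open>a\<close> and by its square, because conjugation by \<open>a\<close> multiplies
    \<open>b\<close> by the central \<open>l\<close> and fixes \<open>t\<close>.\<close>
  define s where "s = b + t"
  define s1 where "s1 = l * b + t"
  define s2 where "s2 = l * (l * b) + t"
  have "s \<noteq> 0"
  proof
    assume "s = 0"
    then have "b = - t" unfolding s_def by (simp add: eq_neg_iff_add_eq_0)
    then have "a * b = b * a" using t(2)[of a] by simp
    then have "(l - 1) * (b * a) = 0" using l(1) by (simp add: left_diff_distrib)
    then show False using l(2) ab by simp
  qed
  have as: "a * s = s1 * a" and as1: "a * s1 = s2 * a"
  proof -
    have "a * (l * b) = l * (a * b)" using lc[of a] by (simp add: mult.assoc[symmetric])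
    then have "a * (l * b) = l * (l * b) * a" unfolding l(1) by (simp add: mult.assoc)
    then show "a * s1 = s2 * a" unfolding s1_def s2_def by (simp add: distrib_left distrib_right t(2)[of a, symmetric])
    show "a * s = s1 * a" unfolding s_def s1_def
      by (simp add: distrib_left distrib_right l(1) mult.assoc t(2)[of a, symmetric])
  qed
  have s10: "s1 \<noteq> 0" and s20: "s2 \<noteq> 0" using as as1 \<open>s \<noteq> 0\<close> ab(3) by auto
  define u where "u = s * inverse s1"
  have conj: "y * inverse x = inverse x' * y" if "y * x = x' * y" "x \<noteq> 0" "x' \<noteq> 0" for x x' y :: 'a
  proof -
    have "x' * (y * inverse x) = y" using that by (simp add: mult.assoc[symmetric]) (simp add: mult.assoc flip: that(1))
    then have "inverse x' * (x' * (y * inverse x)) = inverse x' * y" by (rule arg_cong)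
    then show ?thesis using that(3) by (simp add: mult.assoc[symmetric])
  qed
  have "a * inverse s * inverse a = inverse s1"
    unfolding conj[OF as \<open>s \<noteq> 0\<close> s10] using ab(3) by (simp add: mult.assoc)
  then have "u = (s * a * inverse s) * inverse a" unfolding u_def by (simp add: mult.assoc)
  moreover have "s * a * inverse s \<in> N" using nor ab(1) \<open>s \<noteq> 0\<close> unfolding conj_closed_def by blast
  ultimately have uN: "u \<in> N" using m i ab(1) by simp
  have u0: "u \<noteq> 0" unfolding u_def using \<open>s \<noteq> 0\<close> s10 by simp
  define \<mu> where "\<mu> = a * u * inverse a * inverse u"
  have \<mu>c: "\<mu> * z = z * \<mu>" for z unfolding \<mu>_def using cen[OF ab(1) uN] .
  have "a * u = s1 * (a * inverse s1)" unfolding u_def by (simp add: mult.assoc[symmetric] as)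
  also have "\<dots> = s1 * inverse s2 * a" unfolding conj[OF as1 s10 s20] by (simp add: mult.assoc)
  finally have au: "a * u = s1 * inverse s2 * a" .
  have "a * u = \<mu> * u * a"
  proof -
    have "\<mu> * (u * a) = a * u" unfolding \<mu>_def using u0 ab(3) by (simp add: mult.assoc)
        (simp add: mult.assoc[symmetric])
    then show ?thesis by (simp add: mult.assoc)
  qed
  then have "s1 * inverse s2 * a = \<mu> * u * a" using au by simp
  then have e0: "s1 * inverse s2 = \<mu> * (s * inverse s1)" using ab(3) unfolding u_def by simp
  have tl: "t * (l * z) = l * (t * z)" "t * l = l * t" for z using t(2)[of l] by (simp_all add: mult.assoc[symmetric])
  have bl: "b * (l * z) = l * (b * z)" "b * l = l * b" for z using lc[of b] by (simp_all add: mult.assoc[symmetric])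
  have bt: "b * (t * z) = t * (b * z)" "b * t = t * b" for z using t(2)[of b] by (simp_all add: mult.assoc[symmetric])
  have al: "a * (l * z) = l * (a * z)" "a * l = l * a" for z using lc[of a] by (simp_all add: mult.assoc[symmetric])
  have at: "a * (t * z) = t * (a * z)" "a * t = t * a" for z using t(2)[of a] by (simp_all add: mult.assoc[symmetric])
  have a\<mu>: "a * (\<mu> * z) = \<mu> * (a * z)" "a * \<mu> = \<mu> * a" for z using \<mu>c[of a] by (simp_all add: mult.assoc[symmetric])
  have l\<mu>: "l * (\<mu> * z) = \<mu> * (l * z)" "l * \<mu> = \<mu> * l" for z using \<mu>c[of l] by (simp_all add: mult.assoc[symmetric])
  have lab: "a * b = l * (b * a)" "a * (b * z) = l * (b * (a * z))" for z
    using l(1) by (simp_all add: mult.assoc[symmetric])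
  have c12: "s1 * s2 = s2 * s1" "s * s2 = s2 * s" "s1 * s = s * s1"
    unfolding s_def s1_def s2_def by (simp_all add: distrib_left distrib_right mult.assoc tl bl bt add_ac)
  \<comment> \<open>The relation between \<open>u\<close> and its conjugate by \<open>a\<close>
    reads \<open>s1 * inverse s2 = \<mu> * (s * inverse s1)\<close>. The denominators can be cleared
    because \<open>s\<close>, \<open>s1\<close> and \<open>s2\<close> commute with each
    other.\<close>
  have E1: "s1 * s1 = \<mu> * (s * s2)"
  proof -
    have "s1 * inverse s2 * s2 * s1 = \<mu> * (s * inverse s1) * s2 * s1" unfolding e0 ..
    then have "s1 * s1 = \<mu> * (s * (inverse s1 * (s2 * s1)))" using s20 by (simp add: mult.assoc)
    also have "inverse s1 * (s2 * s1) = s2"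
      unfolding c12(1)[symmetric] using s10 by (simp add: mult.assoc[symmetric])
    finally show ?thesis .
  qed
  \<comment> \<open>Notation for \<open>E1\<close> sorted by powers of \<open>b\<close>:
    \<open>e\<close> and \<open>k\<close> are built from the central \<open>\<mu>\<close> and
    \<open>l\<close>, and \<open>Q\<close> is the square of \<open>l * b\<close>.\<close>
  define e where "e = 1 - \<mu>"
  define Q where "Q = l * (l * (b * b))"
  define k where "k = \<mu> + \<mu> * (l * l) - l - l"
  have ae: "a * (e * z) = e * (a * z)" for z unfolding e_def by (simp add: left_diff_distrib right_diff_distrib a\<mu>)
  have ak: "a * (k * z) = k * (a * z)" for z
    unfolding k_def by (simp add: left_diff_distrib right_diff_distrib distrib_left distrib_right mult.assoc a\<mu> al)
  have le: "l * (e * z) = e * (l * z)" for z unfolding e_def by (simp add: left_diff_distrib right_diff_distrib l\<mu>)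
  have lk: "l * (k * z) = k * (l * z)" for z
    unfolding k_def by (simp add: left_diff_distrib right_diff_distrib distrib_left distrib_right mult.assoc l\<mu>)
  have E2: "e * (Q + t * t) = k * (t * b)"
  proof -
    have "Q + l * (t * b) + l * (t * b) + t * t = \<mu> * Q + \<mu> * (t * b) + \<mu> * (l * (l * (t * b))) + \<mu> * (t * t)"
      using E1 unfolding s_def s1_def s2_def Q_def
      by (simp add: distrib_left distrib_right mult.assoc tl bl bt add_ac)
    then show ?thesis unfolding e_def k_def
      by (simp add: left_diff_distrib right_diff_distrib distrib_left distrib_right mult.assoc algebra_simps)
  qed
  have e0: "e \<noteq> 0"
  proof
    assume "e = 0"
    then have \<mu>1: "\<mu> = 1" unfolding e_def by simp
    have "k * (t * b) = 0" using E2 \<open>e = 0\<close> by simp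
    then have "k = 0" using t(1) ab(4) by simp
    moreover have "k = (1 - l) * (1 - l)" unfolding k_def \<mu>1 by (simp add: left_diff_distrib right_diff_distrib)
    ultimately show False using l(2) by simp
  qed
  \<comment> \<open>Conjugating \<open>E2\<close> by \<open>a\<close> replaces \<open>b\<close> by
    \<open>l * b\<close>, hence \<open>Q\<close> by \<open>l * (l * Q)\<close>. Multiplying
    \<open>E2\<close> by \<open>l\<close> gives the same right side, so the left sides agree, which
    eliminates \<open>k\<close> and, after cancellation, \<open>e\<close>.\<close>
  have E3: "e * (l * (l * Q) + t * t) = k * (t * (l * b))"
  proof -
    have "a * (e * (Q + t * t)) = a * (k * (t * b))" unfolding E2 ..
    then have "e * (l * (l * Q) + t * t) * a = k * (t * (l * b)) * a"
      unfolding ae ak Q_def by (simp add: distrib_left distrib_right mult.assoc al at lab bl)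
    then show ?thesis using ab(3) by simp
  qed
  have "l * (e * (Q + t * t)) = l * (k * (t * b))" unfolding E2 ..
  then have "e * (l * (Q + t * t)) = e * (l * (l * Q) + t * t)"
    unfolding E3 le lk tl .
  then have "l * (Q + t * t) = l * (l * Q) + t * t" using e0 by simp
  then have "(1 - l) * (l * Q - t * t) = 0"
    by (simp add: left_diff_distrib right_diff_distrib distrib_left algebra_simps)
  then have "l * Q = t * t" using l(2) by simp
  then show ?thesis unfolding Q_def .
qed

text \<open>In \<open>main\<close>, \<open>class_two_relation\<close> is used for three values of
  \<open>t\<close>: 1 and \<open>l\<close> give that the square of \<open>l\<close> is 1, so
  \<open>l = - 1\<close> and \<open>b * b = - 1\<close>; then 2, nonzero because
  \<open>l \<noteq> 1\<close>, gives \<open>4 = 1\<close>. What is left looks like quaternions in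
  characteristic 3, which have zero divisors.\<close>

lemma class_two_imp_commute:
  fixes N :: "'a::division_ring set"
  assumes N: "subgroup N mult_group" and nor: "conj_closed N"
    and cen: "\<And>x y z. x \<in> N \<Longrightarrow> y \<in> N \<Longrightarrow> x * y * inverse x * inverse y * z = z * (x * y * inverse x * inverse y)"
    and ab: "a \<in> N" "b \<in> N"
  shows "a * b = b * a"
proof (rule ccontr)
  assume ne: "a * b \<noteq> b * a"
  have N0: "x \<noteq> 0" if "x \<in> N" for x using subgroup.mem_carrier[OF N that] by simp
  have Nm: "x * y \<in> N" if "x \<in> N" "y \<in> N" for x y using subgroup.m_closed[OF N that] by simp
  have Ni: "inverse x \<in> N" if "x \<in> N" for x using subgroup.m_inv_closed[OF N that] N0[OF that] by simp
  have main: "b * b = - 1 \<and> (3 :: 'a) = 0 \<and> a * b = - (b * a)" if ab: "a \<in> N" "b \<in> N" and ne: "a * b \<noteq> b * a" for a b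
  proof -
    have a0: "a \<noteq> 0" "b \<noteq> 0" using N0 ab by auto
    define l where "l = a * b * inverse a * inverse b"
    have lc: "l * z = z * l" for z unfolding l_def by (rule cen[OF ab])
    have l: "a * b = l * (b * a)"
    proof -
      have "inverse a * (inverse b * (b * a)) = 1" using a0 by (simp add: mult.assoc[symmetric])
      then show ?thesis unfolding l_def by (simp add: mult.assoc)
    qed
    have l1: "l \<noteq> 1" using l ne by auto
    have l0: "l \<noteq> 0" using l a0 by auto
    have rel: "l * (l * (l * (b * b))) = t * t" if t: "t \<noteq> 0" "\<And>z. t * z = z * t" for t
      by (rule class_two_relation[OF nor Nm Ni cen ab a0 l l1 lc t])
    have r1: "l * (l * (l * (b * b))) = 1" using rel[of 1] by simp
    have "l * l = 1" using rel[OF l0 lc] r1 by simp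
    then have "(l - 1) * (l + 1) = 0" by (simp add: algebra_simps)
    then have l': "l = - 1" using l1 by (simp add: eq_neg_iff_add_eq_0)
    have bb: "b * b = - 1" using r1 unfolding l' by (simp add: equation_minus_iff)
    have "(2 :: 'a) \<noteq> 0"
    proof
      assume "(2 :: 'a) = 0"
      then have "(1 :: 'a) = - 1" by (simp add: eq_neg_iff_add_eq_0)
      then show False using l1 l' by simp
    qed
    moreover have "2 * z = z * 2" for z :: 'a by (simp add: mult_2 mult_2_right)
    ultimately have "(2 :: 'a) * 2 = 1" using rel[of 2] r1 by simp
    then have "(3 :: 'a) + 1 = 0 + 1" by simp
    then have "(3 :: 'a) = 0" by (rule add_right_imp_eq)
    then show ?thesis using bb l l' by simp
  qed
  have 1: "b * b = - 1" "(3 :: 'a) = 0" "a * b = - (b * a)" using main[OF ab ne] by auto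
  have 2: "a * a = - 1" using main[OF ab(2,1)] ne by metis
  \<comment> \<open>Since \<open>a\<close> and \<open>b\<close> anticommute with squares -1, the
    square of \<open>a + b\<close> is -2 and the product is 3, which is 0. So one factor vanishes,
    and \<open>a\<close> becomes a polynomial in \<open>b\<close>.\<close>
  have "(1 + (a + b)) * (1 - (a + b)) = 1 - (a * a + b * b + (a * b + b * a))"
    by (simp add: left_diff_distrib right_diff_distrib distrib_left distrib_right algebra_simps)
  also have "\<dots> = 3" unfolding 1(1,3) 2 by simp
  finally have "1 + (a + b) = 0 \<or> 1 - (a + b) = 0" using 1(2) by simp
  then have "a = - 1 - b \<or> a = 1 - b"
  proof
    assume "1 + (a + b) = 0"
    then have "a = - 1 - b" by (simp add: eq_diff_eq eq_neg_iff_add_eq_0 add_ac)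
    then show ?thesis ..
  next
    assume "1 - (a + b) = 0"
    then have "a = 1 - b" by (simp add: eq_diff_eq)
    then show ?thesis ..
  qed
  then show False using ne by (auto simp: left_diff_distrib right_diff_distrib)
qed

theorem lf_mod_center_normal_central:
  fixes N :: "'a::division_ring set"
  assumes N: "subgroup N mult_group" and nor: "conj_closed N"
    and lf: "lf_mod mult_group (center mult_group) N"
  shows "N \<subseteq> center mult_group"
proof -
  define K where "K = {x \<in> N. \<exists>k::nat. k > 0 \<and> x [^]\<^bsub>mult_group\<^esub> k = \<one>\<^bsub>mult_group\<^esub>}"
  have N0: "x \<noteq> 0" if "x \<in> N" for x using subgroup.mem_carrier[OF N that] by simp
  have cen: "z \<otimes>\<^bsub>mult_group\<^esub> x = x \<otimes>\<^bsub>mult_group\<^esub> z" if "z \<in> center mult_group" for z x :: 'a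
    using that unfolding center_mult_group by simp
  have K: "subgroup K mult_group" "lf_mod mult_group {\<one>\<^bsub>mult_group\<^esub>} K"
    "\<And>x y. x \<in> N \<Longrightarrow> y \<in> N \<Longrightarrow>
      x \<otimes>\<^bsub>mult_group\<^esub> y \<otimes>\<^bsub>mult_group\<^esub> inv\<^bsub>mult_group\<^esub> x \<otimes>\<^bsub>mult_group\<^esub> inv\<^bsub>mult_group\<^esub> y \<in> K"
    unfolding K_def
    by (rule mult_group.torsion_subgroup_of_lf_mod_center[OF N subgroup_center_mult_group cen lf]; assumption)+
  have norK: "conj_closed K"
    unfolding conj_closed_def
  proof (intro allI impI)
    fix x a :: 'a assume x: "x \<noteq> 0" and a: "a \<in> K"
    have aN: "a \<in> N" using a unfolding K_def by blast
    obtain k :: nat where k: "k > 0" "a ^ k = 1" using a unfolding K_def by auto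
    have "(x * a * inverse x) ^ n = x * a ^ n * inverse x" for n
    proof (induction n)
      case (Suc n)
      have "(x * a * inverse x) ^ Suc n = x * a * (inverse x * x) * a ^ n * inverse x"
        unfolding power_Suc Suc.IH by (simp only: mult.assoc)
      then show ?case using x by (simp add: mult.assoc)
    qed (use x in simp)
    then have "(x * a * inverse x) ^ k = 1" using k x by simp
    moreover have "x * a * inverse x \<in> N" using nor x aN unfolding conj_closed_def by blast
    ultimately show "x * a * inverse x \<in> K" unfolding K_def using k(1) by auto
  qed
  have Kc: "a * b = b * a" if "a \<in> K" "b \<in> K" for a b
    using lf_normal_imp_commute[OF K(1) norK _ that] K(2) by simp
  have Kcen: "a * z = z * a" if "a \<in> K" for a z using abelian_normal_central[OF norK Kc that] .
  have NN: "x * y * inverse x * inverse y \<in> K" if "x \<in> N" "y \<in> N" for x y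
    using K(3)[OF that] N0[OF that(1)] N0[OF that(2)] by simp
  have Nc: "a * b = b * a" if "a \<in> N" "b \<in> N" for a b
    by (rule class_two_imp_commute[OF N nor Kcen[OF NN] that])
  show ?thesis
  proof
    fix a assume a: "a \<in> N"
    then show "a \<in> center mult_group"
      unfolding center_mult_group using N0 abelian_normal_central[OF nor Nc a] by simp
  qed
qed

section \<open>Elementary matrices\<close>

lemma GL_simps [simp]:
  "x \<otimes>\<^bsub>GL n\<^esub> y = x * (y :: 'a::division_ring mat)" "\<one>\<^bsub>GL n\<^esub> = (1\<^sub>m n :: 'a mat)"
  by (simp_all add: GL_def units_of_def ring_mat_simps)

lemma carrier_GL:
  "A \<in> carrier (GL n) \<longleftrightarrow> A \<in> carrier_mat n n \<and> (\<exists>B \<in> carrier_mat n n. A * B = 1\<^sub>m n \<and> B * A = (1\<^sub>m n :: 'a::division_ring mat))"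
  by (auto simp: GL_def units_of_def Units_def ring_mat_simps)

lemma GL_carrier_mat: "A \<in> carrier (GL n) \<Longrightarrow> A \<in> carrier_mat n n"
  by (simp add: carrier_GL)

lemma group_GL: "group (GL n :: 'a::division_ring mat monoid)"
proof -
  interpret semiring "ring_mat TYPE('a) n ()" by (rule semiring_mat)
  show ?thesis unfolding GL_def by (rule units_group)
qed

interpretation GL: group "GL n :: 'a::division_ring mat monoid" for n
  by (rule group_GL)

lemma GL_inv_eqI:
  assumes "A \<in> carrier_mat n n" "B \<in> carrier_mat n n" "A * B = 1\<^sub>m n" "B * A = (1\<^sub>m n :: 'a::division_ring mat)"
  shows "A \<in> carrier (GL n)" "B \<in> carrier (GL n)" "inv\<^bsub>GL n\<^esub> A = B"
proof -
  show A: "A \<in> carrier (GL n)" and B: "B \<in> carrier (GL n)" using assms unfolding carrier_GL by blast+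
  show "inv\<^bsub>GL n\<^esub> A = B" by (rule GL.inv_equality) (use A B assms(4) in simp_all)
qed

text \<open>The identity plus the product of the column \<open>u\<close> and the row
  \<open>f\<close>; a transvection, or the identity, when the sum of \<open>f k * u k\<close> is
  0.\<close>

definition tv :: "nat \<Rightarrow> (nat \<Rightarrow> 'a::division_ring) \<Rightarrow> (nat \<Rightarrow> 'a) \<Rightarrow> 'a mat" where
  "tv n u f = mat n n (\<lambda>(i, j). (if i = j then 1 else 0) + u i * f j)"

lemma tv_carrier [simp]: "tv n u f \<in> carrier_mat n n"
  by (simp add: tv_def)

lemma tv_index: "i < n \<Longrightarrow> j < n \<Longrightarrow> tv n u f $$ (i, j) = (if i = j then 1 else 0) + u i * f j"
  by (simp add: tv_def)

lemma mat_mult_index: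
  "A \<in> carrier_mat n n \<Longrightarrow> B \<in> carrier_mat n n \<Longrightarrow> i < n \<Longrightarrow> j < n \<Longrightarrow>
    (A * B) $$ (i, j) = (\<Sum>k<n. A $$ (i, k) * (B :: 'a::semiring_0 mat) $$ (k, j))"
  by (auto simp: scalar_prod_def lessThan_atLeast0 intro!: sum.cong)

lemma tv_mult_left:
  assumes A: "A \<in> carrier_mat n n" and ij: "i < n" "j < n"
  shows "(tv n u f * A) $$ (i, j) = A $$ (i, j) + u i * (\<Sum>k<n. f k * A $$ (k, j))"
proof -
  have "(tv n u f * A) $$ (i, j) = (\<Sum>k<n. ((if i = k then 1 else 0) + u i * f k) * A $$ (k, j))"
    unfolding mat_mult_index[OF tv_carrier A ij] using ij by (intro sum.cong) (auto simp: tv_index)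
  also have "\<dots> = (\<Sum>k<n. (if i = k then A $$ (k, j) else 0) + u i * (f k * A $$ (k, j)))"
    by (intro sum.cong) (auto simp: distrib_right mult.assoc)
  also have "\<dots> = A $$ (i, j) + u i * (\<Sum>k<n. f k * A $$ (k, j))"
    using ij by (simp add: sum.distrib sum_distrib_left)
  finally show ?thesis .
qed

lemma tv_mult_right:
  assumes A: "A \<in> carrier_mat n n" and ij: "i < n" "j < n"
  shows "(A * tv n u f) $$ (i, j) = A $$ (i, j) + (\<Sum>k<n. A $$ (i, k) * u k) * f j"
proof -
  have "(A * tv n u f) $$ (i, j) = (\<Sum>k<n. A $$ (i, k) * ((if k = j then 1 else 0) + u k * f j))"
    unfolding mat_mult_index[OF A tv_carrier ij] using ij by (intro sum.cong) (auto simp: tv_index)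
  also have "\<dots> = (\<Sum>k<n. (if k = j then A $$ (i, k) else 0) + (A $$ (i, k) * u k) * f j)"
    by (intro sum.cong) (auto simp: distrib_left mult.assoc)
  also have "\<dots> = A $$ (i, j) + (\<Sum>k<n. A $$ (i, k) * u k) * f j"
    using ij by (simp add: sum.distrib sum_distrib_right)
  finally show ?thesis .
qed

lemma tv_tv_same_row:
  assumes "(\<Sum>k<n. f k * v k) = 0"
  shows "tv n u f * tv n v f = tv n (\<lambda>i. u i + v i) f"
proof (rule eq_matI)
  fix i j assume "i < dim_row (tv n (\<lambda>i. u i + v i) f)" "j < dim_col (tv n (\<lambda>i. u i + v i) f)"
  then have ij: "i < n" "j < n" by (simp_all add: tv_def)
  have "(\<Sum>k<n. f k * tv n v f $$ (k, j)) = (\<Sum>k<n. (if k = j then f k else 0) + (f k * v k) * f j)"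
    using ij by (intro sum.cong) (auto simp: tv_index distrib_left mult.assoc)
  also have "\<dots> = f j" using assms ij by (simp add: sum.distrib sum_distrib_right[symmetric])
  finally show "(tv n u f * tv n v f) $$ (i, j) = tv n (\<lambda>i. u i + v i) f $$ (i, j)"
    using ij by (simp add: tv_mult_left tv_index distrib_right add_ac)
qed (simp_all add: tv_def)

lemma tv_tv_same_col:
  assumes "(\<Sum>k<n. f k * u k) = 0"
  shows "tv n u f * tv n u g = tv n u (\<lambda>j. f j + g j)"
proof (rule eq_matI)
  fix i j assume "i < dim_row (tv n u (\<lambda>j. f j + g j))" "j < dim_col (tv n u (\<lambda>j. f j + g j))"
  then have ij: "i < n" "j < n" by (simp_all add: tv_def)
  have "(\<Sum>k<n. f k * tv n u g $$ (k, j)) = (\<Sum>k<n. (if k = j then f k else 0) + (f k * u k) * g j)"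
    using ij by (intro sum.cong) (auto simp: tv_index distrib_left mult.assoc)
  also have "\<dots> = f j" using assms ij by (simp add: sum.distrib sum_distrib_right[symmetric])
  finally show "(tv n u f * tv n u g) $$ (i, j) = tv n u (\<lambda>j. f j + g j) $$ (i, j)"
    using ij by (simp add: tv_mult_left tv_index distrib_left add_ac)
qed (simp_all add: tv_def)

lemma tv_zero: "tv n (\<lambda>_. 0) f = 1\<^sub>m n" "tv n u (\<lambda>_. 0) = 1\<^sub>m n"
  by (auto simp: tv_def intro!: eq_matI)

lemma tv_GL:
  assumes "(\<Sum>k<n. f k * u k) = 0"
  shows "tv n u f \<in> carrier (GL n)" "inv\<^bsub>GL n\<^esub> (tv n u f) = tv n (\<lambda>i. - u i) f"
proof -
  have "(\<Sum>k<n. f k * - u k) = 0" using assms by (simp add: sum_negf)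
  then have "tv n u f * tv n (\<lambda>i. - u i) f = 1\<^sub>m n" "tv n (\<lambda>i. - u i) f * tv n u f = 1\<^sub>m n"
    using assms by (simp_all add: tv_tv_same_row tv_zero)
  from GL_inv_eqI[OF tv_carrier tv_carrier this]
  show "tv n u f \<in> carrier (GL n)" "inv\<^bsub>GL n\<^esub> (tv n u f) = tv n (\<lambda>i. - u i) f" by auto
qed

definition single :: "nat \<Rightarrow> 'a::division_ring \<Rightarrow> nat \<Rightarrow> 'a" where
  "single i c k = (if k = i then c else 0)"

lemma sum_single [simp]:
  "i < n \<Longrightarrow> (\<Sum>k<n. single i c k * g k) = c * g i" "i < n \<Longrightarrow> (\<Sum>k<n. g k * single i c k) = g i * c"
proof -
  have "single i c k * g k = (if k = i then c * g k else 0)" "g k * single i c k = (if k = i then g k * c else 0)" for k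
    by (simp_all add: single_def)
  then show "i < n \<Longrightarrow> (\<Sum>k<n. single i c k * g k) = c * g i" "i < n \<Longrightarrow> (\<Sum>k<n. g k * single i c k) = g i * c"
    by simp_all
qed

lemma single_same [simp]: "single i c i = c" and single_other [simp]: "k \<noteq> i \<Longrightarrow> single i c k = 0"
  and single_uminus [simp]: "(\<lambda>k. - single i c k) = single i (- c)"
  by (auto simp: single_def)

text \<open>The elementary matrix with entry \<open>c\<close> at \<open>(i, j)\<close>, presented as
  a \<open>tv\<close> so that it shares the product formulas.\<close>

definition el :: "nat \<Rightarrow> nat \<Rightarrow> nat \<Rightarrow> 'a::division_ring \<Rightarrow> 'a mat" where
  "el n i j c = tv n (single i c) (single j 1)"

lemma el_carrier [simp]: "el n i j c \<in> carrier_mat n n"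
  by (simp add: el_def)

lemma el_GL:
  assumes "i < n" "j < n" "i \<noteq> j"
  shows "el n i j c \<in> carrier (GL n)" "inv\<^bsub>GL n\<^esub> (el n i j c) = el n i j (- c)"
  using tv_GL[of "single j 1" "single i c" n] assms by (simp_all add: el_def)

lemma el_mult_left:
  "A \<in> carrier_mat n n \<Longrightarrow> i < n \<Longrightarrow> j < n \<Longrightarrow> k < n \<Longrightarrow> l < n \<Longrightarrow>
    (el n k l c * A) $$ (i, j) = A $$ (i, j) + (if i = k then c * A $$ (l, j) else 0)"
  unfolding el_def by (simp add: tv_mult_left)

lemma el_mult_right:
  "A \<in> carrier_mat n n \<Longrightarrow> i < n \<Longrightarrow> j < n \<Longrightarrow> k < n \<Longrightarrow> l < n \<Longrightarrow>
    (A * el n k l c) $$ (i, j) = A $$ (i, j) + (if j = l then A $$ (i, k) * c else 0)"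
  unfolding el_def by (simp add: tv_mult_right)

lemma commutes_el_index:
  assumes A: "A \<in> carrier (GL n)"
    and el: "\<And>i j c. i < n \<Longrightarrow> j < n \<Longrightarrow> i \<noteq> j \<Longrightarrow> el n i j c * A = A * el n i j c"
    and ij: "i < n" "j < n" "i \<noteq> j"
  shows "A $$ (i, j) = 0" "A $$ (j, j) * c = c * (A :: 'a::division_ring mat) $$ (i, i)"
proof -
  have Am: "A \<in> carrier_mat n n" using GL_carrier_mat[OF A] .
  have e: "(el n k l c * A) $$ (p, q) = (A * el n k l c) $$ (p, q)" if "k < n" "l < n" "k \<noteq> l" for k l c p q
    using el[OF that] by simp
  show "A $$ (i, j) = 0"
    using e[OF ij(2,1), of 1 j j] ij by (simp add: el_mult_left[OF Am] el_mult_right[OF Am])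
  have "c * A $$ (j, j) = A $$ (i, i) * c" for c
    using e[OF ij, of c i j] ij by (simp add: el_mult_left[OF Am] el_mult_right[OF Am])
  from this[of 1] this[of c] show "A $$ (j, j) * c = c * A $$ (i, i)" by simp
qed

lemma scalar_mat_central:
  assumes l: "\<And>x::'a::division_ring. l * x = x * l" and l0: "l \<noteq> 0"
  shows "l \<cdot>\<^sub>m 1\<^sub>m n \<in> center (GL n)"
proof -
  have e: "(l \<cdot>\<^sub>m 1\<^sub>m n) * B = l \<cdot>\<^sub>m B" "B * (l \<cdot>\<^sub>m 1\<^sub>m n) = l \<cdot>\<^sub>m B" 
    if B: "B \<in> carrier_mat n n" and l: "\<And>x. l * x = x * l" for B and l :: 'a
  proof -
    have 1: "l \<cdot>\<^sub>m 1\<^sub>m n \<in> carrier_mat n n" by simp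
    show "(l \<cdot>\<^sub>m 1\<^sub>m n) * B = l \<cdot>\<^sub>m B"
    proof (rule eq_matI)
      fix i j assume "i < dim_row (l \<cdot>\<^sub>m B)" "j < dim_col (l \<cdot>\<^sub>m B)"
      then have ij: "i < n" "j < n" using B by auto
      have "((l \<cdot>\<^sub>m 1\<^sub>m n) * B) $$ (i, j) = (\<Sum>k<n. single i l k * B $$ (k, j))"
        unfolding mat_mult_index[OF 1 B ij] using ij by (intro sum.cong) (auto simp: single_def)
      then show "((l \<cdot>\<^sub>m 1\<^sub>m n) * B) $$ (i, j) = (l \<cdot>\<^sub>m B) $$ (i, j)" using ij B by simp
    qed (use B in auto)
    show "B * (l \<cdot>\<^sub>m 1\<^sub>m n) = l \<cdot>\<^sub>m B"
    proof (rule eq_matI)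
      fix i j assume "i < dim_row (l \<cdot>\<^sub>m B)" "j < dim_col (l \<cdot>\<^sub>m B)"
      then have ij: "i < n" "j < n" using B by auto
      have "(B * (l \<cdot>\<^sub>m 1\<^sub>m n)) $$ (i, j) = (\<Sum>k<n. B $$ (i, k) * single j l k)"
        unfolding mat_mult_index[OF B 1 ij] using ij by (intro sum.cong) (auto simp: single_def)
      then show "(B * (l \<cdot>\<^sub>m 1\<^sub>m n)) $$ (i, j) = (l \<cdot>\<^sub>m B) $$ (i, j)" using ij B l[of "B $$ (i, j)"] by simp
    qed (use B in auto)
  qed
  have li: "inverse l * x = x * inverse l" for x using l by (rule mult_commute_imp_mult_inverse_commute)
  have "(l \<cdot>\<^sub>m 1\<^sub>m n) * (inverse l \<cdot>\<^sub>m 1\<^sub>m n) = 1\<^sub>m n" "(inverse l \<cdot>\<^sub>m 1\<^sub>m n) * (l \<cdot>\<^sub>m 1\<^sub>m n) = 1\<^sub>m n"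
    using l0 by (auto simp: e(1)[OF _ l] e(1)[OF _ li] intro!: eq_matI)
  then have "l \<cdot>\<^sub>m 1\<^sub>m n \<in> carrier (GL n)" unfolding carrier_GL by (auto intro!: bexI[of _ "inverse l \<cdot>\<^sub>m 1\<^sub>m n"])
  then show ?thesis
    unfolding center_def using e[OF GL_carrier_mat l] by simp
qed

text \<open>Commuting with elementary matrices kills the off-diagonal entries and makes the diagonal
  constant and central. For \<open>n = 1\<close> there are no elementary matrices, hence the
  hypothesis \<open>one\<close>. As the elementary matrices lie in \<open>SL n\<close>, this serves
  for the centres of both \<open>GL n\<close> and \<open>SL n\<close>.\<close>

lemma commutes_el_scalar:
  assumes n: "n > 0" and A: "A \<in> carrier (GL n)"
    and el: "\<And>i j c. i < n \<Longrightarrow> j < n \<Longrightarrow> i \<noteq> j \<Longrightarrow> el n i j c * A = A * (el n i j c :: 'a::division_ring mat)"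
    and one: "n = 1 \<Longrightarrow> \<forall>c. A $$ (0, 0) * c = c * A $$ (0, 0)"
  shows "A = A $$ (0, 0) \<cdot>\<^sub>m 1\<^sub>m n" "A $$ (0, 0) \<in> center mult_group"
proof -
  have Am: "A \<in> carrier_mat n n" using GL_carrier_mat[OF A] .
  have c1: "A $$ (i, j) = 0" if "i < n" "j < n" "i \<noteq> j" for i j
    by (rule commutes_el_index(1)[OF A _ that]) (rule el)
  have c2: "A $$ (j, j) * x = x * A $$ (i, i)" if "i < n" "j < n" "i \<noteq> j" for i j x
    by (rule commutes_el_index(2)[OF A _ that]) (rule el)
  have d: "A $$ (j, j) = A $$ (0, 0)" if "j < n" for j
    using c2[of 0 j 1] that n by (cases "j = 0") auto
  show e: "A = A $$ (0, 0) \<cdot>\<^sub>m 1\<^sub>m n"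
  proof (rule eq_matI)
    fix i j assume "i < dim_row (A $$ (0, 0) \<cdot>\<^sub>m 1\<^sub>m n)" "j < dim_col (A $$ (0, 0) \<cdot>\<^sub>m 1\<^sub>m n)"
    then have ij: "i < n" "j < n" by auto
    show "A $$ (i, j) = (A $$ (0, 0) \<cdot>\<^sub>m 1\<^sub>m n) $$ (i, j)"
    proof (cases "i = j")
      case True
      then show ?thesis using d[OF ij(2)] ij by simp
    qed (use ij c1[OF ij] in simp)
  qed (use Am in auto)
  have cc: "A $$ (0, 0) * x = x * A $$ (0, 0)" for x
  proof (cases "n = 1")
    case False
    then show ?thesis using c2[of 0 1 x] d[of 1] n by simp
  qed (use one in blast)
  obtain B where B: "B \<in> carrier_mat n n" "A * B = 1\<^sub>m n" using A unfolding carrier_GL by blast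
  have "A $$ (0, 0) \<noteq> 0"
  proof
    assume 0: "A $$ (0, 0) = 0"
    have "A = 0 \<cdot>\<^sub>m 1\<^sub>m n" using e unfolding 0 .
    also have "\<dots> = 0\<^sub>m n n" by (rule eq_matI) auto
    finally have "A = 0\<^sub>m n n" .
    then have "A * B = 0\<^sub>m n n" using B(1) by simp
    then have "(1\<^sub>m n :: 'a mat) $$ (0, 0) = 0\<^sub>m n n $$ (0, 0)" using B(2) by simp
    then show False using n by simp
  qed
  then show "A $$ (0, 0) \<in> center mult_group" unfolding center_mult_group using cc by blast
qed

section \<open>Subgroups normalized by the elementary matrices\<close>

text \<open>The group-theoretic half of Iwasawa's criterion: modulo the normalized subgroup
  \<open>M\<close>, the product \<open>W\<close> of \<open>M\<close> and \<open>B\<close> is an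
  image of the commutative \<open>B\<close>, so its commutators fall into \<open>M\<close>.\<close>

lemma (in group) conj_quotient_abelian:
  assumes M: "subgroup M G" and P: "subgroup P G" and nor: "normalizes G P M"
    and B: "B \<subseteq> P" "\<And>s t. s \<in> B \<Longrightarrow> t \<in> B \<Longrightarrow> s \<otimes> t \<in> B \<and> s \<otimes> t = t \<otimes> s"
  defines "W \<equiv> {m \<otimes> t | m t. m \<in> M \<and> t \<in> B}"
  shows "\<And>x y. x \<in> W \<Longrightarrow> y \<in> W \<Longrightarrow> x \<otimes> y \<in> W"
    "\<And>x y. x \<in> W \<Longrightarrow> y \<in> W \<Longrightarrow> x \<otimes> y \<otimes> inv x \<otimes> inv y \<in> M"
proof -
  have Mc: "x \<in> M \<Longrightarrow> x \<in> carrier G" for x using M subgroup.mem_carrier by metis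
  have Bc: "x \<in> B \<Longrightarrow> x \<in> carrier G" for x using P B(1) subgroup.mem_carrier by (metis subsetD)
  have pr: "\<exists>k \<in> M. (m \<otimes> s) \<otimes> (m' \<otimes> t) = k \<otimes> (s \<otimes> t)" if "m \<in> M" "s \<in> B" "m' \<in> M" "t \<in> B" for m s m' t
  proof (intro bexI)
    have c: "m \<in> carrier G" "s \<in> carrier G" "m' \<in> carrier G" "t \<in> carrier G" using that Mc Bc by auto
    show "(m \<otimes> s) \<otimes> (m' \<otimes> t) = (m \<otimes> (s \<otimes> m' \<otimes> inv s)) \<otimes> (s \<otimes> t)"
      using c by (simp add: m_assoc inv_cancel_left)
    have "s \<in> P" using that(2) B(1) by blast
    then show "m \<otimes> (s \<otimes> m' \<otimes> inv s) \<in> M"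
      using subgroup.m_closed[OF M that(1) normalizesD[OF nor _ that(3)]] by simp
  qed
  have WE: "\<exists>m t. m \<in> M \<and> t \<in> B \<and> x = m \<otimes> t" if "x \<in> W" for x using that unfolding W_def by blast
  show "x \<otimes> y \<in> W" if xy: "x \<in> W" "y \<in> W" for x y
  proof -
    obtain m s where 1: "m \<in> M" "s \<in> B" "x = m \<otimes> s" using WE[OF xy(1)] by (elim exE conjE) (rule that)
    obtain m' t where 2: "m' \<in> M" "t \<in> B" "y = m' \<otimes> t" using WE[OF xy(2)] by (elim exE conjE) (rule that)
    obtain k where "k \<in> M" "x \<otimes> y = k \<otimes> (s \<otimes> t)" using pr[OF 1(1,2) 2(1,2)] 1(3) 2(3) by blast
    then show ?thesis unfolding W_def using B(2)[OF 1(2) 2(2)] by blast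
  qed
  show "x \<otimes> y \<otimes> inv x \<otimes> inv y \<in> M" if xy: "x \<in> W" "y \<in> W" for x y
  proof -
    obtain m s where 1: "m \<in> M" "s \<in> B" "x = m \<otimes> s" using WE[OF xy(1)] by (elim exE conjE) (rule that)
    obtain m' t where 2: "m' \<in> M" "t \<in> B" "y = m' \<otimes> t" using WE[OF xy(2)] by (elim exE conjE) (rule that)
    obtain k where k: "k \<in> M" "x \<otimes> y = k \<otimes> (s \<otimes> t)" using pr[OF 1(1,2) 2(1,2)] 1(3) 2(3) by blast
    obtain l where l: "l \<in> M" "y \<otimes> x = l \<otimes> (t \<otimes> s)" using pr[OF 2(1,2) 1(1,2)] 1(3) 2(3) by blast
    have c: "x \<in> carrier G" "y \<in> carrier G" "k \<in> carrier G" "l \<in> carrier G" "s \<otimes> t \<in> carrier G"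
      using 1 2 k(1) l(1) Mc Bc by auto
    have "x \<otimes> y = k \<otimes> (inv l \<otimes> (y \<otimes> x))"
      using k(2) l(2) B(2)[OF 1(2) 2(2)] c by (simp add: inv_cancel_left)
    then have "x \<otimes> y \<otimes> inv x \<otimes> inv y = k \<otimes> inv l"
      using c by (simp add: m_assoc)
    then show ?thesis using subgroup.m_closed[OF M k(1) subgroup.m_inv_closed[OF M l(1)]] by simp
  qed
qed

lemma scalar_GL_nonzero:
  assumes "(l :: 'a::division_ring) \<cdot>\<^sub>m 1\<^sub>m n \<in> carrier (GL n)" "n > 0"
  shows "l \<noteq> 0"
proof
  assume 0: "l = 0"
  obtain B where B: "B \<in> carrier_mat n n" "(l \<cdot>\<^sub>m 1\<^sub>m n) * B = 1\<^sub>m n" using assms(1) unfolding carrier_GL by blast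
  have "l \<cdot>\<^sub>m 1\<^sub>m n = 0\<^sub>m n n" unfolding 0 by (rule eq_matI) auto
  then have "0\<^sub>m n n = (1\<^sub>m n :: 'a mat)" using B by simp
  then have "(1\<^sub>m n :: 'a mat) $$ (0, 0) = 0\<^sub>m n n $$ (0, 0)" by simp
  then show False using assms(2) by simp
qed

lemma tv_cong:
  assumes "\<And>i j. i < n \<Longrightarrow> j < n \<Longrightarrow> u i * f j = v i * g j"
  shows "tv n u f = tv n v g"
  using assms by (auto simp: tv_def intro!: eq_matI)

locale elementary_normalized =
  fixes n :: nat and M P :: "'a::division_ring mat set"
  assumes n2: "n \<ge> 2" and M: "subgroup M (GL n)" and P: "subgroup P (GL n)"
    and el_P: "\<And>i j c. i < n \<Longrightarrow> j < n \<Longrightarrow> i \<noteq> j \<Longrightarrow> el n i j c \<in> P"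
    and nor: "normalizes (GL n) P M"
begin

lemma M_carrier_mat: "x \<in> M \<Longrightarrow> x \<in> carrier_mat n n"
  using subgroup.mem_carrier[OF M] GL_carrier_mat by blast

lemma conj_el:
  assumes "i < n" "j < n" "i \<noteq> j" "m \<in> M"
  shows "el n i j c * m * el n i j (- c) \<in> M"
  using normalizesD[OF nor el_P[OF assms(1-3)] assms(4), of c] el_GL(2)[OF assms(1-3), of c] by simp

lemma conj_el':
  assumes "i < n" "j < n" "i \<noteq> j" "m \<in> M"
  shows "el n i j (- c) * m * el n i j c \<in> M"
  using conj_el[OF assms, of "- c"] by simp

text \<open>With the row vector fixed, elementary matrices multiply by adding their column vectors,
  so \<open>u\<close> can be built up one entry at a time.\<close>

lemma tv_row_P:
  assumes i: "i < n" and u: "u i = 0"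
  shows "tv n u (single i 1) \<in> P"
proof -
  have "tv n (\<lambda>k. if k < m then u k else 0) (single i 1) \<in> P" if "m \<le> n" for m
    using that
  proof (induction m)
    case 0
    then show ?case using subgroup.one_closed[OF P] by (simp add: tv_zero)
  next
    case (Suc m)
    show ?case
    proof (cases "m = i")
      case True
      then have "(\<lambda>k. if k < Suc m then u k else 0) = (\<lambda>k. if k < m then u k else 0)"
        using u by (auto simp: less_Suc_eq)
      then show ?thesis using Suc by simp
    next
      case False
      have "(\<Sum>k<n. single i 1 k * single m (u m) k) = 0" using i False by simp
      from tv_tv_same_row[OF this, of "\<lambda>k. if k < m then u k else 0"]
      have "tv n (\<lambda>k. if k < m then u k else 0) (single i 1) * el n m i (u m)
          = tv n (\<lambda>k. (if k < m then u k else 0) + single m (u m) k) (single i 1)"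
        unfolding el_def .
      also have "(\<lambda>k. (if k < m then u k else 0) + single m (u m) k) = (\<lambda>k. if k < Suc m then u k else 0)"
        by (auto simp: single_def less_Suc_eq)
      finally show ?thesis
        using subgroup.m_closed[OF P Suc.IH el_P[of m i "u m"]] Suc.prems i False by simp
    qed
  qed
  from this[OF order_refl] show ?thesis
    using tv_cong[of n "\<lambda>k. if k < n then u k else 0" "single i 1" u "single i 1"] by simp
qed

lemma tv_col_P:
  assumes i: "i < n" and f: "f i = 0"
  shows "tv n (single i 1) f \<in> P"
proof -
  have "tv n (single i 1) (\<lambda>k. if k < m then f k else 0) \<in> P" if "m \<le> n" for m
    using that
  proof (induction m)
    case 0
    then show ?case using subgroup.one_closed[OF P] by (simp add: tv_zero)
  next
    case (Suc m)
    show ?case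
    proof (cases "m = i")
      case True
      then have "(\<lambda>k. if k < Suc m then f k else 0) = (\<lambda>k. if k < m then f k else 0)"
        using f by (auto simp: less_Suc_eq)
      then show ?thesis using Suc by simp
    next
      case False
      have e: "el n i m (f m) = tv n (single i 1) (single m (f m))"
        unfolding el_def by (rule tv_cong) (auto simp: single_def)
      have "(\<Sum>k<n. (if k < m then f k else 0) * single i 1 k) = 0" using i f by simp
      from tv_tv_same_col[OF this, of "single m (f m)"]
      have "tv n (single i 1) (\<lambda>k. if k < m then f k else 0) * el n i m (f m)
          = tv n (single i 1) (\<lambda>k. (if k < m then f k else 0) + single m (f m) k)"
        unfolding e .
      also have "(\<lambda>k. (if k < m then f k else 0) + single m (f m) k) = (\<lambda>k. if k < Suc m then f k else 0)"
        by (auto simp: single_def less_Suc_eq)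
      finally show ?thesis
        using subgroup.m_closed[OF P Suc.IH el_P[of i m "f m"]] Suc.prems i False by simp
    qed
  qed
  from this[OF order_refl] show ?thesis
    using tv_cong[of n "single i 1" "\<lambda>k. if k < n then f k else 0" "single i 1" f] by simp
qed

text \<open>Otherwise every element of \<open>M\<close> stabilizes the line of the first basis
  vector. So do the conjugates by elementary matrices, which lie in \<open>M\<close> again, and
  comparing first columns turns every element of \<open>M\<close> into a central scalar
  matrix.\<close>

lemma ex_moving:
  assumes nc: "\<not> M \<subseteq> center (GL n)"
  shows "\<exists>m \<in> M. \<exists>k. 0 < k \<and> k < n \<and> m $$ (k, 0) \<noteq> 0"
proof (rule ccontr)
  assume "\<not> ?thesis"
  then have H: "m $$ (k, 0) = 0" if "m \<in> M" "0 < k" "k < n" for m k using that by blast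
  have n0: "0 < n" using n2 by simp
  \<comment> \<open>The conjugation adds column \<open>j\<close> to column 0 and changes row
    \<open>j\<close> only besides, so the vanishing of column 0 passes to the entry
    \<open>(i, j)\<close>.\<close>
  have off: "m $$ (i, j) = 0" if m: "m \<in> M" and ij: "0 < i" "i < n" "0 < j" "j < n" "i \<noteq> j" for m i j
  proof -
    have "el n j 0 (- 1) * m * el n j 0 1 \<in> M" by (rule conj_el') (use m ij n0 in auto)
    from H[OF this ij(1,2)] H[OF m ij(1,2)] show ?thesis
      using ij n0 M_carrier_mat[OF m] by (simp add: el_mult_right el_mult_left mult_carrier_mat[of _ n n])
  qed
  have R: "m $$ (j, j) * c = c * m $$ (0, 0) + c * (m $$ (0, j) * c)"
    if m: "m \<in> M" and j: "0 < j" "j < n" for m j c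
  proof -
    have "el n j 0 (- c) * m * el n j 0 c \<in> M" by (rule conj_el') (use m j n0 in auto)
    from H[OF this j] H[OF m j] show ?thesis
      using j n0 M_carrier_mat[OF m] by (simp add: el_mult_right el_mult_left mult_carrier_mat[of _ n n] algebra_simps)
  qed
  \<comment> \<open>By \<open>R\<close> the entry \<open>(0, j)\<close> is the difference of the
    diagonal entries at \<open>j\<close> and 0, for \<open>m\<close> and for its conjugate
    \<open>m1\<close>. The two have the same diagonal entries there, yet conjugation adds this
    difference to the entry \<open>(0, j)\<close>; so it is 0.\<close>
  have top: "m $$ (0, j) = 0" if m: "m \<in> M" and j: "0 < j" "j < n" for m j
  proof -
    define m1 where "m1 = el n 0 j 1 * m * el n 0 j (- 1)"
    have m1: "m1 \<in> M" unfolding m1_def by (rule conj_el) (use m j n0 in auto)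
    have 1: "m $$ (j, j) = m $$ (0, 0) + m $$ (0, j)" using R[OF m j, of 1] by simp
    have "m1 $$ (0, 0) = m $$ (0, 0)" "m1 $$ (j, j) = m $$ (j, j)"
      "m1 $$ (0, j) = m $$ (0, j) + m $$ (j, j) - m $$ (0, 0)"
      unfolding m1_def using j n0 M_carrier_mat[OF m] H[OF m j]
      by (simp_all add: el_mult_right el_mult_left mult_carrier_mat[of _ n n])
    then have "m $$ (j, j) = m $$ (0, 0) + (m $$ (0, j) + m $$ (j, j) - m $$ (0, 0))" using R[OF m1 j, of 1] by simp
    then show ?thesis by simp
  qed
  have "m \<in> center (GL n)" if m: "m \<in> M" for m
  proof -
    define l where "l = m $$ (0, 0)"
    have d: "m $$ (j, j) = l" if "j < n" for j
      using R[OF m _ that, of 1] top[OF m _ that] unfolding l_def by (cases "j = 0") auto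
    have z: "m $$ (i, j) = 0" if "i < n" "j < n" "i \<noteq> j" for i j
      using off[OF m] top[OF m] H[OF m] that by (cases "i = 0"; cases "j = 0") auto
    have e: "m = l \<cdot>\<^sub>m 1\<^sub>m n" using M_carrier_mat[OF m] d z by (intro eq_matI) auto
    have lc: "l * c = c * l" for c
      using R[OF m, of 1 c] top[OF m, of 1] d[of 1] n2 unfolding l_def[symmetric] by simp
    have "l \<noteq> 0" using scalar_GL_nonzero[of l n] e subgroup.mem_carrier[OF M m] n0 by simp
    then show ?thesis unfolding e using scalar_mat_central[OF lc] by simp
  qed
  then show False using nc by blast
qed

text \<open>An element of \<open>M\<close> that moves the line of the first basis vector to the
  \<open>i\<close>-th coordinate line, replacing the transitivity assumption of Iwasawa's criterion.
  One conjugation makes the entry \<open>(i, 0)\<close> nonzero, another clears the rest of column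
  0.\<close>

lemma ex_column:
  assumes nc: "\<not> M \<subseteq> center (GL n)" and i: "0 < i" "i < n"
  shows "\<exists>w \<in> M. \<forall>j < n. j \<noteq> i \<longrightarrow> w $$ (j, 0) = 0"
proof -
  have n0: "0 < n" using n2 by simp
  obtain m k where m: "m \<in> M" "0 < k" "k < n" "m $$ (k, 0) \<noteq> 0" using ex_moving[OF nc] by blast
  have "\<exists>m1 \<in> M. m1 $$ (i, 0) \<noteq> 0"
  proof (cases "m $$ (i, 0) = 0")
    case True
    then have ik: "i \<noteq> k" using m by auto
    have "el n i k 1 * m * el n i k (- 1) \<in> M" using conj_el[OF i(2) m(3) ik m(1)] .
    moreover have "(el n i k 1 * m * el n i k (- 1)) $$ (i, 0) \<noteq> 0"
      using True m i n0 M_carrier_mat[OF m(1)] by (simp add: el_mult_right el_mult_left mult_carrier_mat[of _ n n])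
    ultimately show ?thesis by blast
  qed (use m in blast)
  then obtain m1 where m1: "m1 \<in> M" "m1 $$ (i, 0) \<noteq> 0" by blast
  \<comment> \<open>The multipliers with which row \<open>i\<close> clears the other entries of
    column 0. The inverse of \<open>h\<close>, multiplied on the right, changes only column
    \<open>i\<close>, and \<open>i \<noteq> 0\<close>, so column 0 stays cleared.\<close>
  define u where "u j = (if j = i then 0 else - (m1 $$ (j, 0) * inverse (m1 $$ (i, 0))))" for j
  define h where "h = tv n u (single i 1)"
  have ui: "u i = 0" unfolding u_def by simp
  have hP: "h \<in> P" unfolding h_def by (rule tv_row_P[of i u, OF i(2) ui])
  have "(\<Sum>k<n. single i 1 k * u k) = 0" using i ui by simp
  then have hi: "inv\<^bsub>GL n\<^esub> h = tv n (\<lambda>j. - u j) (single i 1)" unfolding h_def by (rule tv_GL(2))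
  define w where "w = h * m1 * tv n (\<lambda>j. - u j) (single i 1)"
  have wM: "w \<in> M" unfolding w_def using normalizesD[OF nor hP m1(1)] hi by simp
  have hm: "h * m1 \<in> carrier_mat n n" using M_carrier_mat[OF m1(1)] unfolding h_def by (simp add: mult_carrier_mat[of _ n n])
  have "w $$ (j, 0) = 0" if "j < n" "j \<noteq> i" for j
  proof -
    have "w $$ (j, 0) = (h * m1) $$ (j, 0)"
      unfolding w_def using tv_mult_right[OF hm that(1) n0] i by simp
    also have "\<dots> = m1 $$ (j, 0) + u j * m1 $$ (i, 0)"
      unfolding h_def using tv_mult_left[OF M_carrier_mat[OF m1(1)] that(1) n0] i by simp
    also have "\<dots> = 0" unfolding u_def using that m1(2) by (simp add: mult.assoc)
    finally show ?thesis .
  qed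
  then show ?thesis using wM by blast
qed

text \<open>The transvections along the first basis vector, together with the identity: the abelian
  normal subgroup of the stabilizer of a line that Iwasawa's criterion asks for.\<close>

definition B where "B = {tv n (single 0 1) f | f. f 0 = 0}"

definition W where "W = {m \<otimes>\<^bsub>GL n\<^esub> t | m t. m \<in> M \<and> t \<in> B}"

lemma B_P: "B \<subseteq> P"
  unfolding B_def using tv_col_P n2 by auto

lemma B_mult: "s \<in> B \<Longrightarrow> t \<in> B \<Longrightarrow> s * t \<in> B \<and> s * t = t * s"
proof -
  assume "s \<in> B" "t \<in> B"
  then obtain f g where fg: "s = tv n (single 0 1) f" "t = tv n (single 0 1) g" "f 0 = 0" "g 0 = 0"
    unfolding B_def by blast
  have n0: "0 < n" using n2 by simp
  have z: "(\<Sum>k<n. f k * single 0 1 k) = 0" "(\<Sum>k<n. g k * single 0 1 k) = 0" using fg n0 by simp_all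
  have st: "s * t = tv n (single 0 1) (\<lambda>j. f j + g j)" unfolding fg using tv_tv_same_col[OF z(1)] .
  have ts: "t * s = tv n (single 0 1) (\<lambda>j. g j + f j)" unfolding fg using tv_tv_same_col[OF z(2)] .
  have "s * t \<in> B" unfolding st B_def using fg(3,4) by (intro CollectI exI[of _ "\<lambda>j. f j + g j"]) simp
  then show ?thesis using st ts by (simp add: add.commute)
qed

text \<open>For \<open>i \<noteq> 0\<close> the element \<open>w\<close> of \<open>ex_column\<close>
  conjugates some \<open>t \<in> B\<close> to \<open>el n i j c\<close>. This conjugate is
  \<open>t\<close> preceded by the commutator of \<open>w\<close> and \<open>t\<close>, and the
  commutator lies in \<open>M\<close> because \<open>t\<close> normalizes \<open>M\<close>.\<close>

lemma el_W:
  assumes nc: "\<not> M \<subseteq> center (GL n)" and ij: "i < n" "j < n" "i \<noteq> j"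
  shows "el n i j c \<in> W"
proof (cases "i = 0")
  case True
  have e: "el n i j c = tv n (single 0 1) (single j c)"
    unfolding el_def True by (rule tv_cong) (auto simp: single_def)
  have "el n i j c \<in> B" unfolding B_def e using ij True by (intro CollectI exI[of _ "single j c"]) simp
  then have "\<one>\<^bsub>GL n\<^esub> \<otimes>\<^bsub>GL n\<^esub> el n i j c \<in> W"
    unfolding W_def using subgroup.one_closed[OF M] by blast
  then show ?thesis using left_mult_one_mat[OF el_carrier[of n i j c]] by simp
next
  case False
  have n0: "0 < n" using n2 by simp
  obtain w where w: "w \<in> M" "\<And>k. k < n \<Longrightarrow> k \<noteq> i \<Longrightarrow> w $$ (k, 0) = 0"
    using ex_column[OF nc, of i] False ij by auto
  define b where "b = w $$ (i, 0)"
  have wc: "w \<in> carrier (GL n)" using subgroup.mem_carrier[OF M w(1)] .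
  have b0: "b \<noteq> 0"
  proof
    assume b: "b = 0"
    obtain V where V: "V \<in> carrier_mat n n" "V * w = 1\<^sub>m n" using wc unfolding carrier_GL by blast
    have "(V * w) $$ (0, 0) = (\<Sum>k<n. V $$ (0, k) * w $$ (k, 0))"
      using mat_mult_index[OF V(1) M_carrier_mat[OF w(1)] n0 n0] .
    also have "\<dots> = 0"
    proof (rule sum.neutral, intro ballI)
      fix k assume "k \<in> {..<n}"
      then have "w $$ (k, 0) = 0" using w(2)[of k] b unfolding b_def by (cases "k = i") auto
      then show "V $$ (0, k) * w $$ (k, 0) = 0" by simp
    qed
    finally show False using V(2) n0 by simp
  qed
  \<comment> \<open>Solves \<open>el n i j c * w = w * t\<close> in row \<open>i\<close>, the only
    row in which either side differs from \<open>w\<close>. It vanishes at 0 because column 0 of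
    \<open>w\<close> is concentrated in row \<open>i\<close>, so that
    \<open>t \<in> B\<close>.\<close>
  define f where "f l = inverse b * c * w $$ (j, l)" for l
  define t where "t = tv n (single 0 1) f"
  have f0: "f 0 = 0" unfolding f_def using w(2)[of j] ij by simp
  have tB: "t \<in> B" unfolding t_def B_def using f0 by blast
  have tP: "t \<in> P" using tB B_P by blast
  have tc: "t \<in> carrier (GL n)" using subgroup.mem_carrier[OF P tP] .
  have "el n i j c * w = w * t"
  proof (rule eq_matI)
    fix p q assume "p < dim_row (w * t)" "q < dim_col (w * t)"
    then have pq: "p < n" "q < n" using M_carrier_mat[OF w(1)] unfolding t_def by (auto simp: tv_def)
    have "(w * t) $$ (p, q) = w $$ (p, q) + w $$ (p, 0) * f q"
      unfolding t_def using tv_mult_right[OF M_carrier_mat[OF w(1)] pq] n0 by simp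
    also have "\<dots> = w $$ (p, q) + (if p = i then c * w $$ (j, q) else 0)"
    proof (cases "p = i")
      case True
      have "b * (inverse b * c * w $$ (j, q)) = c * w $$ (j, q)"
        using b0 by (simp add: mult.assoc[symmetric])
      then show ?thesis using True unfolding f_def b_def by simp
    qed (use w(2)[OF pq(1)] in simp)
    finally show "(el n i j c * w) $$ (p, q) = (w * t) $$ (p, q)"
      using el_mult_left[OF M_carrier_mat[OF w(1)] pq ij(1,2)] by simp
  qed (use M_carrier_mat[OF w(1)] in \<open>auto simp: t_def tv_def el_def\<close>)
  then have "el n i j c \<otimes>\<^bsub>GL n\<^esub> w = w \<otimes>\<^bsub>GL n\<^esub> t" by simp
  then have e: "el n i j c = w \<otimes>\<^bsub>GL n\<^esub> t \<otimes>\<^bsub>GL n\<^esub> inv\<^bsub>GL n\<^esub> w"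
    using wc tc el_GL(1)[OF ij, of c] by (metis GL.inv_solve_right GL.m_closed)
  have "t \<otimes>\<^bsub>GL n\<^esub> inv\<^bsub>GL n\<^esub> w \<otimes>\<^bsub>GL n\<^esub> inv\<^bsub>GL n\<^esub> t \<in> M"
    using normalizesD[OF nor tP subgroup.m_inv_closed[OF M w(1)]] .
  then have "w \<otimes>\<^bsub>GL n\<^esub> (t \<otimes>\<^bsub>GL n\<^esub> inv\<^bsub>GL n\<^esub> w \<otimes>\<^bsub>GL n\<^esub> inv\<^bsub>GL n\<^esub> t) \<in> M"
    using subgroup.m_closed[OF M w(1)] by blast
  moreover have "el n i j c = w \<otimes>\<^bsub>GL n\<^esub> (t \<otimes>\<^bsub>GL n\<^esub> inv\<^bsub>GL n\<^esub> w \<otimes>\<^bsub>GL n\<^esub> inv\<^bsub>GL n\<^esub> t) \<otimes>\<^bsub>GL n\<^esub> t"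
    unfolding e using wc tc by (simp add: GL.m_assoc del: GL_simps)
  ultimately show ?thesis unfolding W_def using tB by blast
qed

lemma W_mult:
  assumes "x \<in> W" "y \<in> W"
  shows "x * y \<in> W"
proof -
  have "x \<otimes>\<^bsub>GL n\<^esub> y \<in> W"
    unfolding W_def
  proof (rule GL.conj_quotient_abelian(1)[OF M P nor B_P])
    show "s \<otimes>\<^bsub>GL n\<^esub> t \<in> B \<and> s \<otimes>\<^bsub>GL n\<^esub> t = t \<otimes>\<^bsub>GL n\<^esub> s" if "s \<in> B" "t \<in> B" for s t
      using B_mult[OF that] unfolding GL_simps .
  qed (use assms in \<open>unfold W_def\<close>)
  then show ?thesis by simp
qed

lemma W_commutator:
  assumes "x \<in> W" "y \<in> W"
  shows "x * y * inv\<^bsub>GL n\<^esub> x * inv\<^bsub>GL n\<^esub> y \<in> M"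
proof -
  have "x \<otimes>\<^bsub>GL n\<^esub> y \<otimes>\<^bsub>GL n\<^esub> inv\<^bsub>GL n\<^esub> x \<otimes>\<^bsub>GL n\<^esub> inv\<^bsub>GL n\<^esub> y \<in> M"
  proof (rule GL.conj_quotient_abelian(2)[OF M P nor B_P])
    show "s \<otimes>\<^bsub>GL n\<^esub> t \<in> B \<and> s \<otimes>\<^bsub>GL n\<^esub> t = t \<otimes>\<^bsub>GL n\<^esub> s" if "s \<in> B" "t \<in> B" for s t
      using B_mult[OF that] unfolding GL_simps .
  qed (use assms in \<open>unfold W_def\<close>)
  then show ?thesis by simp
qed

end

section \<open>Calculations in the upper left two by two block\<close>

definition blk :: "nat \<Rightarrow> 'a \<Rightarrow> 'a \<Rightarrow> 'a \<Rightarrow> 'a \<Rightarrow> 'a::division_ring mat" where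
  "blk n a b c d = mat n n (\<lambda>(i, j).
     if i = 0 \<and> j = 0 then a else if i = 0 \<and> j = 1 then b else
     if i = 1 \<and> j = 0 then c else if i = 1 \<and> j = 1 then d else if i = j then 1 else 0)"

lemma blk_carrier [simp]: "blk n a b c d \<in> carrier_mat n n"
  by (simp add: blk_def)

lemma blk_mult:
  assumes n: "n \<ge> 2"
  shows "blk n a b c d * blk n a' b' c' d' =
    blk n (a * a' + b * c') (a * b' + b * d') (c * a' + d * c') (c * b' + d * d')"
proof (rule eq_matI)
  let ?R = "blk n (a * a' + b * c') (a * b' + b * d') (c * a' + d * c') (c * b' + d * d')"
  fix i j assume "i < dim_row ?R" "j < dim_col ?R"
  then have ij: "i < n" "j < n" by (simp_all add: blk_def)
  obtain m where m: "n = Suc (Suc m)" using le_Suc_ex[OF n] by auto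
  have "(blk n a b c d * blk n a' b' c' d') $$ (i, j) =
      (\<Sum>k<n. blk n a b c d $$ (i, k) * blk n a' b' c' d' $$ (k, j))"
    using mat_mult_index[OF blk_carrier blk_carrier ij] .
  also have "\<dots> = blk n a b c d $$ (i, 0) * blk n a' b' c' d' $$ (0, j) +
      (blk n a b c d $$ (i, 1) * blk n a' b' c' d' $$ (1, j) +
       (\<Sum>k<m. blk n a b c d $$ (i, Suc (Suc k)) * blk n a' b' c' d' $$ (Suc (Suc k), j)))"
    unfolding m by (simp only: sum.lessThan_Suc_shift One_nat_def)
  also have "(\<Sum>k<m. blk n a b c d $$ (i, Suc (Suc k)) * blk n a' b' c' d' $$ (Suc (Suc k), j)) =
      (\<Sum>k<m. if k = i - 2 then (if 2 \<le> i \<and> i = j then 1 else 0) else 0)"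
    using ij m by (intro sum.cong) (auto simp: blk_def)
  also have "\<dots> = (if 2 \<le> i \<and> i = j then 1 else 0)"
    using ij m by auto
  finally have e: "(blk n a b c d * blk n a' b' c' d') $$ (i, j) =
      blk n a b c d $$ (i, 0) * blk n a' b' c' d' $$ (0, j) +
      (blk n a b c d $$ (i, 1) * blk n a' b' c' d' $$ (1, j) + (if 2 \<le> i \<and> i = j then 1 else 0))" .
  consider "i = 0" | "i = 1" | "i \<ge> 2" by linarith
  then show "(blk n a b c d * blk n a' b' c' d') $$ (i, j) = ?R $$ (i, j)"
    unfolding e using ij m by cases (auto simp: blk_def)
qed (simp_all add: blk_def)

lemma blk_one: "n \<ge> 2 \<Longrightarrow> blk n 1 0 0 1 = 1\<^sub>m n"
  by (auto simp: blk_def intro!: eq_matI)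

lemma blk_el: "n \<ge> 2 \<Longrightarrow> el n 0 1 a = blk n 1 a 0 1" "n \<ge> 2 \<Longrightarrow> el n 1 0 a = blk n 1 0 a 1"
  by (auto simp: blk_def el_def tv_def single_def intro!: eq_matI)

lemma blk_index: "n \<ge> 2 \<Longrightarrow> blk n a b c d $$ (0, 0) = a" "n \<ge> 2 \<Longrightarrow> blk n a b c d $$ (0, 1) = b"
    "n \<ge> 2 \<Longrightarrow> blk n a b c d $$ (1, 0) = c" "n \<ge> 2 \<Longrightarrow> blk n a b c d $$ (1, 1) = d"
  by (auto simp: blk_def)

lemma blk_diag_GL:
  assumes "n \<ge> 2" "s \<noteq> 0" "t \<noteq> 0"
  shows "blk n s 0 0 t \<in> carrier (GL n)" "inv\<^bsub>GL n\<^esub> (blk n s 0 0 t) = blk n (inverse s) 0 0 (inverse t)"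
proof -
  have "blk n s 0 0 t * blk n (inverse s) 0 0 (inverse t) = 1\<^sub>m n"
    "blk n (inverse s) 0 0 (inverse t) * blk n s 0 0 t = 1\<^sub>m n"
    using assms by (simp_all add: blk_mult blk_one)
  from GL_inv_eqI[OF blk_carrier blk_carrier this]
  show "blk n s 0 0 t \<in> carrier (GL n)" "inv\<^bsub>GL n\<^esub> (blk n s 0 0 t) = blk n (inverse s) 0 0 (inverse t)"
    by auto
qed

text \<open>Both factors are Weyl elements \<open>x\<^sub>1\<^sub>2(s) x\<^sub>2\<^sub>1(-1/s) x\<^sub>1\<^sub>2(s)\<close>.\<close>

lemma blk_diag_el:
  assumes "n \<ge> 2" "s \<noteq> 0"
  shows "blk n s 0 0 (inverse s) =
    (el n 0 1 s * el n 1 0 (- inverse s) * el n 0 1 s) * (el n 0 1 (- 1) * el n 1 0 1 * el n 0 1 (- 1))"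
  unfolding blk_el[OF assms(1)] using assms by (simp add: blk_mult)

lemma ring_of_type_algebra_simps:
  "carrier (ring_of_type_algebra :: 'a::ring_1 ring) = UNIV"
  "x \<otimes>\<^bsub>ring_of_type_algebra\<^esub> y = x * (y :: 'a)" "\<one>\<^bsub>ring_of_type_algebra\<^esub> = (1 :: 'a)"
  "x \<oplus>\<^bsub>ring_of_type_algebra\<^esub> y = x + (y :: 'a)" "\<zero>\<^bsub>ring_of_type_algebra\<^esub> = (0 :: 'a)"
  by (simp_all add: ring_of_type_algebra_def)

text \<open>A finite set of nonzero elements generates a finite group \<open>H\<close>, as the
  multiplicative group is abelian and torsion. In positive characteristic \<open>int_span H\<close>
  is finite, and it is closed under inverses because these are powers; so it contains the generated
  field.\<close>

lemma locally_finite_fieldI: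
  assumes comm: "\<And>x y :: 'a::division_ring. x * y = y * x"
    and ch: "\<exists>m::nat. m > 0 \<and> of_nat m = (0 :: 'a)"
    and tor: "\<And>x :: 'a. x \<noteq> 0 \<Longrightarrow> \<exists>k::nat. k > 0 \<and> x ^ k = 1"
  shows "locally_finite_field TYPE('a)"
proof -
  let ?R = "ring_of_type_algebra :: 'a ring"
  have lcomm: "x * (y * z) = y * (x * z)" for x y z :: 'a
    by (simp only: mult.assoc[symmetric] comm[of x y])
  have neg: "\<exists>y. x + y = 0" for x :: 'a using add.right_inverse by blast
  have cr: "cring ?R"
    unfolding ring_of_type_algebra_def using neg add.right_inverse
    by unfold_locales (auto simp: algebra_simps Units_def comm lcomm)
  interpret R: cring ?R by (rule cr)
  have field: "field ?R"
  proof (rule R.cring_fieldI)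
    have "x \<in> Units ?R" if "x \<noteq> 0" for x
      using that unfolding Units_def
      by (auto simp: ring_of_type_algebra_simps intro!: exI[of _ "inverse x"])
    moreover have "0 \<notin> Units ?R" unfolding Units_def by (simp add: ring_of_type_algebra_simps)
    ultimately show "Units ?R = carrier ?R - {\<zero>\<^bsub>?R\<^esub>}" by (auto simp: ring_of_type_algebra_simps)
  qed
  have gfield: "finite (generate_field ?R A)" if A: "finite A" for A
  proof -
    have one: "subgroup {1} (mult_group :: 'a monoid)" using mult_group.triv_subgroup by simp
    have lf: "lf_mod (mult_group :: 'a monoid) {1} (carrier mult_group)"
    proof (rule mult_group.lf_mod_abelian_periodic[OF mult_group.subgroup_self one])
      fix x y :: 'a assume "x \<in> carrier mult_group" "y \<in> carrier mult_group"
      then have "x \<noteq> 0" "y \<noteq> 0" by auto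
      moreover from this have "x * y * inverse x * inverse y = 1"
        unfolding comm[of x y] by (simp add: mult.assoc)
      ultimately show "x \<otimes>\<^bsub>mult_group\<^esub> y \<otimes>\<^bsub>mult_group\<^esub> inv\<^bsub>mult_group\<^esub> x \<otimes>\<^bsub>mult_group\<^esub> inv\<^bsub>mult_group\<^esub> y \<in> {1}"
        by simp
    qed (use tor in \<open>auto simp: normalizes_def\<close>)
    define H where "H = generate mult_group (A - {0})"
    have A0: "A - {0} \<subseteq> carrier mult_group" by auto
    have Hf: "finite H"
      unfolding H_def using mult_group.lf_mod_one_imp_finite_generate[OF mult_group.subgroup_self _ _ A0] lf A by simp
    have sH: "subgroup H mult_group" unfolding H_def using mult_group.generate_is_subgroup[OF A0] .
    have H1: "1 \<in> H" using subgroup.one_closed[OF sH] by simp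
    have Hm: "g * h \<in> H" if "g \<in> H" "h \<in> H" for g h using subgroup.m_closed[OF sH that] by simp
    define S where "S = int_span H"
    have S: "finite S" "1 \<in> S" "0 \<in> S"
      unfolding S_def using finite_int_span[OF Hf] ch int_span_base[OF Hf H1] int_span_0 by auto
    have Sm: "x * y \<in> S" if "x \<in> S" "y \<in> S" for x y
      using int_span_mult[OF Hf Hm] that unfolding S_def by blast
    have Sp: "x ^ k \<in> S" if "x \<in> S" for x and k :: nat
      by (induction k) (use S Sm that in auto)
    have Si: "inverse x \<in> S" if x: "x \<in> S" "x \<noteq> 0" for x
    proof -
      obtain k :: nat where k: "k > 0" "x ^ k = 1" using tor[OF x(2)] by blast
      have "x * x ^ (k - 1) = 1" using k by (metis Suc_diff_1 power_Suc)
      then have "inverse x = x ^ (k - 1)" by (rule inverse_unique)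
      then show ?thesis using Sp x by simp
    qed
    have "generate_field ?R A \<subseteq> S"
    proof
      fix x assume "x \<in> generate_field ?R A"
      then show "x \<in> S"
      proof induction
        case one then show ?case using S by (simp add: ring_of_type_algebra_simps)
      next
        case (incl h)
        then show ?case
          using S int_span_base[OF Hf] generate.incl[of h "A - {0}" mult_group] unfolding S_def H_def by (cases "h = 0") auto
      next
        case (a_inv h)
        have "\<ominus>\<^bsub>?R\<^esub> h = - h"
          by (rule R.minus_equality) (simp_all add: ring_of_type_algebra_simps)
        then show ?case using int_span_diff[of 0 H h] a_inv.IH S unfolding S_def by simp
      next
        case (m_inv h)
        then have h0: "h \<noteq> 0" by (simp add: ring_of_type_algebra_simps)
        have "inv\<^bsub>?R\<^esub> h = inverse h"
          by (rule R.inv_unique'[symmetric]) (use h0 in \<open>simp_all add: ring_of_type_algebra_simps\<close>)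
        then show ?case using Si[OF m_inv.IH h0] by simp
      next
        case (eng_add h1 h2)
        then show ?case using int_span_add unfolding S_def by (simp add: ring_of_type_algebra_simps)
      next
        case (eng_mult h1 h2)
        then show ?case using Sm by (simp add: ring_of_type_algebra_simps)
      qed
    qed
    then show ?thesis using S(1) finite_subset by blast
  qed
  show ?thesis unfolding locally_finite_field_def using field gfield by blast
qed

lemma (in group) subgroup_center: "subgroup (center G) G"
proof (rule subgroupI)
  show "center G \<subseteq> carrier G" unfolding center_def by blast
  have "\<one> \<in> center G" unfolding center_def by simp
  then show "center G \<noteq> {}" by blast
  show "inv a \<in> center G" if "a \<in> center G" for a
  proof -
    have a: "a \<in> carrier G" "\<And>x. x \<in> carrier G \<Longrightarrow> a \<otimes> x = x \<otimes> a" using that unfolding center_def by blast+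
    have "inv a \<otimes> x = x \<otimes> inv a" if x: "x \<in> carrier G" for x
    proof -
      have "inv a \<otimes> (a \<otimes> x) \<otimes> inv a = inv a \<otimes> (x \<otimes> a) \<otimes> inv a" using a(2)[OF x] by simp
      then show ?thesis using a(1) x by (simp add: m_assoc inv_cancel_left)
    qed
    then show ?thesis unfolding center_def using a(1) by simp
  qed
  show "a \<otimes> b \<in> center G" if "a \<in> center G" "b \<in> center G" for a b
  proof -
    have a: "a \<in> carrier G" "\<And>x. x \<in> carrier G \<Longrightarrow> a \<otimes> x = x \<otimes> a" using that unfolding center_def by blast+
    have b: "b \<in> carrier G" "\<And>x. x \<in> carrier G \<Longrightarrow> b \<otimes> x = x \<otimes> b" using that unfolding center_def by blast+
    have "a \<otimes> b \<otimes> x = x \<otimes> (a \<otimes> b)" if x: "x \<in> carrier G" for x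
    proof -
      have "a \<otimes> b \<otimes> x = a \<otimes> (x \<otimes> b)" using a(1) b(1) x b(2)[OF x] by (simp add: m_assoc)
      also have "\<dots> = a \<otimes> x \<otimes> b" using a(1) b(1) x by (simp add: m_assoc)
      also have "\<dots> = x \<otimes> (a \<otimes> b)" using a(1) b(1) x a(2)[OF x] by (simp add: m_assoc)
      finally show ?thesis .
    qed
    then show ?thesis unfolding center_def using a(1) b(1) by simp
  qed
qed

section \<open>Noncentral subgroups in rank at least two\<close>

context elementary_normalized
begin

lemma blk_diag_W_P:
  assumes "\<not> M \<subseteq> center (GL n)" "s \<noteq> 0"
  shows "blk n s 0 0 (inverse s) \<in> W" "blk n s 0 0 (inverse s) \<in> P"
proof -
  have ij: "0 < n" "1 < n" using n2 by auto
  note w = el_W[OF assms(1) ij(1,2)] el_W[OF assms(1) ij(2,1)]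
  show "blk n s 0 0 (inverse s) \<in> W"
    unfolding blk_diag_el[OF n2 assms(2)] by (intro W_mult w) auto
  have P': "x * y \<in> P" if "x \<in> P" "y \<in> P" for x y using subgroup.m_closed[OF P that] by simp
  show "blk n s 0 0 (inverse s) \<in> P"
    unfolding blk_diag_el[OF n2 assms(2)] by (intro P' el_P) (use ij in auto)
qed

text \<open>Let \<open>L\<close> collect the first entries \<open>d\<close> of the matrices diag(d,
  d', 1, ...) in \<open>M\<close>. Conjugation by diag(x, 1/x, 1, ...) in \<open>P\<close> makes
  \<open>L\<close> normal in the multiplicative group, so the case of rank one puts \<open>L\<close>
  into the centre. But \<open>L\<close> contains all commutators, coming from the diagonal matrices
  in \<open>W\<close>; the multiplicative group thus has class at most two and is
  commutative.\<close>

lemma commutative_of_noncentral: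
  assumes nc: "\<not> M \<subseteq> center (GL n)" and lf: "lf_mod (GL n) (center (GL n)) M"
  shows "x * y = y * (x :: 'a)"
proof -
  define Z where "Z = center (GL n :: 'a mat monoid)"
  have Z: "subgroup Z (GL n)" unfolding Z_def by (rule GL.subgroup_center)
  have Z00: "z $$ (0, 0) \<in> center mult_group" if z: "z \<in> Z" for z
  proof (rule commutes_el_scalar(2))
    show "z \<in> carrier (GL n)" "0 < n" using z n2 unfolding Z_def center_def by auto
    show "el n i j c * z = z * el n i j c" if "i < n" "j < n" "i \<noteq> j" for i j c
      using z el_GL(1)[OF that, of c] unfolding Z_def center_def by auto
    show "n = 1 \<Longrightarrow> \<forall>c. z $$ (0, 0) * c = c * z $$ (0, 0)" using n2 by simp
  qed
  have Mm': "x * y \<in> M" if "x \<in> M" "y \<in> M" for x y using subgroup.m_closed[OF M that] by simp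
  \<comment> \<open>The second entry is left free: the commutator of diag(s, 1/s, 1, ...) and
    diag(t, 1/t, 1, ...) has second entry \<open>inverse s * inverse t * s * t\<close>, which need
    not be the inverse of the first when \<open>D\<close> is not commutative.\<close>
  define K where "K = {A \<in> M. \<exists>d d'. d \<noteq> 0 \<and> d' \<noteq> 0 \<and> A = blk n d 0 0 d'}"
  have KM: "K \<subseteq> M" unfolding K_def by blast
  have KI: "blk n d 0 0 d' \<in> K" if "blk n d 0 0 d' \<in> M" "d \<noteq> 0" "d' \<noteq> 0" for d d'
    unfolding K_def using that by blast
  have KE: "\<exists>d d'. d \<noteq> 0 \<and> d' \<noteq> 0 \<and> A = blk n d 0 0 d'" if "A \<in> K" for A using that unfolding K_def by blast
  have subK: "subgroup K (GL n)"
  proof (rule GL.subgroupI)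
    show "K \<subseteq> carrier (GL n)" using KM subgroup.subset[OF M] by blast
    have "blk n 1 0 0 1 \<in> M" unfolding blk_one[OF n2] using subgroup.one_closed[OF M] by simp
    then show "K \<noteq> {}" using KI[of 1 1] by auto
    show "inv\<^bsub>GL n\<^esub> A \<in> K" if A: "A \<in> K" for A
    proof -
      obtain d d' where d: "d \<noteq> 0" "d' \<noteq> 0" "A = blk n d 0 0 d'" using KE[OF A] by (elim exE conjE) (rule that)
      have "inv\<^bsub>GL n\<^esub> A \<in> M" using subgroup.m_inv_closed[OF M] A KM by blast
      then show ?thesis using KI[of "inverse d" "inverse d'"] d blk_diag_GL(2)[OF n2 d(1,2)] by simp
    qed
    show "A \<otimes>\<^bsub>GL n\<^esub> A' \<in> K" if A: "A \<in> K" and A': "A' \<in> K" for A A'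
    proof -
      obtain d d' where d: "d \<noteq> 0" "d' \<noteq> 0" "A = blk n d 0 0 d'" using KE[OF A] by (elim exE conjE) (rule that)
      obtain e e' where e: "e \<noteq> 0" "e' \<noteq> 0" "A' = blk n e 0 0 e'" using KE[OF A'] by (elim exE conjE) (rule that)
      have "A * A' \<in> M" using Mm' A A' KM by blast
      then show ?thesis using KI[of "d * e" "d' * e'"] d e by (simp add: blk_mult[OF n2])
    qed
  qed
  have lfK: "lf_mod (GL n) (Z \<inter> K) K"
    using GL.lf_mod_Int[OF M Z _ subK KM] lf unfolding Z_def by blast
  define p where "p A = A $$ (0, 0)" for A :: "'a mat"
  have pm: "p (A * A') = p A * p A'" if A: "A \<in> K" "A' \<in> K" for A A'
  proof -
    obtain d d' where d: "A = blk n d 0 0 d'" using KE[OF A(1)] by blast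
    obtain e e' where e: "A' = blk n e 0 0 e'" using KE[OF A(2)] by blast
    show ?thesis unfolding d e p_def using n2 by (simp add: blk_mult blk_index)
  qed
  have p0: "p A \<noteq> 0" if A: "A \<in> K" for A
  proof -
    obtain d d' where "d \<noteq> 0" "A = blk n d 0 0 d'" using KE[OF A] by blast
    then show ?thesis unfolding p_def using n2 by (simp add: blk_index)
  qed
  have p1: "p (1\<^sub>m n) = 1" unfolding p_def using n2 by simp
  define L where "L = p ` K"
  have LI: "d \<in> L" if "blk n d 0 0 d' \<in> M" "d \<noteq> 0" "d' \<noteq> 0" for d d'
    unfolding L_def using KI[OF that] n2 by (intro image_eqI[of _ _ "blk n d 0 0 d'"]) (simp_all add: p_def blk_index)
  have LE: "\<exists>d'. d' \<noteq> 0 \<and> d \<noteq> 0 \<and> blk n d 0 0 d' \<in> M" if dL: "d \<in> L" for d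
  proof -
    obtain A where A: "A \<in> K" "d = p A" using dL unfolding L_def by blast
    obtain e e' where e: "e \<noteq> 0" "e' \<noteq> 0" "A = blk n e 0 0 e'" using KE[OF A(1)] by (elim exE conjE) (rule that)
    have "e = d" using A(2) e(3) n2 by (simp add: p_def blk_index)
    then show ?thesis using A(1) KM e by blast
  qed
  have "subgroup L mult_group"
  proof (rule mult_group.subgroupI)
    show "L \<subseteq> carrier mult_group" unfolding L_def using p0 by auto
    show "L \<noteq> {}" unfolding L_def using subgroup.one_closed[OF subK] by blast
    show "inv\<^bsub>mult_group\<^esub> d \<in> L" if dL: "d \<in> L" for d
    proof -
      obtain d' where d: "d' \<noteq> 0" "d \<noteq> 0" "blk n d 0 0 d' \<in> M" using LE[OF dL] by (elim exE conjE) (rule that)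
      have "blk n (inverse d) 0 0 (inverse d') \<in> M"
        using subgroup.m_inv_closed[OF M d(3)] blk_diag_GL(2)[OF n2 d(2,1)] by simp
      then show ?thesis using LI[of "inverse d" "inverse d'"] d by simp
    qed
    show "d \<otimes>\<^bsub>mult_group\<^esub> e \<in> L" if de: "d \<in> L" "e \<in> L" for d e
    proof -
      obtain d' where d: "d' \<noteq> 0" "d \<noteq> 0" "blk n d 0 0 d' \<in> M" using LE[OF de(1)] by (elim exE conjE) (rule that)
      obtain e' where e: "e' \<noteq> 0" "e \<noteq> 0" "blk n e 0 0 e' \<in> M" using LE[OF de(2)] by (elim exE conjE) (rule that)
      have "blk n (d * e) 0 0 (d' * e') \<in> M" using Mm'[OF d(3) e(3)] by (simp add: blk_mult[OF n2])
      then show ?thesis using LI[of "d * e" "d' * e'"] d e by simp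
    qed
  qed
  moreover have "conj_closed L"
    unfolding conj_closed_def
  proof (intro allI impI)
    fix x d :: 'a assume x: "x \<noteq> 0" and dL: "d \<in> L"
    obtain d' where d: "d' \<noteq> 0" "d \<noteq> 0" "blk n d 0 0 d' \<in> M" using LE[OF dL] by (elim exE conjE) (rule that)
    have ix: "inverse x \<noteq> 0" using x by simp
    have "blk n x 0 0 (inverse x) * blk n d 0 0 d' * blk n (inverse x) 0 0 (inverse (inverse x)) \<in> M"
      using normalizesD[OF nor blk_diag_W_P(2)[OF nc x] d(3)] unfolding blk_diag_GL(2)[OF n2 x ix] by simp
    then have "blk n (x * d * inverse x) 0 0 (inverse x * d' * x) \<in> M"
      using x by (simp add: blk_mult[OF n2])
    then show "x * d * inverse x \<in> L" by (rule LI) (use x d in auto)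
  qed
  moreover have "lf_mod mult_group (center mult_group) L"
    unfolding L_def
  proof (rule lf_mod_image[OF lfK])
    show "p (x \<otimes>\<^bsub>GL n\<^esub> y) = p x \<otimes>\<^bsub>mult_group\<^esub> p y" if "x \<in> K \<union> Z \<inter> K" "y \<in> K" for x y
      using pm[of x y] that by auto
    show "p \<one>\<^bsub>GL n\<^esub> = \<one>\<^bsub>mult_group\<^esub>" using p1 by simp
    show "p ` (Z \<inter> K) \<subseteq> center mult_group" using Z00 unfolding p_def by blast
  qed
  ultimately have Lc: "L \<subseteq> center mult_group" by (rule lf_mod_center_normal_central)
  have cen: "s * t * inverse s * inverse t * z = z * (s * t * inverse s * inverse t)"
    if st: "s \<in> carrier mult_group" "t \<in> carrier mult_group" for s t z :: 'a
  proof -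
    have nz: "s \<noteq> 0" "t \<noteq> 0" "inverse s \<noteq> 0" "inverse t \<noteq> 0" using st by auto
    have "blk n s 0 0 (inverse s) * blk n t 0 0 (inverse t) * inv\<^bsub>GL n\<^esub> (blk n s 0 0 (inverse s))
        * inv\<^bsub>GL n\<^esub> (blk n t 0 0 (inverse t)) \<in> M"
      using W_commutator[OF blk_diag_W_P(1)[OF nc nz(1)] blk_diag_W_P(1)[OF nc nz(2)]] .
    then have "blk n (s * t * inverse s * inverse t) 0 0 (inverse s * inverse t * s * t) \<in> M"
      unfolding blk_diag_GL(2)[OF n2 nz(1,3)] blk_diag_GL(2)[OF n2 nz(2,4)] by (simp add: blk_mult[OF n2])
    then have "s * t * inverse s * inverse t \<in> L" by (rule LI) (use nz in auto)
    then have "s * t * inverse s * inverse t \<in> center mult_group" using Lc by blast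
    then show ?thesis unfolding center_mult_group by blast
  qed
  have cc: "conj_closed (carrier (mult_group :: 'a monoid))" unfolding conj_closed_def by auto
  show ?thesis
  proof (cases "x = 0 \<or> y = 0")
    case False
    then show ?thesis using class_two_imp_commute[OF mult_group.subgroup_self cc cen, of x y] by simp
  qed auto
qed

theorem lf_mod_imp_central:
  assumes lf: "lf_mod (GL n) (center (GL n)) M" and nf: "\<not> locally_finite_field TYPE('a)"
  shows "M \<subseteq> center (GL n)"
proof (rule ccontr)
  assume nc: "\<not> M \<subseteq> center (GL n)"
  note comm = commutative_of_noncentral[OF nc lf]
  have ij: "0 < n" "1 < n" using n2 by auto
  show False
  proof (cases "\<exists>d :: 'a. d \<noteq> 0 \<and> d * d \<noteq> 1")
    \<comment> \<open>If every nonzero element squares to 1, the multiplicative group is torsion,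
      and \<open>2 * 2 = 1\<close> unless \<open>2 = 0\<close> bounds the characteristic by 3. So
      \<open>D\<close> would be a locally finite field already.\<close>
    case False
    have sq: "x * x = 1" if "x \<noteq> 0" for x :: 'a using False that by blast
    have tor: "\<exists>k::nat. k > 0 \<and> x ^ k = 1" if "x \<noteq> 0" for x :: 'a
      using sq[OF that] by (intro exI[of _ 2]) (simp add: power2_eq_square)
    have "\<exists>m::nat. m > 0 \<and> of_nat m = (0 :: 'a)"
    proof (cases "(2 :: 'a) = 0")
      case True then show ?thesis by (intro exI[of _ 2]) simp
    next
      case False
      then have "(3 :: 'a) + 1 = 0 + 1" using sq[of 2] by simp
      then have "(3 :: 'a) = 0" by (rule add_right_imp_eq)
      then show ?thesis by (intro exI[of _ 3]) simp
    qed
    then show False using locally_finite_fieldI[OF comm _ tor] nf by blast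
  next
    case True
    then obtain d :: 'a where d: "d \<noteq> 0" "d * d \<noteq> 1" by blast
    have id: "inverse d \<noteq> 0" using d by simp
    have inv1: "inv\<^bsub>GL n\<^esub> (blk n d 0 0 (inverse d)) = blk n (inverse d) 0 0 d"
      using blk_diag_GL(2)[OF n2 d(1) id] by simp
    have inv2: "inv\<^bsub>GL n\<^esub> (blk n (inverse d) 0 0 d) = blk n d 0 0 (inverse d)"
      using blk_diag_GL(2)[OF n2 id d(1)] by simp
    \<comment> \<open>The commutator of diag(d, 1/d, 1, ...) with \<open>el n 0 1 a\<close> is
      \<open>el n 0 1 (d * a * d - a)\<close>. Because the square of \<open>d\<close> is not 1,
      every \<open>u\<close> has this form.\<close>
    have sq: "d * (inverse (d * d - 1) * u) * d - inverse (d * d - 1) * u = u" for u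
    proof -
      have n0: "d * d - 1 \<noteq> 0" using d(2) by simp
      define a where "a = inverse (d * d - 1) * u"
      have "d * a * d = d * d * a" by (simp only: mult.assoc comm[of a d])
      then have "d * a * d - a = (d * d - 1) * a" by (simp add: left_diff_distrib)
      also have "\<dots> = u" unfolding a_def using n0 by (simp add: mult.assoc[symmetric])
      finally show ?thesis unfolding a_def .
    qed
    have up: "el n 0 1 u \<in> M" for u
    proof -
      define a where "a = inverse (d * d - 1) * u"
      have e: "d * a * d - a = u" using sq[of u] unfolding a_def .
      have "blk n d 0 0 (inverse d) * el n 0 1 a * inv\<^bsub>GL n\<^esub> (blk n d 0 0 (inverse d)) * inv\<^bsub>GL n\<^esub> (el n 0 1 a) \<in> M"
        by (rule W_commutator[OF blk_diag_W_P(1)[OF nc d(1)] el_W[OF nc ij]]) simp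
      then show ?thesis
        unfolding inv1 unfolding el_GL(2)[OF ij zero_neq_one] unfolding blk_el[OF n2]
        using d(1) e by (simp add: blk_mult[OF n2])
    qed
    have low: "el n 1 0 u \<in> M" for u
    proof -
      define a where "a = inverse (d * d - 1) * u"
      have e: "d * a * d - a = u" using sq[of u] unfolding a_def .
      have "blk n (inverse d) 0 0 (inverse (inverse d)) * el n 1 0 a *
          inv\<^bsub>GL n\<^esub> (blk n (inverse d) 0 0 (inverse (inverse d))) * inv\<^bsub>GL n\<^esub> (el n 1 0 a) \<in> M"
        by (rule W_commutator[OF blk_diag_W_P(1)[OF nc id] el_W[OF nc ij(2,1)]]) simp
      then show ?thesis
        unfolding inverse_inverse_eq inv2 unfolding el_GL(2)[OF ij(2,1) one_neq_zero] unfolding blk_el[OF n2]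
        using d(1) e by (simp add: blk_mult[OF n2])
    qed
    have Mm': "x * y \<in> M" if "x \<in> M" "y \<in> M" for x y using subgroup.m_closed[OF M that] by simp
    have h: "blk n s 0 0 (inverse s) \<in> M" if "s \<noteq> 0" for s
      unfolding blk_diag_el[OF n2 that] by (intro Mm' up low)
    have cen: "A * B = B * A" if "A \<in> center (GL n)" "B \<in> carrier (GL n)" for A B :: "'a mat"
      using that unfolding center_def by simp
    have tor: "\<exists>k::nat. k > 0 \<and> s ^ k = 1" if s: "s \<noteq> 0" for s :: 'a
    proof -
      obtain k :: nat where k: "k > 0" "blk n s 0 0 (inverse s) [^]\<^bsub>GL n\<^esub> k \<in> center (GL n)"
        using GL.lf_mod_pow[OF M GL.subgroup_center lf h[OF s]] by blast
      have "blk n s 0 0 (inverse s) [^]\<^bsub>GL n\<^esub> j = blk n (s ^ j) 0 0 (inverse s ^ j)" for j :: nat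
        by (induction j) (simp_all add: blk_one[OF n2] blk_mult[OF n2] power_Suc2 del: power_Suc)
      then have c: "blk n (s ^ k) 0 0 (inverse s ^ k) \<in> center (GL n)" using k(2) by simp
      \<comment> \<open>Commuting with an elementary matrix forces the two diagonal entries to
        agree, so \<open>s ^ (k + k) = 1\<close>.\<close>
      have "blk n (s ^ k) 0 0 (inverse s ^ k) * el n 0 1 1 = el n 0 1 1 * blk n (s ^ k) 0 0 (inverse s ^ k)"
        using cen[OF c el_GL(1)[OF ij]] by simp
      then have "blk n (s ^ k) (s ^ k) 0 (inverse s ^ k) = blk n (s ^ k) (inverse s ^ k) 0 (inverse s ^ k)"
        unfolding blk_el[OF n2] by (simp add: blk_mult[OF n2])
      from arg_cong[OF this, of "\<lambda>A. A $$ (0, 1)"] have "s ^ k = inverse s ^ k" unfolding blk_index[OF n2] .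
      then have "s ^ k * s ^ k = inverse s ^ k * s ^ k" by simp
      also have "\<dots> = 1" using s by (simp add: power_inverse)
      finally have "s ^ (k + k) = 1" by (simp add: power_add)
      then show ?thesis using k(1) by (intro exI[of _ "k + k"]) simp
    qed
    have ch: "\<exists>m::nat. m > 0 \<and> of_nat m = (0 :: 'a)"
    proof -
      obtain k :: nat where k: "k > 0" "el n 0 1 1 [^]\<^bsub>GL n\<^esub> k \<in> center (GL n :: 'a mat monoid)"
        using GL.lf_mod_pow[OF M GL.subgroup_center lf up] by blast
      have "el n 0 1 1 [^]\<^bsub>GL n\<^esub> j = blk n 1 (of_nat j :: 'a) 0 1" for j :: nat
        unfolding blk_el[OF n2] by (induction j) (simp_all add: blk_one[OF n2] blk_mult[OF n2] add.commute)
      then have c: "blk n 1 (of_nat k :: 'a) 0 1 \<in> center (GL n)" using k(2) by simp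
      \<comment> \<open>An upper elementary matrix commutes with this lower one only if its entry
        vanishes. The entry is \<open>of_nat k\<close>, so the characteristic is positive.\<close>
      have "blk n 1 (of_nat k :: 'a) 0 1 * el n 1 0 1 = el n 1 0 1 * blk n 1 (of_nat k) 0 1"
        using cen[OF c el_GL(1)[OF ij(2,1)]] by simp
      then have "blk n (1 + of_nat k) (of_nat k) 1 1 = blk n 1 (of_nat k :: 'a) 1 (of_nat k + 1)"
        unfolding blk_el[OF n2] by (simp add: blk_mult[OF n2])
      from arg_cong[OF this, of "\<lambda>A. A $$ (0, 0)"] have "1 + of_nat k = (1 :: 'a)" unfolding blk_index[OF n2] .
      then show ?thesis using k(1) by auto
    qed
    show False using locally_finite_fieldI[OF comm ch tor] nf by blast
  qed
qed

end

section \<open>Special and projective linear groups\<close>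

lemma GL_diag_nonzero:
  assumes A: "A \<in> carrier (GL 1)"
  shows "A $$ (0, 0) \<noteq> (0 :: 'a::division_ring)"
proof
  assume 0: "A $$ (0, 0) = 0"
  have "\<exists>B \<in> carrier_mat 1 1. A * B = 1\<^sub>m 1 \<and> B * A = 1\<^sub>m 1" using A by (rule carrier_GL[THEN iffD1, THEN conjunct2])
  then obtain B where B: "B \<in> carrier_mat 1 1" "A * B = 1\<^sub>m 1" by (elim bexE conjE) (rule that)
  have "(A * B) $$ (0, 0) = (\<Sum>k<1. A $$ (0, k) * B $$ (k, 0))"
    by (rule mat_mult_index[OF GL_carrier_mat[OF A] B(1)]) simp_all
  then show False using 0 B(2) by simp
qed

lemma scalar_GL_1:
  assumes "x \<noteq> (0 :: 'a::division_ring)"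
  shows "x \<cdot>\<^sub>m 1\<^sub>m 1 \<in> carrier (GL 1)"
proof -
  have c: "x \<cdot>\<^sub>m 1\<^sub>m 1 \<in> carrier_mat 1 1" "inverse x \<cdot>\<^sub>m 1\<^sub>m 1 \<in> carrier_mat 1 1" by simp_all
  have m: "(B * C) $$ (0, 0) = B $$ (0, 0) * C $$ (0, 0)"
    if "B \<in> carrier_mat 1 1" "C \<in> carrier_mat 1 1" for B C :: "'a mat"
    using mat_mult_index[OF that, of 0 0] by simp
  have "(x \<cdot>\<^sub>m 1\<^sub>m 1) * (inverse x \<cdot>\<^sub>m 1\<^sub>m 1) = 1\<^sub>m 1" "(inverse x \<cdot>\<^sub>m 1\<^sub>m 1) * (x \<cdot>\<^sub>m 1\<^sub>m 1) = 1\<^sub>m 1"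
    using assms m[OF c] m[OF c(2,1)] by (auto intro!: eq_matI)
  then show ?thesis using GL_inv_eqI(1)[OF c] by blast
qed

lemma center_GL_iff:
  assumes n: "n > 0"
  shows "A \<in> center (GL n) \<longleftrightarrow> (\<exists>l \<in> center mult_group. A = l \<cdot>\<^sub>m (1\<^sub>m n :: 'a::division_ring mat))"
proof
  assume "\<exists>l \<in> center mult_group. A = l \<cdot>\<^sub>m 1\<^sub>m n"
  then obtain l where l: "l \<in> center mult_group" "A = l \<cdot>\<^sub>m 1\<^sub>m n" by (elim bexE) (rule that)
  note z = l(1)[unfolded center_mult_group]
  show "A \<in> center (GL n)" unfolding l(2) by (rule scalar_mat_central[OF z[THEN conjunct2, rule_format] z[THEN conjunct1]])
next
  assume A: "A \<in> center (GL n)"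
  then have Ac: "A \<in> carrier (GL n)" and cm: "\<forall>B \<in> carrier (GL n). A \<otimes>\<^bsub>GL n\<^esub> B = B \<otimes>\<^bsub>GL n\<^esub> A"
    unfolding center_def by blast+
  note cm = bspec[OF cm[unfolded GL_simps]]
  have el: "el n i j c * A = A * el n i j c" if "i < n" "j < n" "i \<noteq> j" for i j c
    by (rule cm[OF el_GL(1)[OF that], symmetric])
  have one: "\<forall>c. A $$ (0, 0) * c = c * A $$ (0, 0)" if n1: "n = 1"
  proof
    fix c show "A $$ (0, 0) * c = c * A $$ (0, 0)"
    proof (cases "c = 0")
      case False
      have "c \<cdot>\<^sub>m 1\<^sub>m 1 \<in> carrier (GL 1)" by (rule scalar_GL_1[OF False])
      then have c: "A * (c \<cdot>\<^sub>m 1\<^sub>m 1) = (c \<cdot>\<^sub>m 1\<^sub>m 1) * A" by (rule cm[unfolded n1])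
      have Am: "A \<in> carrier_mat 1 1" using GL_carrier_mat[OF Ac] n1 by simp
      have "A $$ (0, 0) * c = (A * (c \<cdot>\<^sub>m 1\<^sub>m 1)) $$ (0, 0)" using mat_mult_index[OF Am, of "c \<cdot>\<^sub>m 1\<^sub>m 1" 0 0] by simp
      also have "\<dots> = c * A $$ (0, 0)" unfolding c using mat_mult_index[OF _ Am, of "c \<cdot>\<^sub>m 1\<^sub>m 1" 0 0] by simp
      finally show ?thesis .
    qed simp
  qed
  have "A = A $$ (0, 0) \<cdot>\<^sub>m 1\<^sub>m n" by (rule commutes_el_scalar(1)[OF n Ac]) ((rule el; assumption) | (rule one; assumption))+
  moreover have "A $$ (0, 0) \<in> center mult_group"
    by (rule commutes_el_scalar(2)[OF n Ac]) ((rule el; assumption) | (rule one; assumption))+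
  ultimately show "\<exists>l \<in> center mult_group. A = l \<cdot>\<^sub>m 1\<^sub>m n" by (rule bexI)
qed

section \<open>The Dieudonne determinant on scalar and elementary matrices, and rank one\<close>

lemma dieudonne_rep_pivot_0:
  assumes "A $$ (0, 0) \<noteq> (0 :: 'a::division_ring)"
  shows "dieudonne_rep (Suc n) A = A $$ (0, 0) * dieudonne_rep n (eliminate n 0 A)"
proof -
  have "(LEAST i. A $$ (i, 0) \<noteq> 0) = 0" using assms by (intro Least_eq_0)
  then show ?thesis by simp
qed

lemma dieudonne_rep_scalar:
  assumes "l \<noteq> (0 :: 'a::division_ring)"
  shows "dieudonne_rep n (l \<cdot>\<^sub>m 1\<^sub>m n) = l ^ n"
proof (induction n)
  case (Suc n)
  have "eliminate n 0 (l \<cdot>\<^sub>m 1\<^sub>m (Suc n)) = l \<cdot>\<^sub>m 1\<^sub>m n"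
    unfolding eliminate_def by (rule eq_matI) auto
  then show ?case using Suc assms dieudonne_rep_pivot_0[of "l \<cdot>\<^sub>m 1\<^sub>m (Suc n)" n] by simp
qed simp

lemma el_index:
  "k < n \<Longrightarrow> l < n \<Longrightarrow> el n i j c $$ (k, l) = (if k = l then 1 else 0) + (if k = i \<and> l = j then c else 0)"
  by (simp add: el_def tv_index single_def)

text \<open>The pivot at (0, 0) is 1, and no correction term arises in the remaining block, since
  row 0 or column 0 is that of the identity. The block is again elementary, or the identity if
  \<open>i\<close> or \<open>j\<close> is 0.\<close>

lemma dieudonne_rep_el:
  assumes "i < n" "j < n" "i \<noteq> j"
  shows "dieudonne_rep n (el n i j c) = (1 :: 'a::division_ring)"
  using assms
proof (induction n arbitrary: i j)
  case (Suc n)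
  have 1: "dieudonne_rep n (1\<^sub>m n) = (1 :: 'a)"
  proof -
    have "(1 :: 'a) \<cdot>\<^sub>m 1\<^sub>m n = 1\<^sub>m n" by (rule eq_matI) simp_all
    then show ?thesis using dieudonne_rep_scalar[of "1 :: 'a" n] by simp
  qed
  have 00: "el (Suc n) i j c $$ (0, 0) = 1" using Suc.prems by (auto simp: el_index)
  have e: "eliminate n 0 (el (Suc n) i j c) $$ (k, l) =
      (if k = l then 1 else 0) + (if Suc k = i \<and> Suc l = j then c else 0)" if "k < n" "l < n" for k l
  proof -
    have "eliminate n 0 (el (Suc n) i j c) $$ (k, l) = el (Suc n) i j c $$ (Suc k, Suc l)
        - el (Suc n) i j c $$ (Suc k, 0) * el (Suc n) i j c $$ (0, Suc l)"
      unfolding eliminate_def using that 00 by simp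
    moreover have "el (Suc n) i j c $$ (Suc k, 0) = 0 \<or> el (Suc n) i j c $$ (0, Suc l) = 0"
      using that by (cases "i = 0") (simp_all add: el_index)
    ultimately show ?thesis using that by (auto simp: el_index)
  qed
  have dim: "eliminate n 0 (el (Suc n) i j c) \<in> carrier_mat n n" unfolding eliminate_def by simp
  have "dieudonne_rep n (eliminate n 0 (el (Suc n) i j c)) = 1"
  proof (cases "i = 0 \<or> j = 0")
    case True
    have "eliminate n 0 (el (Suc n) i j c) = 1\<^sub>m n"
      by (rule eq_matI) (use True dim e in auto)
    then show ?thesis using 1 by simp
  next
    case False
    then obtain i' j' where ij: "i = Suc i'" "j = Suc j'" by (meson not0_implies_Suc)
    have "eliminate n 0 (el (Suc n) i j c) = el n i' j' c"
    proof (rule eq_matI)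
      fix k l assume "k < dim_row (el n i' j' c)" "l < dim_col (el n i' j' c)"
      then have kl: "k < n" "l < n" using carrier_matD[OF el_carrier[of n i' j' c]] by simp_all
      show "eliminate n 0 (el (Suc n) i j c) $$ (k, l) = el n i' j' c $$ (k, l)"
        using e[OF kl] kl by (simp add: el_index ij)
    qed (use dim carrier_matD[OF el_carrier[of n i' j' c]] in simp_all)
    then show ?thesis using Suc.IH[of i' j'] Suc.prems ij by simp
  qed
  then show ?case using dieudonne_rep_pivot_0[of "el (Suc n) i j c" n] 00 by simp
qed simp

lemma subgroup_commutator_subgroup:
  "subgroup (commutator_subgroup :: 'a::division_ring set) mult_group"
  using mult_group.derived_is_subgroup by blast

lemma commutator_in_commutator_subgroup:
  "x \<noteq> 0 \<Longrightarrow> y \<noteq> 0 \<Longrightarrow> x * y * inverse x * inverse y \<in> (commutator_subgroup :: 'a::division_ring set)"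
  unfolding derived_def by (rule generate.incl) force

lemma carrier_SL:
  "A \<in> carrier (SL n) \<longleftrightarrow> A \<in> carrier (GL n) \<and> dieudonne_rep n A \<in> (commutator_subgroup :: 'a::division_ring set)"
proof -
  let ?D = "commutator_subgroup :: 'a set"
  have "?D #>\<^bsub>mult_group\<^esub> r = ?D \<longleftrightarrow> r \<in> ?D" for r
  proof
    assume "?D #>\<^bsub>mult_group\<^esub> r = ?D"
    moreover have "1 * r \<in> ?D #>\<^bsub>mult_group\<^esub> r"
      unfolding r_coset_def using subgroup.one_closed[OF subgroup_commutator_subgroup] by force
    ultimately show "r \<in> ?D" by simp
  next
    assume r: "r \<in> ?D"
    show "?D #>\<^bsub>mult_group\<^esub> r = ?D"
      using mult_group.coset_join2[OF subgroup.mem_carrier[OF subgroup_commutator_subgroup r]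
          subgroup_commutator_subgroup r] .
  qed
  then show ?thesis unfolding SL_def by (simp add: kernel_def dieudonne_det_def FactGroup_def)
qed

lemma SL_record: "SL n = (GL n)\<lparr>carrier := carrier (SL n)\<rparr>"
  unfolding SL_def by simp

lemma el_SL: "i < n \<Longrightarrow> j < n \<Longrightarrow> i \<noteq> j \<Longrightarrow> el n i j c \<in> carrier (SL n)"
  using subgroup.one_closed[OF subgroup_commutator_subgroup]
  by (simp add: carrier_SL el_GL(1) dieudonne_rep_el)

lemma carrier_SL_1:
  assumes A: "A \<in> carrier (GL 1)"
  shows "A \<in> carrier (SL 1) \<longleftrightarrow> A $$ (0, 0) \<in> (commutator_subgroup :: 'a::division_ring set)"
  using A dieudonne_rep_pivot_0[OF GL_diag_nonzero[OF A], of 0] by (simp add: carrier_SL)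

lemma GL_1_mult_index:
  "A \<in> carrier (GL 1) \<Longrightarrow> B \<in> carrier (GL 1) \<Longrightarrow> (A * B) $$ (0, 0) = A $$ (0, 0) * (B :: 'a::division_ring mat) $$ (0, 0)"
  using mat_mult_index[OF GL_carrier_mat GL_carrier_mat, of A 1 B 0 0] by simp

lemma GL_1_inv_index:
  assumes A: "A \<in> carrier (GL 1)"
  shows "(inv\<^bsub>GL 1\<^esub> A) $$ (0, 0) = inverse ((A :: 'a::division_ring mat) $$ (0, 0))"
proof -
  have "A * inv\<^bsub>GL 1\<^esub> A = 1\<^sub>m 1" using GL.r_inv[OF A] by simp
  then have "A $$ (0, 0) * (inv\<^bsub>GL 1\<^esub> A) $$ (0, 0) = 1"
    using GL_1_mult_index[OF A GL.inv_closed[OF A]] by simp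
  then show ?thesis by (simp add: inverse_unique)
qed

lemma GL_1_subgroup_image:
  assumes R: "subgroup R (GL 1)" and nor: "normalizes (GL 1) (carrier (GL 1)) R"
  shows "subgroup ((\<lambda>A. A $$ (0, 0)) ` R) mult_group"
    "conj_closed ((\<lambda>A. A $$ (0, 0)) ` (R :: 'a::division_ring mat set))"
proof -
  let ?p = "\<lambda>A :: 'a mat. A $$ (0, 0)"
  have Rc: "A \<in> carrier (GL 1)" if "A \<in> R" for A using subgroup.mem_carrier[OF R that] .
  show "subgroup (?p ` R) mult_group"
  proof (rule mult_group.subgroupI)
    show "?p ` R \<subseteq> carrier mult_group" using GL_diag_nonzero[OF Rc] by auto
    show "?p ` R \<noteq> {}" using subgroup.one_closed[OF R] by blast
    show "inv\<^bsub>mult_group\<^esub> a \<in> ?p ` R" if aR: "a \<in> ?p ` R" for a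
    proof -
      obtain A where A: "A \<in> R" "a = ?p A" using aR by blast
      then have "inv\<^bsub>mult_group\<^esub> a = ?p (inv\<^bsub>GL 1\<^esub> A)"
        using GL_1_inv_index[OF Rc[OF A(1)]] GL_diag_nonzero[OF Rc[OF A(1)]] by simp
      then show ?thesis using subgroup.m_inv_closed[OF R A(1)] by blast
    qed
    show "a \<otimes>\<^bsub>mult_group\<^esub> b \<in> ?p ` R" if abR: "a \<in> ?p ` R" "b \<in> ?p ` R" for a b
    proof -
      obtain A B where A: "A \<in> R" "a = ?p A" "B \<in> R" "b = ?p B" using abR by blast
      then have "a \<otimes>\<^bsub>mult_group\<^esub> b = ?p (A \<otimes>\<^bsub>GL 1\<^esub> B)" using GL_1_mult_index[OF Rc[OF A(1)] Rc[OF A(3)]] by simp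
      then show ?thesis using subgroup.m_closed[OF R A(1,3)] by blast
    qed
  qed
  show "conj_closed (?p ` R)"
    unfolding conj_closed_def
  proof (intro allI impI)
    fix x a :: 'a assume x: "x \<noteq> 0" and "a \<in> ?p ` R"
    then obtain A where A: "A \<in> R" "a = ?p A" by blast
    let ?x = "x \<cdot>\<^sub>m 1\<^sub>m 1"
    have xc: "?x \<in> carrier (GL 1)" using scalar_GL_1[OF x] .
    have m: "?x * A \<in> carrier (GL 1)" using GL.m_closed[OF xc Rc[OF A(1)]] by simp
    have "?p (?x * A * inv\<^bsub>GL 1\<^esub> ?x) = x * a * inverse x"
      using GL_1_mult_index[OF m GL.inv_closed[OF xc]] GL_1_mult_index[OF xc Rc[OF A(1)]] GL_1_inv_index[OF xc] A(2)
      by simp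
    moreover have "?x * A * inv\<^bsub>GL 1\<^esub> ?x \<in> R" using normalizesD[OF nor xc A(1)] by simp
    ultimately show "x * a * inverse x \<in> ?p ` R" by (metis imageI)
  qed
qed

lemma GL_1_center_of_index:
  assumes "A \<in> carrier (GL 1)" "A $$ (0, 0) \<in> center (mult_group :: 'a::division_ring monoid)"
  shows "A \<in> center (GL 1)"
proof -
  have "A = A $$ (0, 0) \<cdot>\<^sub>m 1\<^sub>m 1" using GL_carrier_mat[OF assms(1)] by (intro eq_matI) auto
  then show ?thesis using center_GL_iff[of 1 A] assms(2) by auto
qed

text \<open>A conjugate of \<open>p\<close> is \<open>p\<close> preceded by a commutator, and in
  rank one all commutators lie in \<open>SL 1\<close>.\<close>

lemma GL_1_normalizes:
  assumes P: "subgroup P (GL 1)" and SL: "carrier (SL 1) \<subseteq> (P :: 'a::division_ring mat set)"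
  shows "normalizes (GL 1) (carrier (GL 1)) P"
  unfolding normalizes_def
proof (intro ballI)
  fix x p assume x: "x \<in> carrier (GL 1 :: 'a mat monoid)" and p: "p \<in> P"
  have pc: "p \<in> carrier (GL 1)" using subgroup.mem_carrier[OF P p] .
  let ?c = "x \<otimes>\<^bsub>GL 1\<^esub> p \<otimes>\<^bsub>GL 1\<^esub> inv\<^bsub>GL 1\<^esub> x \<otimes>\<^bsub>GL 1\<^esub> inv\<^bsub>GL 1\<^esub> p"
  have c: "?c \<in> carrier (GL 1)" using x pc by (simp del: GL_simps)
  have 1: "x * p \<in> carrier (GL 1)" using GL.m_closed[OF x pc] by simp
  have 2: "x * p * inv\<^bsub>GL 1\<^esub> x \<in> carrier (GL 1)" using GL.m_closed[OF 1 GL.inv_closed[OF x]] by simp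
  have "?c $$ (0, 0) = x $$ (0, 0) * p $$ (0, 0) * inverse (x $$ (0, 0)) * inverse (p $$ (0, 0))"
    using GL_1_mult_index[OF 2 GL.inv_closed[OF pc]] GL_1_mult_index[OF 1 GL.inv_closed[OF x]]
      GL_1_mult_index[OF x pc] GL_1_inv_index[OF x] GL_1_inv_index[OF pc] by simp
  also have "\<dots> \<in> commutator_subgroup"
    using commutator_in_commutator_subgroup[OF GL_diag_nonzero[OF x] GL_diag_nonzero[OF pc]] .
  finally have "?c \<in> P" using carrier_SL_1[OF c] SL by blast
  then have "?c \<otimes>\<^bsub>GL 1\<^esub> p \<in> P" using subgroup.m_closed[OF P _ p] by blast
  moreover have "?c \<otimes>\<^bsub>GL 1\<^esub> p = x \<otimes>\<^bsub>GL 1\<^esub> p \<otimes>\<^bsub>GL 1\<^esub> inv\<^bsub>GL 1\<^esub> x"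
    using x pc by (simp add: GL.m_assoc del: GL_simps)
  ultimately show "x \<otimes>\<^bsub>GL 1\<^esub> p \<otimes>\<^bsub>GL 1\<^esub> inv\<^bsub>GL 1\<^esub> x \<in> P" by simp
qed

text \<open>Both regimes meet here: for \<open>n \<ge> 2\<close> the elementary matrices in
  \<open>SL n\<close> are what \<open>P\<close> must contain, for \<open>n = 1\<close> it is the
  commutator subgroup.\<close>

theorem lf_normal_central:
  fixes N P Z :: "'a::division_ring mat set"
  assumes n: "n > 0" and nf: "n \<ge> 2 \<Longrightarrow> \<not> locally_finite_field TYPE('a)"
    and P: "subgroup P (GL n)" and SL: "carrier (SL n) \<subseteq> P"
    and Z: "subgroup Z (GL n)" "Z \<subseteq> center (GL n)" and N: "GL.lf_normal n Z P N"
  shows "N \<subseteq> center (GL n)"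
proof (cases "n = 1")
  case False
  then have n2: "n \<ge> 2" using n by simp
  have N': "subgroup N (GL n)" "normalizes (GL n) P N" "lf_mod (GL n) Z N" using N unfolding GL.lf_normal_def by blast+
  have en: "elementary_normalized n N P"
    using n2 N'(1) P _ N'(2) by (rule elementary_normalized.intro) (use el_SL SL in blast)
  have "lf_mod (GL n) (center (GL n)) N" using N'(3) Z(2) by (rule lf_mod_mono)
  then show ?thesis using elementary_normalized.lf_mod_imp_central[OF en] nf[OF n2] by blast
next
  case True
  let ?p = "\<lambda>A :: 'a mat. A $$ (0, 0)"
  note N = N[unfolded True] and P = P[unfolded True] and SL = SL[unfolded True] and Z = Z[unfolded True]
  have norP: "normalizes (GL 1) (carrier (GL 1)) P" using GL_1_normalizes[OF P SL] .
  have norZ: "normalizes (GL 1) (carrier (GL 1)) Z"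
    unfolding normalizes_def
  proof (intro ballI)
    fix x z assume x: "x \<in> carrier (GL 1 :: 'a mat monoid)" and z: "z \<in> Z"
    have zc: "z \<in> carrier (GL 1)" "z \<otimes>\<^bsub>GL 1\<^esub> x = x \<otimes>\<^bsub>GL 1\<^esub> z" using z x Z(2) unfolding center_def by auto
    have "x \<otimes>\<^bsub>GL 1\<^esub> z \<otimes>\<^bsub>GL 1\<^esub> inv\<^bsub>GL 1\<^esub> x = z"
      unfolding zc(2)[symmetric] using x zc(1) by (simp add: GL.m_assoc del: GL_simps)
    then show "x \<otimes>\<^bsub>GL 1\<^esub> z \<otimes>\<^bsub>GL 1\<^esub> inv\<^bsub>GL 1\<^esub> x \<in> Z" using z by simp
  qed
  have ZP: "Z \<subseteq> P" using N unfolding GL.lf_normal_def by blast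
  \<comment> \<open>\<open>N\<close> is normalized by \<open>P\<close> only, whereas the rank one
    theorem asks for invariance under the whole multiplicative group. The radical of
    \<open>P\<close> contains \<open>N\<close> and has that invariance, because \<open>P\<close> is
    normal.\<close>
  define R where "R = GL.lf_radical 1 Z P"
  have R: "GL.lf_normal 1 Z P R"
    unfolding R_def using GL.lf_radical[OF P Z(1) ZP normalizes_mono[OF norZ subgroup.subset[OF P]]] .
  have norR: "normalizes (GL 1) (carrier (GL 1)) R"
    unfolding R_def using GL.normalizes_lf_radical[OF P GL.subgroup_self norP norZ] .
  have sR: "subgroup R (GL 1)" "lf_mod (GL 1) Z R" "Z \<subseteq> R" using R unfolding GL.lf_normal_def by auto
  have Rc: "A \<in> carrier (GL 1)" if "A \<in> R" for A using subgroup.mem_carrier[OF sR(1) that] .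
  have "lf_mod mult_group (center mult_group) (?p ` R)"
  proof (rule lf_mod_image[OF sR(2)])
    show "?p (x \<otimes>\<^bsub>GL 1\<^esub> y) = ?p x \<otimes>\<^bsub>mult_group\<^esub> ?p y" if "x \<in> R \<union> Z" "y \<in> R" for x y
      using GL_1_mult_index[of x y] Rc that sR(3) by auto
    show "?p \<one>\<^bsub>GL 1\<^esub> = \<one>\<^bsub>mult_group\<^esub>" by simp
    show "?p ` Z \<subseteq> center mult_group"
    proof
      fix y assume "y \<in> ?p ` Z"
      then obtain A where A: "A \<in> Z" "y = ?p A" by blast
      have "\<exists>l \<in> center mult_group. A = l \<cdot>\<^sub>m 1\<^sub>m 1"
        using A(1) Z(2) by (intro iffD1[OF center_GL_iff]) auto
      then obtain l where "l \<in> center mult_group" "A = l \<cdot>\<^sub>m 1\<^sub>m 1" by (elim bexE) (rule that)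
      then show "y \<in> center mult_group" using A(2) by simp
    qed
  qed
  then have "?p ` R \<subseteq> center mult_group"
    using lf_mod_center_normal_central[OF GL_1_subgroup_image[OF sR(1) norR]] by blast
  then have "R \<subseteq> center (GL 1)" using GL_1_center_of_index[OF Rc] by blast
  moreover have "N \<subseteq> R" unfolding R_def GL.lf_radical_def using N by blast
  ultimately show ?thesis unfolding True by blast
qed

section \<open>Return from quotients by central subgroups\<close>

context group
begin

lemma normal_center_subset:
  assumes Z: "subgroup Z G" "Z \<subseteq> center G"
  shows "Z \<lhd> G"
proof (rule normal_invI[OF Z(1)])
  fix x h assume x: "x \<in> carrier G" and h: "h \<in> Z"
  have c: "h \<in> carrier G" "h \<otimes> x = x \<otimes> h" using h x Z(2) unfolding center_def by blast+
  have "x \<otimes> h \<otimes> inv x = h" unfolding c(2)[symmetric] using x c(1) by (simp add: m_assoc)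
  then show "x \<otimes> h \<otimes> inv x \<in> Z" using h by simp
qed

text \<open>\<open>f\<close> takes full preimages under the quotient map. Local finiteness in the
  quotient becomes local finiteness modulo \<open>Z\<close> in the group, which is the form in which
  \<open>lf_normal_central\<close> accepts it.\<close>

lemma lf_normal_pullback:
  assumes Z: "Z \<lhd> G" and C: "subgroup C (G Mod Z)"
    and M: "group.lf_normal (G Mod Z) {\<one>\<^bsub>G Mod Z\<^esub>} C M"
  defines "f \<equiv> \<lambda>L. {g \<in> carrier G. Z #> g \<in> L}"
  shows "subgroup (f C) G" "lf_normal Z (f C) (f M)"
proof -
  have sZ: "subgroup Z G" using Z by (rule normal_imp_subgroup)
  have Zc: "Z \<subseteq> carrier G" using sZ by (rule subgroup.subset)
  interpret Q: group "G Mod Z" by (rule normal.factorgroup_is_group[OF Z])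
  have hom: "(\<lambda>g. Z #> g) \<in> hom G (G Mod Z)" by (rule normal.r_coset_hom_Mod[OF Z])
  interpret h: group_hom G "G Mod Z" "\<lambda>g. Z #> g"
    by (rule group_hom.intro[OF group_axioms Q.group_axioms]) (rule group_hom_axioms.intro[OF hom])
  have M': "subgroup M (G Mod Z)" "\<one>\<^bsub>G Mod Z\<^esub> \<in> M" "M \<subseteq> C" "normalizes (G Mod Z) C M"
    "lf_mod (G Mod Z) {\<one>\<^bsub>G Mod Z\<^esub>} M"
    using M unfolding Q.lf_normal_def by blast+
  have fI: "g \<in> f L" if "g \<in> carrier G" "Z #> g \<in> L" for g L using that unfolding f_def by blast
  have fD: "g \<in> carrier G" "Z #> g \<in> L" if "g \<in> f L" for g L using that unfolding f_def by blast+
  have sub: "subgroup (f L) G" if L: "subgroup L (G Mod Z)" for L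
  proof (rule subgroupI)
    show "f L \<subseteq> carrier G" unfolding f_def by blast
    have "\<one> \<in> f L" using subgroup.one_closed[OF L] by (intro fI one_closed) (simp only: h.hom_one)
    then show "f L \<noteq> {}" by blast
    show "inv a \<in> f L" if "a \<in> f L" for a
    proof (rule fI)
      show "Z #> inv a \<in> L" unfolding h.hom_inv[OF fD(1)[OF that]] by (rule subgroup.m_inv_closed[OF L fD(2)[OF that]])
    qed (rule inv_closed[OF fD(1)[OF that]])
    show "a \<otimes> b \<in> f L" if ab: "a \<in> f L" "b \<in> f L" for a b
    proof (rule fI)
      show "Z #> (a \<otimes> b) \<in> L" unfolding h.hom_mult[OF fD(1)[OF ab(1)] fD(1)[OF ab(2)]]
        by (rule subgroup.m_closed[OF L fD(2)[OF ab(1)] fD(2)[OF ab(2)]])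
    qed (rule m_closed[OF fD(1)[OF ab(1)] fD(1)[OF ab(2)]])
  qed
  show "subgroup (f C) G" using C by (rule sub)
  have ZI: "z \<in> Z \<longleftrightarrow> Z #> z = \<one>\<^bsub>G Mod Z\<^esub>" if "z \<in> carrier G" for z
    using coset_join1[OF _ that sZ] coset_join2[OF that sZ] by (auto simp: FactGroup_def)
  show "lf_normal Z (f C) (f M)"
    unfolding lf_normal_def
  proof (intro conjI)
    show "subgroup (f M) G" using M'(1) by (rule sub)
    show "Z \<subseteq> f M"
    proof
      fix z assume z: "z \<in> Z"
      then have "Z #> z = \<one>\<^bsub>G Mod Z\<^esub>" using ZI Zc by blast
      then show "z \<in> f M" using M'(2) z Zc by (intro fI) auto
    qed
    show "f M \<subseteq> f C" using M'(3) unfolding f_def by blast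
    show "normalizes G (f C) (f M)"
      unfolding normalizes_def
    proof (intro ballI)
      fix b m assume b: "b \<in> f C" and m: "m \<in> f M"
      note bc = fD[OF b] and mc = fD[OF m]
      have "Z #> (b \<otimes> m \<otimes> inv b) = (Z #> b) \<otimes>\<^bsub>G Mod Z\<^esub> (Z #> m) \<otimes>\<^bsub>G Mod Z\<^esub> inv\<^bsub>G Mod Z\<^esub> (Z #> b)"
        unfolding h.hom_mult[OF m_closed[OF bc(1) mc(1)] inv_closed[OF bc(1)]] h.hom_mult[OF bc(1) mc(1)]
          h.hom_inv[OF bc(1)] ..
      then have "Z #> (b \<otimes> m \<otimes> inv b) \<in> M" using normalizesD[OF M'(4) bc(2) mc(2)] by (simp only:)
      then show "b \<otimes> m \<otimes> inv b \<in> f M" using bc(1) mc(1) by (intro fI) simp_all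
    qed
    show "lf_mod G Z (f M)"
      unfolding lf_mod_def
    proof (intro allI impI)
      fix A assume A: "finite A \<and> A \<subseteq> f M"
      have A': "finite ((\<lambda>g. Z #> g) ` A)" "(\<lambda>g. Z #> g) ` A \<subseteq> M" using A fD(2) by blast+
      obtain T where T: "finite T" "T \<subseteq> M" "\<one>\<^bsub>G Mod Z\<^esub> \<in> T"
        "\<And>t a. t \<in> T \<Longrightarrow> a \<in> (\<lambda>g. Z #> g) ` A \<Longrightarrow>
          \<exists>z \<in> {\<one>\<^bsub>G Mod Z\<^esub>}. \<exists>t' \<in> T. t \<otimes>\<^bsub>G Mod Z\<^esub> a = z \<otimes>\<^bsub>G Mod Z\<^esub> t'"
        by (rule lf_modD[OF M'(5) A']) (rule that)
      have Tc: "t \<in> carrier (G Mod Z)" if "t \<in> T" for t using that T(2) subgroup.subset[OF M'(1)] by blast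
      \<comment> \<open>The trivial coset is represented by \<open>\<one>\<close>, as the definition
        of \<open>lf_mod\<close> requires.\<close>
      define r where "r c = (if c = \<one>\<^bsub>G Mod Z\<^esub> then \<one> else (SOME g. g \<in> carrier G \<and> Z #> g = c))" for c
      have r: "r c \<in> carrier G \<and> Z #> r c = c" if c: "c \<in> T" for c
      proof (cases "c = \<one>\<^bsub>G Mod Z\<^esub>")
        case True
        then show ?thesis unfolding r_def using h.hom_one by simp
      next
        case False
        have "\<exists>g. g \<in> carrier G \<and> Z #> g = c"
          using Tc[OF c] unfolding FactGroup_def RCOSETS_def by auto
        from someI_ex[OF this] show ?thesis unfolding r_def by (simp only: False if_False)
      qed
      have "finite (r ` T)" using T(1) by blast
      moreover have "r ` T \<subseteq> f M"
      proof
        fix g assume "g \<in> r ` T"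
        then obtain c where c: "c \<in> T" "g = r c" by blast
        have "Z #> g \<in> M" unfolding c(2) r[OF c(1), THEN conjunct2] using c(1) T(2) by blast
        then show "g \<in> f M" using r[OF c(1)] c(2) by (intro fI) simp_all
      qed
      moreover have "\<one> \<in> r ` T" using T(3) unfolding r_def by force
      moreover have "\<forall>t \<in> r ` T. \<forall>a \<in> A. \<exists>z \<in> Z. \<exists>t' \<in> r ` T. t \<otimes> a = z \<otimes> t'"
      proof (intro ballI)
        fix t a assume "t \<in> r ` T" and a: "a \<in> A"
        then obtain c where c: "c \<in> T" "t = r c" by blast
        have ac: "a \<in> carrier G" using a A fD(1) by blast
        have "\<exists>t' \<in> T. c \<otimes>\<^bsub>G Mod Z\<^esub> (Z #> a) = \<one>\<^bsub>G Mod Z\<^esub> \<otimes>\<^bsub>G Mod Z\<^esub> t'"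
          using T(4)[OF c(1) imageI[OF a]] by (elim bexE) (drule singletonD, hypsubst, rule bexI)
        then obtain c' where c': "c' \<in> T" "c \<otimes>\<^bsub>G Mod Z\<^esub> (Z #> a) = \<one>\<^bsub>G Mod Z\<^esub> \<otimes>\<^bsub>G Mod Z\<^esub> c'"
          by (elim bexE) (rule that)
        note rc = r[OF c(1)] and rc' = r[OF c'(1)]
        have tc: "t \<in> carrier G" using rc c(2) by blast
        let ?z = "t \<otimes> a \<otimes> inv (r c')"
        have zc: "?z \<in> carrier G" using tc ac rc' by blast
        have "Z #> (t \<otimes> a) = c'"
        proof -
          have "Z #> (t \<otimes> a) = (Z #> t) \<otimes>\<^bsub>G Mod Z\<^esub> (Z #> a)" using tc ac by (rule h.hom_mult)
          also have "\<dots> = c \<otimes>\<^bsub>G Mod Z\<^esub> (Z #> a)" unfolding c(2) rc[THEN conjunct2] ..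
          also have "\<dots> = c'" unfolding c'(2) using Tc[OF c'(1)] by (rule Q.l_one)
          finally show ?thesis .
        qed
        then have "Z #> ?z = c' \<otimes>\<^bsub>G Mod Z\<^esub> inv\<^bsub>G Mod Z\<^esub> c'"
          unfolding h.hom_mult[OF m_closed[OF tc ac] inv_closed[OF rc'[THEN conjunct1]]]
            h.hom_inv[OF rc'[THEN conjunct1]] rc'[THEN conjunct2] by (rule arg_cong)
        also have "\<dots> = \<one>\<^bsub>G Mod Z\<^esub>" using Tc[OF c'(1)] by (rule Q.r_inv)
        finally have "?z \<in> Z" using ZI[OF zc] by blast
        moreover have "t \<otimes> a = ?z \<otimes> r c'" using tc ac rc' by (simp add: m_assoc)
        ultimately show "\<exists>z \<in> Z. \<exists>t' \<in> r ` T. t \<otimes> a = z \<otimes> t'" using c'(1) by blast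
      qed
      ultimately show "\<exists>T. finite T \<and> T \<subseteq> f M \<and> \<one> \<in> T \<and> (\<forall>t \<in> T. \<forall>a \<in> A. \<exists>z \<in> Z. \<exists>t' \<in> T. t \<otimes> a = z \<otimes> t')"
        by (intro exI[of _ "r ` T"] conjI)
    qed
  qed
qed

end

lemma ascendant_subset:
  assumes "ascendant H G"
  shows "subgroup H G"
proof -
  from assms obtain r :: "'a set rel" and S where
    ser: "ascending_series G (\<lambda>A B. A \<lhd> G\<lparr>carrier := B\<rparr>) r S H (carrier G)"
    unfolding ascendant_def by (elim exE) (rule that)
  note s = ser[unfolded ascending_series_def, THEN conjunct2]
  from s[THEN conjunct2, THEN conjunct1] obtain z where z: "z \<in> Field r" "S z = H"
    by (elim bexE conjE) (rule that)
  show ?thesis using bspec[OF s[THEN conjunct1] z(1)] unfolding z(2) .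
qed

lemma commutator_subgroup_nonzero: "b \<in> commutator_subgroup \<Longrightarrow> b \<noteq> (0 :: 'a::division_ring)"
  using subgroup.mem_carrier[OF subgroup_commutator_subgroup] by fastforce

lemma commutator_subgroup_conj:
  assumes x: "x \<noteq> (0 :: 'a::division_ring)" and b: "b \<in> commutator_subgroup"
  shows "x * b * inverse x \<in> commutator_subgroup"
proof -
  have b0: "b \<noteq> 0" using commutator_subgroup_nonzero[OF b] .
  have "(x * b * inverse x * inverse b) \<otimes>\<^bsub>mult_group\<^esub> b \<in> commutator_subgroup"
    using subgroup.m_closed[OF subgroup_commutator_subgroup commutator_in_commutator_subgroup[OF x b0] b] .
  then show ?thesis using b0 by (simp add: mult.assoc)
qed

text \<open>The centre of the commutator subgroup is commutative and invariant under conjugation by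
  all nonzero elements, so \<open>abelian_normal_central\<close> applies to it.\<close>

lemma center_commutator_subgroup_central:
  assumes a: "a \<in> commutator_subgroup" and cm: "\<And>b. b \<in> commutator_subgroup \<Longrightarrow> a * b = b * (a :: 'a::division_ring)"
  shows "a * x = x * a"
proof -
  define S where "S = {a \<in> commutator_subgroup. \<forall>b \<in> commutator_subgroup. a * b = b * (a :: 'a)}"
  have SD: "a \<in> commutator_subgroup" "\<forall>b \<in> commutator_subgroup. a * b = b * a" if "a \<in> S" for a
    using that unfolding S_def by blast+
  have "conj_closed S"
    unfolding conj_closed_def
  proof (intro allI impI)
    fix x a :: 'a assume x: "x \<noteq> 0" and a: "a \<in> S"
    have "x * a * inverse x * b = b * (x * a * inverse x)" if b: "b \<in> commutator_subgroup" for b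
    proof -
      have "inverse x * b * inverse (inverse x) \<in> commutator_subgroup"
        using commutator_subgroup_conj[of "inverse x", OF _ b] x by simp
      then have c: "a * (inverse x * b * x) = inverse x * b * x * a"
        using SD(2)[OF a] x by simp
      have "x * a * inverse x * b = x * (a * (inverse x * b * x)) * inverse x"
        using x by (simp add: mult.assoc)
      also have "\<dots> = (x * inverse x) * b * (x * a * inverse x)" unfolding c by (simp only: mult.assoc)
      finally show ?thesis using x by simp
    qed
    then show "x * a * inverse x \<in> S"
      using commutator_subgroup_conj[OF x SD(1)[OF a]] unfolding S_def by blast
  qed
  moreover have "a * b = b * a" if "a \<in> S" "b \<in> S" for a b
    using bspec[OF SD(2)[OF that(1)] SD(1)[OF that(2)]] .
  moreover have "a \<in> S" unfolding S_def using a cm by blast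
  ultimately show ?thesis by (rule abelian_normal_central)
qed

lemma power_mult_central:
  assumes "\<And>x :: 'a::division_ring. l * x = x * l"
  shows "(l * m) ^ k = l ^ k * m ^ k"
proof (induction k)
  case (Suc k)
  have "l * m * (l ^ k * m ^ k) = l * (m * l ^ k) * m ^ k" by (simp add: mult.assoc)
  also have "m * l ^ k = l ^ k * m" by (rule power_commuting_commutes[symmetric]) (rule assms)
  finally show ?case using Suc by (simp add: mult.assoc)
qed simp

text \<open>For \<open>n \<ge> 2\<close> the elementary matrices in \<open>SL n\<close> already
  force an element of its centre to be a central scalar; for \<open>n = 1\<close> this is
  \<open>center_commutator_subgroup_central\<close>.\<close>

lemma center_SL_eq:
  assumes n: "n > 0"
  shows "center (SL n) = carrier (SL n) \<inter> center (GL n :: 'a::division_ring mat monoid)"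
proof
  have sub: "carrier (SL n) \<subseteq> carrier (GL n :: 'a mat monoid)" unfolding carrier_SL subset_iff by blast
  have m: "x \<otimes>\<^bsub>SL n\<^esub> y = x * (y :: 'a mat)" for x y unfolding SL_def by simp
  show "carrier (SL n) \<inter> center (GL n :: 'a mat monoid) \<subseteq> center (SL n)"
    using sub unfolding center_def m GL_simps by blast
  show "center (SL n) \<subseteq> carrier (SL n) \<inter> center (GL n :: 'a mat monoid)"
  proof
    fix A :: "'a mat" assume "A \<in> center (SL n)"
    then have A: "A \<in> carrier (SL n)" and cm: "\<forall>B \<in> carrier (SL n). A * B = B * A"
      unfolding center_def m by blast+
    note cm = bspec[OF cm]
    have Ac: "A \<in> carrier (GL n)" using A sub by blast
    have el: "el n i j c * A = A * el n i j c" if "i < n" "j < n" "i \<noteq> j" for i j c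
      by (rule cm[OF el_SL[OF that], symmetric])
    have one: "\<forall>c. A $$ (0, 0) * c = c * A $$ (0, 0)" if n1: "n = 1"
    proof
      note A1 = A[unfolded n1] and Ac1 = Ac[unfolded n1]
      have a: "A $$ (0, 0) \<in> commutator_subgroup" using A1 unfolding carrier_SL_1[OF Ac1] .
      have "A $$ (0, 0) * b = b * A $$ (0, 0)" if b: "b \<in> commutator_subgroup" for b
      proof -
        let ?B = "b \<cdot>\<^sub>m 1\<^sub>m 1"
        have Bc: "?B \<in> carrier (GL 1)" by (rule scalar_GL_1[OF commutator_subgroup_nonzero[OF b]])
        have "?B \<in> carrier (SL 1)" unfolding carrier_SL_1[OF Bc] using b by simp
        then have "A * ?B = ?B * A" by (rule cm[unfolded n1])
        then have "(A * ?B) $$ (0, 0) = (?B * A) $$ (0, 0)" by (rule arg_cong)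
        then show ?thesis unfolding GL_1_mult_index[OF Ac1 Bc] GL_1_mult_index[OF Bc Ac1] by simp
      qed
      then show "A $$ (0, 0) * c = c * A $$ (0, 0)" for c
        by (rule center_commutator_subgroup_central[OF a])
    qed
    have "A = A $$ (0, 0) \<cdot>\<^sub>m 1\<^sub>m n" by (rule commutes_el_scalar(1)[OF n Ac]) ((rule el; assumption) | (rule one; assumption))+
    moreover have "A $$ (0, 0) \<in> center mult_group"
      by (rule commutes_el_scalar(2)[OF n Ac]) ((rule el; assumption) | (rule one; assumption))+
    ultimately have "A \<in> center (GL n)" unfolding center_GL_iff[OF n] by (rule bexI)
    then show "A \<in> carrier (SL n) \<inter> center (GL n)" using A by blast
  qed
qed

lemma center_SL_iff:
  assumes n: "n > 0"
  shows "A \<in> center (SL n) \<longleftrightarrow>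
    (\<exists>l \<in> center mult_group. l ^ n \<in> commutator_subgroup \<and> A = l \<cdot>\<^sub>m (1\<^sub>m n :: 'a::division_ring mat))"
proof -
  have "A \<in> carrier (SL n) \<longleftrightarrow> l ^ n \<in> commutator_subgroup"
    if l: "l \<in> center mult_group" and A: "A = l \<cdot>\<^sub>m 1\<^sub>m n" for l
  proof -
    have "A \<in> center (GL n)" unfolding center_GL_iff[OF n] using l A by (rule bexI[rotated])
    then have "A \<in> carrier (GL n)" unfolding center_def by blast
    moreover have "l \<noteq> 0" using l unfolding center_mult_group by (rule conjunct1)
    ultimately show ?thesis unfolding carrier_SL A by (simp add: dieudonne_rep_scalar)
  qed
  then show ?thesis unfolding center_SL_eq[OF n] Int_iff center_GL_iff[OF n] by (meson)
qed

lemma scalar_mult: "(l \<cdot>\<^sub>m 1\<^sub>m n) * (m \<cdot>\<^sub>m 1\<^sub>m n) = (l * m) \<cdot>\<^sub>m (1\<^sub>m n :: 'a::division_ring mat)"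
proof (rule eq_matI)
  fix i j assume "i < dim_row ((l * m) \<cdot>\<^sub>m (1\<^sub>m n :: 'a mat))" "j < dim_col ((l * m) \<cdot>\<^sub>m (1\<^sub>m n :: 'a mat))"
  then have ij: "i < n" "j < n" by simp_all
  have "((l \<cdot>\<^sub>m 1\<^sub>m n) * (m \<cdot>\<^sub>m 1\<^sub>m n)) $$ (i, j) = (\<Sum>k<n. single i l k * (m \<cdot>\<^sub>m 1\<^sub>m n) $$ (k, j))"
    by (subst mat_mult_index[of _ n]) (use ij in \<open>auto simp: single_def intro!: sum.cong\<close>)
  also have "\<dots> = l * (m \<cdot>\<^sub>m 1\<^sub>m n) $$ (i, j)" using ij by simp
  also have "\<dots> = ((l * m) \<cdot>\<^sub>m 1\<^sub>m n) $$ (i, j)" using ij by simp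
  finally show "((l \<cdot>\<^sub>m 1\<^sub>m n) * (m \<cdot>\<^sub>m 1\<^sub>m n)) $$ (i, j) = ((l * m) \<cdot>\<^sub>m 1\<^sub>m n) $$ (i, j)" .
qed simp_all

text \<open>On central scalars \<open>dieudonne_rep\<close> is the \<open>n\<close>-th power, hence
  multiplicative, which gives closure directly from \<open>center_SL_iff\<close>.\<close>

lemma subgroup_center_SL:
  assumes n: "n > 0"
  shows "subgroup (center (SL n)) (GL n :: 'a::division_ring mat monoid)"
proof (rule GL.subgroupI)
  let ?Z = "center (SL n :: 'a mat monoid)"
  note iff = center_SL_iff[OF n]
  have zI: "l \<cdot>\<^sub>m 1\<^sub>m n \<in> ?Z" if "l \<in> center mult_group" "l ^ n \<in> commutator_subgroup" for l
    unfolding iff using that by (intro bexI[of _ l] conjI refl)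
  show sub: "?Z \<subseteq> carrier (GL n)" unfolding center_SL_eq[OF n] by (auto simp: carrier_SL)
  have "1 \<cdot>\<^sub>m 1\<^sub>m n \<in> ?Z"
    using subgroup.one_closed[OF subgroup_center_mult_group] subgroup.one_closed[OF subgroup_commutator_subgroup]
    by (intro zI) simp_all
  then show "?Z \<noteq> {}" by blast
  show "A \<otimes>\<^bsub>GL n\<^esub> B \<in> ?Z" if AB: "A \<in> ?Z" "B \<in> ?Z" for A B
  proof -
    obtain l where l: "l \<in> center mult_group" "l ^ n \<in> commutator_subgroup" "A = l \<cdot>\<^sub>m 1\<^sub>m n"
      using AB(1) unfolding iff by (elim bexE conjE) (rule that)
    obtain m where m: "m \<in> center mult_group" "m ^ n \<in> commutator_subgroup" "B = m \<cdot>\<^sub>m 1\<^sub>m n"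
      using AB(2) unfolding iff by (elim bexE conjE) (rule that)
    have lc: "l * x = x * l" for x
      using l(1)[unfolded center_mult_group, THEN conjunct2] by (rule spec)
    have "(l * m) ^ n = l ^ n * m ^ n" by (rule power_mult_central) (rule lc)
    then have "(l * m) ^ n \<in> commutator_subgroup"
      using subgroup.m_closed[OF subgroup_commutator_subgroup l(2) m(2)] by simp
    moreover have "l * m \<in> center mult_group"
      using subgroup.m_closed[OF subgroup_center_mult_group l(1) m(1)] by simp
    ultimately show ?thesis unfolding l(3) m(3) GL_simps scalar_mult by (intro zI)
  qed
  show "inv\<^bsub>GL n\<^esub> A \<in> ?Z" if A: "A \<in> ?Z" for A
  proof -
    obtain l where l: "l \<in> center mult_group" "l ^ n \<in> commutator_subgroup" "A = l \<cdot>\<^sub>m 1\<^sub>m n"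
      using A unfolding iff by (elim bexE conjE) (rule that)
    have l0: "l \<noteq> 0" using l(1) unfolding center_mult_group by (rule conjunct1)
    have "1 \<cdot>\<^sub>m 1\<^sub>m n = (1\<^sub>m n :: 'a mat)" by (rule eq_matI) simp_all
    then have "inv\<^bsub>GL n\<^esub> A = inverse l \<cdot>\<^sub>m 1\<^sub>m n"
      unfolding l(3) using l0 by (intro GL_inv_eqI(3)) (simp_all add: scalar_mult)
    moreover have "inverse l \<in> center mult_group"
      using subgroup.m_inv_closed[OF subgroup_center_mult_group l(1)] l0 by simp
    moreover have "inverse l ^ n \<in> commutator_subgroup"
      using subgroup.m_inv_closed[OF subgroup_commutator_subgroup l(2)] l0 by (simp add: power_inverse)
    ultimately show ?thesis using zI by simp
  qed
qed

text \<open>One argument for both projective groups, with \<open>PSL n\<close> seen as the image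
  \<open>C\<close> of \<open>P = carrier (SL n)\<close> in the quotient of \<open>GL n\<close> by
  the centre of \<open>SL n\<close>. The hypothesis that \<open>P \<inter> center (GL n)\<close>
  lies in \<open>Z\<close> turns centrality of the preimage into triviality in the quotient.\<close>

lemma ascendant_in_quotient_trivial:
  fixes n :: nat and P Z :: "'a::division_ring mat set"
  assumes n: "n > 0" and nf: "n \<ge> 2 \<Longrightarrow> \<not> locally_finite_field TYPE('a)"
    and Z: "subgroup Z (GL n)" "Z \<subseteq> center (GL n)" and P: "carrier (SL n) \<subseteq> P" "P \<inter> center (GL n) \<subseteq> Z"
    and C: "C = (\<lambda>g. Z #>\<^bsub>GL n\<^esub> g) ` P" "P \<subseteq> carrier (GL n)"
    and H: "subgroup H ((GL n Mod Z)\<lparr>carrier := C\<rparr>)"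
      "periodic_group ((GL n Mod Z)\<lparr>carrier := H\<rparr>)"
      "locally_group generalized_radical ((GL n Mod Z)\<lparr>carrier := H\<rparr>)"
      "ascendant H ((GL n Mod Z)\<lparr>carrier := C\<rparr>)"
  shows "H = {\<one>\<^bsub>GL n Mod Z\<^esub>}"
proof -
  let ?Q = "GL n Mod Z"
  let ?f = "\<lambda>L. {g \<in> carrier (GL n). Z #>\<^bsub>GL n\<^esub> g \<in> L}"
  have nZ: "Z \<lhd> GL n" using Z by (rule GL.normal_center_subset)
  interpret Q: group ?Q by (rule normal.factorgroup_is_group[OF nZ])
  have Cc: "C \<subseteq> carrier ?Q" using C unfolding FactGroup_def RCOSETS_def by auto
  note asc = Q.ascendant_locally_radical_periodic[OF Cc H]
  obtain M where M: "Q.lf_normal {\<one>\<^bsub>?Q\<^esub>} C M" "H \<subseteq> M"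
    using asc(2) by (elim exE conjE) (rule that)
  note pb = GL.lf_normal_pullback[OF nZ asc(1) M(1)]
  have SLP: "carrier (SL n) \<subseteq> ?f C"
  proof
    fix w :: "'a mat" assume w: "w \<in> carrier (SL n)"
    then have "w \<in> P" using P(1) by blast
    then show "w \<in> ?f C" using C by blast
  qed
  have Nc: "?f M \<subseteq> center (GL n)" by (rule lf_normal_central[OF n nf pb(1) SLP Z pb(2)])
  have "c = \<one>\<^bsub>?Q\<^esub>" if c: "c \<in> H" for c
  proof -
    have "c \<in> C" using subgroup.mem_carrier[OF H(1) c] by simp
    then obtain w where w: "w \<in> P" "c = Z #>\<^bsub>GL n\<^esub> w" unfolding C(1) by blast
    have wc: "w \<in> carrier (GL n)" using w(1) C(2) by blast
    have "w \<in> ?f M" using M(2) c w(2) wc by blast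
    then have "w \<in> Z" using Nc P(2) w(1) by blast
    then have "Z #>\<^bsub>GL n\<^esub> w = Z" by (rule GL.coset_join2[OF wc Z(1)])
    then show ?thesis unfolding w(2) FactGroup_def by simp
  qed
  moreover have "\<one>\<^bsub>?Q\<^esub> \<in> H" using subgroup.one_closed[OF H(1)] by simp
  ultimately show ?thesis by blast
qed

theorem theorem4p9:
  fixes n :: nat and G :: "'a::division_ring mat set"
  assumes "n > 0"
    and "n \<ge> 2 \<Longrightarrow> \<not> locally_finite_field TYPE('a)"
    and "subgroup G (GL n)"
  shows "(periodic_group ((GL n)\<lparr>carrier := G\<rparr>) \<and>
          locally_group generalized_radical ((GL n)\<lparr>carrier := G\<rparr>) \<and>
          ascendant G (GL n)
            \<longrightarrow> G \<subseteq> center (GL n)) \<and>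
         (periodic_group ((SL n)\<lparr>carrier := G\<rparr>) \<and>
          locally_group generalized_radical ((SL n)\<lparr>carrier := G\<rparr>) \<and>
          ascendant G (SL n)
            \<longrightarrow> G \<subseteq> center (SL n)) \<and>
         \<not> (\<exists>H. subgroup H (PGL n :: 'a mat set monoid) \<and>
              H \<noteq> {\<one>\<^bsub>PGL n\<^esub>} \<and>
              periodic_group ((PGL n)\<lparr>carrier := H\<rparr>) \<and>
              locally_group generalized_radical ((PGL n)\<lparr>carrier := H\<rparr>) \<and>
              ascendant H (PGL n)) \<and>
         \<not> (\<exists>H. subgroup H (PSL n :: 'a mat set monoid) \<and>
              H \<noteq> {\<one>\<^bsub>PSL n\<^esub>} \<and>
              periodic_group ((PSL n)\<lparr>carrier := H\<rparr>) \<and>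
              locally_group generalized_radical ((PSL n)\<lparr>carrier := H\<rparr>) \<and>
              ascendant H (PSL n))"
proof -
  let ?G = "GL n :: 'a mat monoid"
  have one: "subgroup {\<one>\<^bsub>?G\<^esub>} ?G" "{\<one>\<^bsub>?G\<^esub>} \<subseteq> center ?G"
    by (rule GL.triv_subgroup) (unfold center_def, simp del: GL_simps)
  \<comment> \<open>Used with \<open>C\<close> the carrier of \<open>GL n\<close> for (1) and that
    of \<open>SL n\<close> for (2).\<close>
  have central: "H \<subseteq> center ?G"
    if SL: "carrier (SL n) \<subseteq> C" and C: "C \<subseteq> carrier ?G"
      and H: "periodic_group (?G\<lparr>carrier := H\<rparr>)" "locally_group generalized_radical (?G\<lparr>carrier := H\<rparr>)"
        "ascendant H (?G\<lparr>carrier := C\<rparr>)" for C H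
  proof -
    note asc = GL.ascendant_locally_radical_periodic[OF C ascendant_subset[OF H(3)] H]
    obtain M where M: "GL.lf_normal n {\<one>\<^bsub>?G\<^esub>} C M" "H \<subseteq> M"
      using asc(2) by (elim exE conjE) (rule that)
    have "M \<subseteq> center ?G" by (rule lf_normal_central[OF assms(1,2) asc(1) SL one M(1)])
    then show ?thesis using M(2) by blast
  qed
  have SLG: "carrier (SL n) \<subseteq> carrier ?G" unfolding carrier_SL subset_iff by blast
  have SLH: "(SL n)\<lparr>carrier := H\<rparr> = ?G\<lparr>carrier := H\<rparr>" for H unfolding SL_def by simp
  have 1: "G \<subseteq> center ?G" if "periodic_group (?G\<lparr>carrier := G\<rparr>)"
    "locally_group generalized_radical (?G\<lparr>carrier := G\<rparr>)" "ascendant G ?G"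
  proof (rule central[OF SLG subset_refl that(1,2)])
    show "ascendant G (?G\<lparr>carrier := carrier ?G\<rparr>)" using that(3) by simp
  qed
  have 2: "G \<subseteq> center (SL n)" if H: "periodic_group ((SL n)\<lparr>carrier := G\<rparr>)"
    "locally_group generalized_radical ((SL n)\<lparr>carrier := G\<rparr>)" "ascendant G (SL n)"
  proof -
    have "ascendant G (?G\<lparr>carrier := carrier (SL n)\<rparr>)" using H(3) unfolding SL_record[symmetric] .
    then have "G \<subseteq> center ?G" by (rule central[OF subset_refl SLG H(1,2)[unfolded SLH]])
    moreover have "G \<subseteq> carrier (SL n)" using ascendant_subset[OF H(3)] by (rule subgroup.subset)
    ultimately show ?thesis unfolding center_SL_eq[OF assms(1)] by blast
  qed
  have 3: "H = {\<one>\<^bsub>PGL n\<^esub>}" if H: "subgroup H (PGL n :: 'a mat set monoid)"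
    "periodic_group ((PGL n)\<lparr>carrier := H\<rparr>)"
    "locally_group generalized_radical ((PGL n)\<lparr>carrier := H\<rparr>)" "ascendant H (PGL n)" for H
    unfolding PGL_def
  proof (rule ascendant_in_quotient_trivial[OF assms(1,2) GL.subgroup_center subset_refl SLG Int_lower2 refl subset_refl])
    have e: "(?G Mod center ?G)\<lparr>carrier := (\<lambda>g. center ?G #>\<^bsub>?G\<^esub> g) ` carrier ?G\<rparr> = PGL n"
      unfolding PGL_def by (auto simp: FactGroup_def RCOSETS_def)
    show "subgroup H ((?G Mod center ?G)\<lparr>carrier := (\<lambda>g. center ?G #>\<^bsub>?G\<^esub> g) ` carrier ?G\<rparr>)"
      "ascendant H ((?G Mod center ?G)\<lparr>carrier := (\<lambda>g. center ?G #>\<^bsub>?G\<^esub> g) ` carrier ?G\<rparr>)"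
      unfolding e by (rule H(1), rule H(4))
  qed (use H(2,3) in \<open>unfold PGL_def\<close>)
  have 4: "H = {\<one>\<^bsub>PSL n\<^esub>}" if H: "subgroup H (PSL n :: 'a mat set monoid)"
    "periodic_group ((PSL n)\<lparr>carrier := H\<rparr>)"
    "locally_group generalized_radical ((PSL n)\<lparr>carrier := H\<rparr>)" "ascendant H (PSL n)" for H
  proof -
    let ?Z = "center (SL n) :: 'a mat set"
    let ?C = "(\<lambda>g. ?Z #>\<^bsub>?G\<^esub> g) ` carrier (SL n)"
    have m: "x \<otimes>\<^bsub>SL n\<^esub> y = x \<otimes>\<^bsub>?G\<^esub> y" for x y unfolding SL_def by simp
    \<comment> \<open>Cosets of the centre of \<open>SL n\<close> by elements of \<open>SL n\<close>
      are the same sets whether formed in \<open>SL n\<close> or in \<open>GL n\<close>, so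
      \<open>PSL n\<close> is literally a restriction of a quotient of \<open>GL n\<close>.\<close>
    have e: "PSL n = (?G Mod ?Z)\<lparr>carrier := ?C\<rparr>"
      unfolding PSL_def FactGroup_def RCOSETS_def r_coset_def set_mult_def m by (auto simp: fun_eq_iff)
    have e': "(PSL n)\<lparr>carrier := H\<rparr> = (?G Mod ?Z)\<lparr>carrier := H\<rparr>" "\<one>\<^bsub>PSL n\<^esub> = \<one>\<^bsub>?G Mod ?Z\<^esub>"
      unfolding e by simp_all
    have Z: "?Z \<subseteq> center ?G" "carrier (SL n) \<inter> center ?G \<subseteq> ?Z" unfolding center_SL_eq[OF assms(1)] by blast+
    show ?thesis
      unfolding e'(2)
      by (rule ascendant_in_quotient_trivial[OF assms(1,2) subgroup_center_SL[OF assms(1)] Z(1) subset_refl Z(2) refl SLG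
            H(1)[unfolded e] H(2,3)[unfolded e'(1)] H(4)[unfolded e]])
  qed
  show ?thesis
    by (intro conjI impI notI; elim exE conjE) (use 1 2 3 4 in blast)+
qed

end
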